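(* Let $G$ be a finitely generated group of polynomial growth, and let $\mu$ be an adapted, smooth and Abelian-centered probability measure on $G$ (no symmetry or finite support assumed). Then there is a linear isomorphism $$\mathrm{HF}_1(G,\mu)\cong\mathrm{LHF}(G,\mu).$$
   Context: Fix a finite symmetric generating set $S$ of $G$ and let $|x|$ be the word length. $\mu$ is adapted if the semigroup generated by $\mathrm{supp}(\mu)$ is $G$; smooth if $\sum_x\mu(x)e^{\zeta|x|}<\infty$ for some $\zeta>0$; Abelian-centered if $\sum_g\mu(g)[g]=0$ in $G_{\mathrm{ab}}\otimes_{\mathbb Z}\mathbb R$, where $G_{\mathrm{ab}}=G/[G,G]$ and $[g]$ is the class of $g$. $f:G\to\mathbb C$ is $\mu$-harmonic if $f(k)=\sum_g\mu(g)f(kg)$ (absolutely convergent) for all $k$. $\mathrm{LHF}(G,\mu)$ is the space of $\mu$-harmonic $f$ with $\sup_{s\in S,x\in G}|f(xs)-f(x)|<\infty$. $\mathrm{HF}_1(G,\mu)$ is the space of $\mu$-harmonic $f$ with $\limsup_{r\to\infty}r^{-1}\max_{|x|\le r}|f(x)|<\infty$. *)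

theory Defs
  imports "HOL-Algebra.Free_Abelian_Groups" "HOL-Algebra.Generated_Groups"
    "HOL-Probability.Probability"
begin

definition symmetric_generating_set :: "('a, 'm) monoid_scheme \<Rightarrow> 'a set \<Rightarrow> bool" where
  "symmetric_generating_set G S \<longleftrightarrow>
     S \<subseteq> carrier G \<and> (\<forall>s\<in>S. inv\<^bsub>G\<^esub> s \<in> S) \<and> generate G S = carrier G"

text \<open>As \<open>S\<close> is closed under inverses, words in the letters of \<open>S\<close> alone suffice. The value is
  only meaningful for elements that are represented by such a word.\<close>

definition word_length :: "('a, 'm) monoid_scheme \<Rightarrow> 'a set \<Rightarrow> 'a \<Rightarrow> nat" where
  "word_length G S x =
     (LEAST n. \<exists>w. set w \<subseteq> S \<and> length w = n \<and> foldr (\<lambda>s y. s \<otimes>\<^bsub>G\<^esub> y) w \<one>\<^bsub>G\<^esub> = x)"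

definition word_ball :: "('a, 'm) monoid_scheme \<Rightarrow> 'a set \<Rightarrow> nat \<Rightarrow> 'a set" where
  "word_ball G S r = {x \<in> carrier G. word_length G S x \<le> r}"

definition polynomial_growth :: "('a, 'm) monoid_scheme \<Rightarrow> 'a set \<Rightarrow> bool" where
  "polynomial_growth G S \<longleftrightarrow>
     (\<exists>(C::real) (d::nat). \<forall>r\<ge>1. real (card (word_ball G S r)) \<le> C * real r ^ d)"


text \<open>For a commutative group \<open>A\<close>, written multiplicatively, the tensor product of \<open>A\<close> with the
  reals over the integers is the free abelian group on the pairs \<open>(a, r)\<close> modulo the
  biadditivity relations. Like any quotient in \<^theory>\<open>HOL-Algebra.Coset\<close>, it is a
  multiplicative group whose elements are cosets: its sum is the operation \<open>\<otimes>\<close>, its zero is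
  \<open>\<one>\<close>, and finite sums are \<^const>\<open>finprod\<close>.\<close>

definition tensor_relations :: "('a, 'm) monoid_scheme \<Rightarrow> (('a \<times> real) \<Rightarrow>\<^sub>0 int) set" where
  "tensor_relations A = generate (free_Abelian_group (carrier A \<times> UNIV))
     ({frag_of (a \<otimes>\<^bsub>A\<^esub> b, r) - frag_of (a, r) - frag_of (b, r) | a b r.
         a \<in> carrier A \<and> b \<in> carrier A} \<union>
      {frag_of (a, r + s) - frag_of (a, r) - frag_of (a, s) | a r s. a \<in> carrier A})"

definition tensor_real :: "('a, 'm) monoid_scheme \<Rightarrow> (('a \<times> real) \<Rightarrow>\<^sub>0 int) set monoid" where
  "tensor_real A = free_Abelian_group (carrier A \<times> UNIV) Mod tensor_relations A"

definition tensor_coset ::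
    "('a, 'm) monoid_scheme \<Rightarrow> (('a \<times> real) \<Rightarrow>\<^sub>0 int) \<Rightarrow> (('a \<times> real) \<Rightarrow>\<^sub>0 int) set" where
  "tensor_coset A x =
     tensor_relations A #>\<^bsub>free_Abelian_group (carrier A \<times> UNIV)\<^esub> x"

definition pure_tensor ::
    "('a, 'm) monoid_scheme \<Rightarrow> 'a \<Rightarrow> real \<Rightarrow> (('a \<times> real) \<Rightarrow>\<^sub>0 int) set" where
  "pure_tensor A a r = tensor_coset A (frag_of (a, r))"

text \<open>Scalar multiplication is induced by \<open>(a, r) \<mapsto> (a, c * r)\<close>. The representatives of a
  coset are all sent into one and the same coset, so the union below is that coset.\<close>

definition tensor_scale ::
    "('a, 'm) monoid_scheme \<Rightarrow> real \<Rightarrow> (('a \<times> real) \<Rightarrow>\<^sub>0 int) set \<Rightarrow> (('a \<times> real) \<Rightarrow>\<^sub>0 int) set" where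
  "tensor_scale A c v =
     (\<Union>x\<in>v. tensor_coset A (frag_extend (\<lambda>(a, r). frag_of (a, c * r)) x))"

definition tensor_functional ::
    "('a, 'm) monoid_scheme \<Rightarrow> ((('a \<times> real) \<Rightarrow>\<^sub>0 int) set \<Rightarrow> real) \<Rightarrow> bool" where
  "tensor_functional A l \<longleftrightarrow>
     (\<forall>v\<in>carrier (tensor_real A). \<forall>w\<in>carrier (tensor_real A).
        l (v \<otimes>\<^bsub>tensor_real A\<^esub> w) = l v + l w) \<and>
     (\<forall>c. \<forall>v\<in>carrier (tensor_real A). l (tensor_scale A c v) = c * l v)"

text \<open>The coarsest topology that makes all linear functionals continuous. If \<open>A\<close> is finitely
  generated, the vector space is finite-dimensional and this is its usual topology, i.e. the
  unique Hausdorff vector space topology.\<close>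

definition tensor_topology ::
    "('a, 'm) monoid_scheme \<Rightarrow> (('a \<times> real) \<Rightarrow>\<^sub>0 int) set topology" where
  "tensor_topology A = topology_generated_by
     {{v \<in> carrier (tensor_real A). l v \<in> U} | l U. tensor_functional A l \<and> open U}"


inductive_set generated_semigroup :: "('a, 'm) monoid_scheme \<Rightarrow> 'a set \<Rightarrow> 'a set"
  for G and X where
  incl: "x \<in> X \<Longrightarrow> x \<in> generated_semigroup G X"
| mult: "x \<in> generated_semigroup G X \<Longrightarrow> y \<in> generated_semigroup G X \<Longrightarrow>
         x \<otimes>\<^bsub>G\<^esub> y \<in> generated_semigroup G X"

definition adapted :: "('a, 'm) monoid_scheme \<Rightarrow> 'a pmf \<Rightarrow> bool" where
  "adapted G \<mu> \<longleftrightarrow> generated_semigroup G (set_pmf \<mu>) = carrier G"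

definition smooth :: "('a, 'm) monoid_scheme \<Rightarrow> 'a set \<Rightarrow> 'a pmf \<Rightarrow> bool" where
  "smooth G S \<mu> \<longleftrightarrow>
     (\<exists>\<zeta>>0. (\<lambda>x. pmf \<mu> x * exp (\<zeta> * real (word_length G S x))) summable_on carrier G)"

definition abelianization :: "('a, 'm) monoid_scheme \<Rightarrow> 'a set monoid" where
  "abelianization G = G Mod derived G (carrier G)"

definition ab_class :: "('a, 'm) monoid_scheme \<Rightarrow> 'a \<Rightarrow> (('a set \<times> real) \<Rightarrow>\<^sub>0 int) set" where
  "ab_class G g = pure_tensor (abelianization G) (derived G (carrier G) #>\<^bsub>G\<^esub> g) 1"

text \<open>The sum of \<open>\<mu>(g)[g]\<close> over the possibly infinite group is an unconditional sum: the limit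
  of the finite partial sums along the net of finite subsets of \<open>G\<close>.\<close>

definition abelian_centered :: "('a, 'm) monoid_scheme \<Rightarrow> 'a pmf \<Rightarrow> bool" where
  "abelian_centered G \<mu> \<longleftrightarrow>
     limitin (tensor_topology (abelianization G))
       (\<lambda>F. finprod (tensor_real (abelianization G))
              (\<lambda>g. tensor_scale (abelianization G) (pmf \<mu> g) (ab_class G g)) F)
       \<one>\<^bsub>tensor_real (abelianization G)\<^esub>
       (finite_subsets_at_top (carrier G))"


text \<open>Complex functions on \<open>G\<close> are represented by functions on the whole type that vanish outside
  the carrier; the pointwise operations then are the vector space operations.\<close>

definition group_functions :: "('a, 'm) monoid_scheme \<Rightarrow> ('a \<Rightarrow> complex) set" where
  "group_functions G = {f. \<forall>x. x \<notin> carrier G \<longrightarrow> f x = 0}"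

definition harmonic :: "('a, 'm) monoid_scheme \<Rightarrow> 'a pmf \<Rightarrow> ('a \<Rightarrow> complex) \<Rightarrow> bool" where
  "harmonic G \<mu> f \<longleftrightarrow>
     (\<forall>k\<in>carrier G.
        (\<lambda>g. norm (of_real (pmf \<mu> g) * f (k \<otimes>\<^bsub>G\<^esub> g))) summable_on carrier G \<and>
        f k = (\<Sum>\<^sub>\<infinity>g\<in>carrier G. of_real (pmf \<mu> g) * f (k \<otimes>\<^bsub>G\<^esub> g)))"

definition LHF :: "('a, 'm) monoid_scheme \<Rightarrow> 'a set \<Rightarrow> 'a pmf \<Rightarrow> ('a \<Rightarrow> complex) set" where
  "LHF G S \<mu> = {f \<in> group_functions G. harmonic G \<mu> f \<and>
     bdd_above {norm (f (x \<otimes>\<^bsub>G\<^esub> s) - f x) | s x. s \<in> S \<and> x \<in> carrier G}}"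

definition HF1 :: "('a, 'm) monoid_scheme \<Rightarrow> 'a set \<Rightarrow> 'a pmf \<Rightarrow> ('a \<Rightarrow> complex) set" where
  "HF1 G S \<mu> = {f \<in> group_functions G. harmonic G \<mu> f \<and>
     limsup (\<lambda>r. ereal (inverse (real r) * Max ((\<lambda>x. norm (f x)) ` word_ball G S r))) < \<infinity>}"

definition linear_isomorphism ::
    "(('a \<Rightarrow> complex) \<Rightarrow> ('b \<Rightarrow> complex)) \<Rightarrow> ('a \<Rightarrow> complex) set \<Rightarrow> ('b \<Rightarrow> complex) set \<Rightarrow> bool" where
  "linear_isomorphism T V W \<longleftrightarrow>
     bij_betw T V W \<and>
     (\<forall>f\<in>V. \<forall>g\<in>V. T (\<lambda>x. f x + g x) = (\<lambda>y. T f y + T g y)) \<and>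
     (\<forall>c. \<forall>f\<in>V. T (\<lambda>x. c * f x) = (\<lambda>y. c * T f y))"

end

theory Submission
  imports Defs
begin

text \<open>The two spaces coincide, and the identity is the isomorphism: the inclusion of
  \<open>LHF\<close> in \<open>HF\<^sub>1\<close> is the triangle inequality, and the converse is a gradient
  estimate. If \<open>h\<close> is the law of the random walk at an independent random time, then
  \<open>f(s) - f(1) = (\<Sum>y. (h(s\<^sup>-\<^sup>1y) - h(y)) f(y))\<close> for every harmonic \<open>f\<close> of linear
  growth, so it suffices to find, on an unbounded set of scales \<open>R\<close>, a law \<open>h\<close>
  concentrated at distance \<open>R\<close> with
  \<open>\<parallel>e\<^bsup>c|y|/R\<^esup>h\<parallel>\<^sup>2 \<lesssim> 1/V(R)\<close> and left gradient of size
  \<open>\<lesssim> 1/(R\<^sup>2V(R))\<close> in the same weighted norm, where \<open>V\<close> is the volume growth; the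
  Cauchy-Schwarz inequality then bounds \<open>|f(xs) - f(x)|\<close> for all \<open>x\<close> with \<open>|x| \<le> R\<close>.

  Such laws are obtained by applying the resolvents of the walk at the scales \<open>1, 4, 16, \<dots>, R\<close>
  successively. One resolvent step is controlled by a weighted energy inequality. As \<open>\<mu>\<close> is
  not symmetric, this inequality contains a drift term \<open>\<Sum>g. \<mu>(g) \<gamma>(g)\<close> of first order in
  the weight; \<open>\<gamma>\<close> is a homomorphism up to second order, so that the term is of second order
  because \<open>\<mu>\<close> is Abelian-centered. Polynomial growth only enters through the choice of the
  scales, around which the volume has to be doubling in both directions; the structure theory
  of groups of polynomial growth is not used.\<close>

section \<open>Square summable functions and auxiliary facts\<close>

text \<open>Why the iteration over scales closes: Cauchy-Schwarz alone bounds the squared l1 norm of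
  a law by its squared l2 norm times a volume, so that constants would accumulate from scale to
  scale. Interpolating once more with the total mass 1 makes the squared l1 norm linear in the l2
  norm. The new squared l2 norm is then bounded by a square root of the previous bound plus a small
  multiple of it, and this absorbs constants and volume ratios.

  Left and right: convolution with \<mu> on the left averages left translates, so energy and drift
  are about left translations, whereas f(k) = sum of \<mu>(g) f(kg) is dual to convolution on the
  right. The laws used are built from convolution powers of \<mu> and commute with \<mu>, so both
  views apply to the same kernel.

  Exponential weights are truncated in the energy estimates, since otherwise the sums are not known
  to be finite beforehand; all bounds are uniform in the truncation level.\<close>

lemma summable_on_abs_boundI:
  fixes f g :: "'a \<Rightarrow> real"
  assumes "g summable_on A" "\<And>x. x \<in> A \<Longrightarrow> \<bar>f x\<bar> \<le> g x"
  shows "f summable_on A"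
proof -
  have "(\<lambda>x. norm (f x)) summable_on A"
    by (rule Infinite_Sum.abs_summable_on_comparison_test'[OF assms(1)]) (simp add: assms(2))
  then show ?thesis by (rule summable_on_iff_abs_summable_on_real[THEN iffD2])
qed

definition l2norm :: "'a set \<Rightarrow> ('a \<Rightarrow> real) \<Rightarrow> real" where
  "l2norm A f = sqrt (\<Sum>\<^sub>\<infinity>x\<in>A. (f x)\<^sup>2)"

lemma l2norm_nonneg [simp]: "0 \<le> l2norm A f"
  by (simp add: l2norm_def infsum_nonneg)

lemma l2norm_sq: "(l2norm A f)\<^sup>2 = (\<Sum>\<^sub>\<infinity>x\<in>A. (f x)\<^sup>2)"
  by (simp add: l2norm_def infsum_nonneg)

lemma l2_mult_summable:
  fixes f g :: "'a \<Rightarrow> real"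
  assumes "(\<lambda>x. (f x)\<^sup>2) summable_on A" "(\<lambda>x. (g x)\<^sup>2) summable_on A"
  shows "(\<lambda>x. f x * g x) summable_on A"
proof (rule summable_on_abs_boundI)
  show "(\<lambda>x. (f x)\<^sup>2 + (g x)\<^sup>2) summable_on A"
    by (intro summable_on_add assms)
  fix x
  have "2 * (\<bar>f x\<bar> * \<bar>g x\<bar>) \<le> (f x)\<^sup>2 + (g x)\<^sup>2"
    using sum_squares_bound[of "\<bar>f x\<bar>" "\<bar>g x\<bar>"] by simp
  then show "\<bar>f x * g x\<bar> \<le> (f x)\<^sup>2 + (g x)\<^sup>2"
    using mult_nonneg_nonneg[OF abs_ge_zero[of "f x"] abs_ge_zero[of "g x"]]
    unfolding abs_mult by linarith
qed

lemma l2_add_summable: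
  fixes f g :: "'a \<Rightarrow> real"
  assumes "(\<lambda>x. (f x)\<^sup>2) summable_on A" "(\<lambda>x. (g x)\<^sup>2) summable_on A"
  shows "(\<lambda>x. (f x + g x)\<^sup>2) summable_on A"
proof -
  have "(\<lambda>x. (f x)\<^sup>2 + (g x)\<^sup>2 + 2 * (f x * g x)) summable_on A"
    by (intro summable_on_add summable_on_cmult_right assms l2_mult_summable)
  then show ?thesis by (simp add: power2_sum mult.assoc)
qed

lemma l2_cauchy_schwarz:
  fixes f g :: "'a \<Rightarrow> real"
  assumes f: "(\<lambda>x. (f x)\<^sup>2) summable_on A" and g: "(\<lambda>x. (g x)\<^sup>2) summable_on A"
  shows "(\<Sum>\<^sub>\<infinity>x\<in>A. \<bar>f x * g x\<bar>) \<le> l2norm A f * l2norm A g"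
proof (rule infsum_le_finite_sums)
  show "(\<lambda>x. \<bar>f x * g x\<bar>) summable_on A"
    using summable_on_iff_abs_summable_on_real[THEN iffD1, OF l2_mult_summable[OF assms]] by simp
  fix F assume F: "finite F" "F \<subseteq> A"
  have "(\<Sum>x\<in>F. \<bar>f x * g x\<bar>) \<le> L2_set f F * L2_set g F"
    using L2_set_mult_ineq[of f g F] by (simp add: abs_mult)
  also have "\<dots> \<le> l2norm A f * l2norm A g"
    unfolding L2_set_def l2norm_def
    by (intro mult_mono real_sqrt_le_mono finite_sum_le_infsum f g F) (auto intro: sum_nonneg infsum_nonneg)
  finally show "(\<Sum>x\<in>F. \<bar>f x * g x\<bar>) \<le> l2norm A f * l2norm A g" .
qed

lemma abs_infsum_le:
  fixes f :: "'a \<Rightarrow> real"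
  assumes "f summable_on A"
  shows "\<bar>infsum f A\<bar> \<le> (\<Sum>\<^sub>\<infinity>x\<in>A. \<bar>f x\<bar>)"
  using norm_infsum_bound[OF summable_on_iff_abs_summable_on_real[THEN iffD1, OF assms]] by simp

lemma l2_inner_le:
  fixes f g :: "'a \<Rightarrow> real"
  assumes "(\<lambda>x. (f x)\<^sup>2) summable_on A" "(\<lambda>x. (g x)\<^sup>2) summable_on A"
  shows "\<bar>\<Sum>\<^sub>\<infinity>x\<in>A. f x * g x\<bar> \<le> l2norm A f * l2norm A g"
  using abs_infsum_le[OF l2_mult_summable[OF assms]] l2_cauchy_schwarz[OF assms] by linarith

lemma l2_triangle:
  fixes f g :: "'a \<Rightarrow> real"
  assumes f: "(\<lambda>x. (f x)\<^sup>2) summable_on A" and g: "(\<lambda>x. (g x)\<^sup>2) summable_on A"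
  shows "l2norm A (\<lambda>x. f x + g x) \<le> l2norm A f + l2norm A g"
proof (rule power2_le_imp_le)
  have "(l2norm A (\<lambda>x. f x + g x))\<^sup>2 = (\<Sum>\<^sub>\<infinity>x\<in>A. ((f x)\<^sup>2 + (g x)\<^sup>2) + 2 * (f x * g x))"
    unfolding l2norm_sq by (intro infsum_cong) (simp add: power2_sum)
  also have "\<dots> = (\<Sum>\<^sub>\<infinity>x\<in>A. (f x)\<^sup>2 + (g x)\<^sup>2) + (\<Sum>\<^sub>\<infinity>x\<in>A. 2 * (f x * g x))"
    by (intro infsum_add summable_on_add summable_on_cmult_right l2_mult_summable f g)
  also have "\<dots> = (l2norm A f)\<^sup>2 + (l2norm A g)\<^sup>2 + 2 * (\<Sum>\<^sub>\<infinity>x\<in>A. f x * g x)"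
    by (simp add: infsum_add[OF f g] l2norm_sq infsum_cmult_right')
  also have "\<dots> \<le> (l2norm A f + l2norm A g)\<^sup>2"
    using l2_inner_le[OF assms] by (simp add: power2_sum)
  finally show "(l2norm A (\<lambda>x. f x + g x))\<^sup>2 \<le> (l2norm A f + l2norm A g)\<^sup>2" .
qed simp

lemma l2norm_mono:
  assumes "(\<lambda>x. (g x)\<^sup>2) summable_on A" "\<And>x. x \<in> A \<Longrightarrow> \<bar>f x\<bar> \<le> \<bar>g x\<bar>"
  shows "(\<lambda>x. (f x)\<^sup>2) summable_on A" "l2norm A f \<le> l2norm A g"
proof -
  have le: "(f x)\<^sup>2 \<le> (g x)\<^sup>2" if "x \<in> A" for x
    using assms(2)[OF that] abs_le_square_iff by blast
  show s: "(\<lambda>x. (f x)\<^sup>2) summable_on A"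
    by (rule summable_on_abs_boundI[OF assms(1)]) (simp add: le)
  show "l2norm A f \<le> l2norm A g"
    unfolding l2norm_def by (intro real_sqrt_le_mono infsum_mono s assms(1) le)
qed

lemma l2norm_cmult: "l2norm A (\<lambda>x. c * f x) = \<bar>c\<bar> * l2norm A f"
  by (simp add: l2norm_def power_mult_distrib infsum_cmult_right' real_sqrt_mult)

text \<open>Pigeonhole on two envelopes: among sequences with increments at most D,
  \<open>up\<close> is the least majorant and \<open>low\<close> the greatest minorant of \<phi>. An
  index is good when both touch \<phi> there; an envelope that misses \<phi> rises by exactly D.
  Without good indices beyond N the sum \<open>up + low\<close> would gain at least D per step,
  although each summand has slope at most d.\<close>

lemma good_scales:
  fixes \<phi> :: "nat \<Rightarrow> real" and d c D :: real
  assumes mono: "mono \<phi>" and nonneg: "\<And>n. 0 \<le> \<phi> n" and d0: "0 \<le> d"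
    and growth: "\<And>n. \<phi> n \<le> d * real n + c" and D: "2 * d < D"
  shows "\<exists>J\<ge>N. (\<forall>k\<ge>J. \<phi> k \<le> \<phi> J + D * (real k - real J)) \<and>
                (\<forall>k\<le>J. \<phi> J \<le> \<phi> k + D * (real J - real k))"
proof (rule ccontr)
  assume bad: "\<not> ?thesis"
  define up where "up j = (SUP k\<in>{j..}. \<phi> k - D * (real k - real j))" for j
  define low where "low = rec_nat (\<phi> 0) (\<lambda>j l. min (\<phi> (Suc j)) (l + D))"
  have low_0 [simp]: "low 0 = \<phi> 0" and low_Suc: "low (Suc j) = min (\<phi> (Suc j)) (low j + D)" for j
    by (simp_all add: low_def)
  have Dpos: "0 < D" using d0 D by linarith
  have term_le: "\<phi> k - D * (real k - real j) \<le> d * real j + c" if "j \<le> k" for j k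
  proof -
    have "d * (real k - real j) \<le> D * (real k - real j)"
      using that d0 D by (intro mult_right_mono) auto
    then show ?thesis using growth[of k] by (simp add: algebra_simps)
  qed
  have bdd: "bdd_above ((\<lambda>k. \<phi> k - D * (real k - real j)) ` {i..})" if "j \<le> i" for i j
    using that by (intro bdd_aboveI2[where M = "d * real j + c"] term_le) auto
  have up_ge: "\<phi> k - D * (real k - real j) \<le> up j" if "j \<le> k" for j k
    unfolding up_def using that by (intro cSUP_upper bdd) auto
  have up_le: "up j \<le> d * real j + c" for j
    unfolding up_def by (intro cSUP_least term_le) auto
  have up_rec: "up j = max (\<phi> j) (up (Suc j) - D)" for j
  proof (rule antisym)
    have "\<phi> k - D * (real k - real j) \<le> max (\<phi> j) (up (Suc j) - D)" if "j \<le> k" for k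
    proof (cases "k = j")
      case False
      with that have "Suc j \<le> k" by simp
      from up_ge[OF this] show ?thesis by (simp add: algebra_simps le_max_iff_disj)
    qed simp
    then show "up j \<le> max (\<phi> j) (up (Suc j) - D)"
      unfolding up_def[of j] by (intro cSUP_least) auto
    have "\<phi> k - D * (real k - real (Suc j)) \<le> up j + D" if "Suc j \<le> k" for k
      using up_ge[of j k] that by (simp add: algebra_simps)
    then have "up (Suc j) \<le> up j + D"
      unfolding up_def[of "Suc j"] by (intro cSUP_least) auto
    then show "max (\<phi> j) (up (Suc j) - D) \<le> up j"
      using up_ge[of j j] by simp
  qed
  have low_le: "low j \<le> \<phi> j" for j by (cases j) (simp_all add: low_Suc)
  have low_le_step: "low j \<le> \<phi> k + D * (real j - real k)" if "k \<le> j" for j k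
    using that
  proof (induction rule: dec_induct)
    case base then show ?case using low_le[of k] by simp
  next
    case (step n)
    then show ?case using low_Suc[of n] by (simp add: algebra_simps)
  qed
  have low_mono: "low j \<le> low (Suc j)" for j
    using low_le[of j] monoD[OF mono, of j "Suc j"] Dpos by (simp add: low_Suc)
  have up_mono: "up j \<le> up (Suc j)" for j
    using up_rec[of j] monoD[OF mono, of j "Suc j"] up_ge[of "Suc j" "Suc j"] Dpos by auto
  have dich: "up J \<noteq> \<phi> J \<or> low J \<noteq> \<phi> J" if "N \<le> J" for J
  proof (rule ccontr)
    assume "\<not> ?thesis"
    then have eq: "up J = \<phi> J" "low J = \<phi> J" by auto
    have "\<forall>k\<ge>J. \<phi> k \<le> \<phi> J + D * (real k - real J)"
      using up_ge[of J] eq(1) by (metis diff_le_eq)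
    moreover have "\<forall>k\<le>J. \<phi> J \<le> \<phi> k + D * (real J - real k)"
      using low_le_step[of _ J] eq(2) by simp
    ultimately show False using bad that by blast
  qed
  \<comment> \<open>At \<open>Suc j\<close>, a miss of \<open>up\<close> forces its jump after that
    index and a miss of \<open>low\<close> forces its jump before it, hence the shifted
    indices.\<close>
  have step: "up (Suc (Suc j)) + low (Suc j) \<ge> up (Suc j) + low j + D" if "N \<le> j" for j
  proof -
    have "N \<le> Suc j" using that by simp
    from dich[OF this] show ?thesis
    proof
      assume "up (Suc j) \<noteq> \<phi> (Suc j)"
      then have "up (Suc j) = up (Suc (Suc j)) - D" using up_rec[of "Suc j"] by linarith
      then show ?thesis using low_mono[of j] by simp
    next
      assume "low (Suc j) \<noteq> \<phi> (Suc j)"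
      then have "low (Suc j) = low j + D" using low_Suc[of j] by linarith
      then show ?thesis using up_mono[of "Suc j"] by simp
    qed
  qed
  have low_nonneg: "0 \<le> low j" for j
    by (induction j) (auto simp: nonneg intro: order_trans[OF _ low_mono])
  have "up (Suc (N + n)) + low (N + n) \<ge> D * real n" for n
  proof (induction n)
    case 0 show ?case using low_nonneg[of N] up_ge[of "Suc N" "Suc N"] nonneg[of "Suc N"] by simp
  next
    case (Suc n) then show ?case using step[of "N + n"] by (simp add: algebra_simps)
  qed
  note lower = this
  have upper: "up (Suc (N + n)) + low (N + n) \<le> 2 * d * real n + (2 * d * real N + d + 2 * c)" for n
    using up_le[of "Suc (N + n)"] low_le[of "N + n"] growth[of "N + n"] by (simp add: algebra_simps)
  have le: "(D - 2 * d) * real n \<le> 2 * d * real N + d + 2 * c" for n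
    using order_trans[OF lower upper, of n] by (simp add: left_diff_distrib)
  obtain n :: nat where "2 * d * real N + d + 2 * c < real n * (D - 2 * d)"
    using reals_Archimedean3[of "D - 2 * d"] D by auto
  with le[of n] show False by (simp add: mult.commute)
qed

text \<open>Double annihilators in the finite-dimensional space of functions on S, for a possibly
  infinite family. The induction is Gaussian elimination: a pivot \<nu> i0 with nonzero entry at t
  clears the coordinate t of all other vectors.\<close>

lemma orthogonality_imp_combination:
  fixes \<nu> :: "'i \<Rightarrow> 'a \<Rightarrow> real" and m :: "'a \<Rightarrow> real"
  assumes "finite S"
    and "\<And>b. (\<And>i. i \<in> I \<Longrightarrow> (\<Sum>s\<in>S. b s * \<nu> i s) = 0) \<Longrightarrow> (\<Sum>s\<in>S. b s * m s) = 0"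
  shows "\<exists>F c. finite F \<and> F \<subseteq> I \<and> (\<forall>s\<in>S. m s = (\<Sum>i\<in>F. c i * \<nu> i s))"
  using assms
proof (induction S arbitrary: \<nu> m rule: finite_induct)
  case empty
  then show ?case by (intro exI[of _ "{}"]) auto
next
  case (insert t S)
  show ?case
  proof (cases "\<exists>i0\<in>I. \<nu> i0 t \<noteq> 0")
    case False
    then have z: "\<nu> i t = 0" if "i \<in> I" for i using that by auto
    \<comment> \<open>The indicator of t is orthogonal to the whole family.\<close>
    have "m t = 0"
      using insert.prems[of "\<lambda>s. if s = t then 1 else 0"] insert.hyps z
      by (simp add: if_distrib[of "\<lambda>x. x * _"] sum.If_cases cong: if_cong)
    have "\<exists>F c. finite F \<and> F \<subseteq> I \<and> (\<forall>s\<in>S. m s = (\<Sum>i\<in>F. c i * \<nu> i s))"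
    proof (rule insert.IH)
      fix b assume "\<And>i. i \<in> I \<Longrightarrow> (\<Sum>s\<in>S. b s * \<nu> i s) = 0"
      then have "(\<Sum>s\<in>insert t S. b s * m s) = 0"
        using insert.hyps z by (intro insert.prems) simp
      then show "(\<Sum>s\<in>S. b s * m s) = 0" using \<open>m t = 0\<close> insert.hyps by simp
    qed
    then obtain F c where F: "finite F" "F \<subseteq> I" "\<forall>s\<in>S. m s = (\<Sum>i\<in>F. c i * \<nu> i s)" by blast
    then have "\<forall>s\<in>insert t S. m s = (\<Sum>i\<in>F. c i * \<nu> i s)"
      using \<open>m t = 0\<close> z by (auto simp: subset_iff intro!: sum.neutral[symmetric])
    with F show ?thesis by blast
  next
    case True
    then obtain i0 where i0: "i0 \<in> I" "\<nu> i0 t \<noteq> 0" by blast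
    define r where "r i = \<nu> i t / \<nu> i0 t" for i
    define q where "q = m t / \<nu> i0 t"
    have "\<exists>F c. finite F \<and> F \<subseteq> I \<and>
        (\<forall>s\<in>S. m s - q * \<nu> i0 s = (\<Sum>i\<in>F. c i * (\<nu> i s - r i * \<nu> i0 s)))"
    proof (rule insert.IH)
      fix b assume b: "\<And>i. i \<in> I \<Longrightarrow> (\<Sum>s\<in>S. b s * (\<nu> i s - r i * \<nu> i0 s)) = 0"
      define X where "X = (\<Sum>s\<in>S. b s * \<nu> i0 s)"
      \<comment> \<open>The value at t is the one that makes b' orthogonal to the pivot, and thereby
        to the original family.\<close>
      define b' where "b' s = (if s = t then - X / \<nu> i0 t else b s)" for s
      have b'S: "(\<Sum>s\<in>S. b' s * h s) = (\<Sum>s\<in>S. b s * h s)" for h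
        using insert.hyps by (intro sum.cong) (auto simp: b'_def)
      have "(\<Sum>s\<in>insert t S. b' s * m s) = 0"
      proof (rule insert.prems)
        fix i assume "i \<in> I"
        have "(\<Sum>s\<in>S. b s * \<nu> i s) = r i * X"
          using b[OF \<open>i \<in> I\<close>] by (simp add: X_def algebra_simps sum_subtractf sum_distrib_left)
        then show "(\<Sum>s\<in>insert t S. b' s * \<nu> i s) = 0"
          using insert.hyps b'S[of "\<nu> i"] by (simp add: b'_def[of t] r_def)
      qed
      then have "(\<Sum>s\<in>S. b s * m s) = q * X"
        using insert.hyps b'S[of m] by (simp add: b'_def[of t] q_def)
      then show "(\<Sum>s\<in>S. b s * (m s - q * \<nu> i0 s)) = 0"
        by (simp add: X_def algebra_simps sum_subtractf sum_distrib_left)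
    qed
    then obtain F c where F: "finite F" "F \<subseteq> I"
      and eq: "\<forall>s\<in>S. m s - q * \<nu> i0 s = (\<Sum>i\<in>F. c i * (\<nu> i s - r i * \<nu> i0 s))" by blast
    \<comment> \<open>At t both sides vanish, by the choice of q and r.\<close>
    have eq': "\<forall>s\<in>insert t S. m s - q * \<nu> i0 s = (\<Sum>i\<in>F. c i * (\<nu> i s - r i * \<nu> i0 s))"
      using eq i0 by (simp add: q_def r_def)
    define e where "e = q - (\<Sum>i\<in>F. c i * r i)"
    \<comment> \<open>The pivot may already occur in F, so its two coefficients are added.\<close>
    define c' where "c' i = (if i \<in> F then c i else 0) + (if i = i0 then e else 0)" for i
    have "m s = (\<Sum>i\<in>insert i0 F. c' i * \<nu> i s)" if "s \<in> insert t S" for s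
    proof -
      have "(\<Sum>i\<in>insert i0 F. c' i * \<nu> i s) =
          (\<Sum>i\<in>insert i0 F. (if i \<in> F then c i * \<nu> i s else 0)) +
          (\<Sum>i\<in>insert i0 F. (if i = i0 then e * \<nu> i s else 0))"
        by (simp add: c'_def sum.distrib[symmetric] distrib_right if_distrib[of "\<lambda>x. x * _"] cong: if_cong)
      also have "\<dots> = (\<Sum>i\<in>F. c i * \<nu> i s) + e * \<nu> i0 s"
      proof -
        have "insert i0 F \<inter> {i. i \<in> F} = F" by blast
        then show ?thesis using F(1) by (simp add: sum.If_cases)
      qed
      also have "\<dots> = m s"
        using eq'[rule_format, OF that]
        by (simp add: e_def algebra_simps sum_subtractf sum_distrib_left sum_distrib_right)
      finally show ?thesis by simp
    qed
    moreover have "finite (insert i0 F)" "insert i0 F \<subseteq> I" using F i0 by auto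
    ultimately show ?thesis by blast
  qed
qed

section \<open>Words and translations\<close>

locale sym_gen_group = group G for G (structure) +
  fixes S :: "'a set"
  assumes finite_S: "finite S" and sym_gen: "symmetric_generating_set G S"
begin

abbreviation len :: "'a \<Rightarrow> nat" where "len \<equiv> word_length G S"

abbreviation decay :: "real \<Rightarrow> 'a \<Rightarrow> real" where
  "decay \<delta> \<equiv> \<lambda>x. exp (- (\<delta> * real (len x)))"

abbreviation wprod :: "'a list \<Rightarrow> 'a" where "wprod w \<equiv> foldr (\<lambda>s y. s \<otimes> y) w \<one>"

lemma S_carrier: "s \<in> S \<Longrightarrow> s \<in> carrier G"
  and S_inv: "s \<in> S \<Longrightarrow> inv s \<in> S"
  and generate_S: "generate G S = carrier G"
  using sym_gen by (auto simp: symmetric_generating_set_def)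

lemma wprod_closed: "set w \<subseteq> S \<Longrightarrow> wprod w \<in> carrier G"
  by (induction w) (auto simp: S_carrier)

lemma wprod_append: "set u \<subseteq> S \<Longrightarrow> set v \<subseteq> S \<Longrightarrow> wprod (u @ v) = wprod u \<otimes> wprod v"
proof (induction u)
  case (Cons s u)
  then have "wprod (u @ v) = wprod u \<otimes> wprod v" "s \<in> carrier G" "wprod u \<in> carrier G" "wprod v \<in> carrier G"
    by (auto intro: S_carrier wprod_closed)
  then show ?case by (simp add: m_assoc)
qed (simp add: wprod_closed)

definition winv :: "'a list \<Rightarrow> 'a list" where "winv w = rev (map (\<lambda>s. inv s) w)"

lemma winv_set: "set w \<subseteq> S \<Longrightarrow> set (winv w) \<subseteq> S"
  by (auto simp: winv_def S_inv)

lemma wprod_winv: "set w \<subseteq> S \<Longrightarrow> wprod (winv w) = inv (wprod w)"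
proof (induction w)
  case (Cons s w)
  then have s: "s \<in> S" "set w \<subseteq> S" by auto
  have "wprod (winv (s # w)) = wprod (winv w) \<otimes> wprod [inv s]"
    using s by (subst wprod_append[symmetric]) (auto simp: winv_def S_inv)
  also have "\<dots> = inv (wprod w) \<otimes> inv s"
    using s Cons by (simp add: S_carrier)
  also have "\<dots> = inv (wprod (s # w))"
    using s by (simp add: inv_mult_group S_carrier wprod_closed)
  finally show ?case .
qed (simp add: winv_def)

lemma ex_word:
  assumes "x \<in> carrier G"
  shows "\<exists>w. set w \<subseteq> S \<and> wprod w = x"
proof -
  have "x \<in> generate G S" using assms generate_S by simp
  then show ?thesis
  proof (induction rule: generate.induct)
    case one show ?case by (intro exI[of _ "[]"]) simp
  next
    case (incl h) then show ?case by (intro exI[of _ "[h]"]) (simp add: S_carrier)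
  next
    case (inv h) then show ?case by (intro exI[of _ "[inv h]"]) (simp add: S_carrier S_inv)
  next
    case (eng h1 h2)
    then obtain w1 w2 where "set w1 \<subseteq> S" "wprod w1 = h1" "set w2 \<subseteq> S" "wprod w2 = h2" by blast
    then show ?case by (intro exI[of _ "w1 @ w2"]) (simp add: wprod_append del: foldr_append)
  qed
qed

lemma ex_geodesic:
  assumes "x \<in> carrier G"
  shows "\<exists>w. set w \<subseteq> S \<and> wprod w = x \<and> length w = len x"
proof -
  obtain w where "set w \<subseteq> S" "wprod w = x" using ex_word[OF assms] by blast
  then have "\<exists>w'. set w' \<subseteq> S \<and> length w' = length w \<and> wprod w' = x" by blast
  from LeastI[of "\<lambda>n. \<exists>w'. set w' \<subseteq> S \<and> length w' = n \<and> wprod w' = x", OF this]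
  show ?thesis unfolding word_length_def by blast
qed

definition geodesic :: "'a \<Rightarrow> 'a list" where
  "geodesic x = (SOME w. set w \<subseteq> S \<and> wprod w = x \<and> length w = len x)"

lemma geodesic:
  assumes "x \<in> carrier G"
  shows "set (geodesic x) \<subseteq> S" "wprod (geodesic x) = x" "length (geodesic x) = len x"
  using someI_ex[OF ex_geodesic[OF assms]] by (simp_all add: geodesic_def)

lemma len_wprod_le: "set w \<subseteq> S \<Longrightarrow> len (wprod w) \<le> length w"
  unfolding word_length_def by (rule Least_le) blast

lemma len_one [simp]: "len \<one> = 0"
  using len_wprod_le[of "[]"] by simp

lemma len_gen: "s \<in> S \<Longrightarrow> len s \<le> 1"
  using len_wprod_le[of "[s]"] by (simp add: S_carrier)

lemma len_mult:
  assumes "x \<in> carrier G" "y \<in> carrier G"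
  shows "len (x \<otimes> y) \<le> len x + len y"
  using len_wprod_le[of "geodesic x @ geodesic y"] geodesic[OF assms(1)] geodesic[OF assms(2)]
  by (simp add: wprod_append del: foldr_append)

lemma len_inv [simp]:
  assumes "x \<in> carrier G"
  shows "len (inv x) = len x"
proof -
  have le: "len (inv y) \<le> len y" if "y \<in> carrier G" for y
    using len_wprod_le[of "winv (geodesic y)"] geodesic[OF that]
    by (simp add: wprod_winv winv_set) (simp add: winv_def)
  show ?thesis using le[OF assms] le[of "inv x"] assms by simp
qed

lemma len_mult_left_diff:
  assumes "g \<in> carrier G" "x \<in> carrier G"
  shows "\<bar>real (len (inv g \<otimes> x)) - real (len x)\<bar> \<le> real (len g)"
proof -
  have "x = g \<otimes> (inv g \<otimes> x)" using assms by (simp add: m_assoc[symmetric])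
  then have "len x \<le> len g + len (inv g \<otimes> x)"
    using len_mult[of g "inv g \<otimes> x"] assms by simp
  moreover have "len (inv g \<otimes> x) \<le> len g + len x"
    using len_mult[of "inv g" x] assms by simp
  ultimately show ?thesis by linarith
qed

lemma finite_word_ball: "finite (word_ball G S r)"
proof (rule finite_subset)
  show "word_ball G S r \<subseteq> wprod ` {w. set w \<subseteq> S \<and> length w \<le> r}"
  proof
    fix x assume x: "x \<in> word_ball G S r"
    then have "x \<in> carrier G" "len x \<le> r" by (auto simp: word_ball_def)
    then show "x \<in> wprod ` {w. set w \<subseteq> S \<and> length w \<le> r}"
      using geodesic[of x] by (intro image_eqI[of _ _ "geodesic x"]) auto
  qed
  show "finite (wprod ` {w. set w \<subseteq> S \<and> length w \<le> r})"
    by (intro finite_imageI finite_lists_length_le finite_S)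
qed

lemma one_in_ball: "\<one> \<in> word_ball G S r"
  by (simp add: word_ball_def)

lemma card_ball_pos: "1 \<le> card (word_ball G S r)"
  using finite_word_ball[of r] one_in_ball[of r] by (metis Suc_leI card_gt_0_iff empty_iff One_nat_def)

lemma word_ball_mono: "r \<le> r' \<Longrightarrow> word_ball G S r \<subseteq> word_ball G S r'"
  by (auto simp: word_ball_def)

lemma card_ball_mono: "r \<le> r' \<Longrightarrow> card (word_ball G S r) \<le> card (word_ball G S r')"
  by (intro card_mono finite_word_ball word_ball_mono)

lemma bij_translate: "g \<in> carrier G \<Longrightarrow> bij_betw (\<lambda>x. inv g \<otimes> x) (carrier G) (carrier G)"
  by (rule bij_betwI[where g = "\<lambda>x. g \<otimes> x"]) (auto simp: m_assoc[symmetric])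

lemma infsum_translate:
  "g \<in> carrier G \<Longrightarrow> (\<Sum>\<^sub>\<infinity>x\<in>carrier G. f (inv g \<otimes> x)) = (\<Sum>\<^sub>\<infinity>x\<in>carrier G. f x)"
  by (rule infsum_reindex_bij_betw[OF bij_translate])

lemma summable_translate:
  "g \<in> carrier G \<Longrightarrow> (\<lambda>x. f (inv g \<otimes> x)) summable_on carrier G \<longleftrightarrow> f summable_on carrier G"
  by (rule summable_on_reindex_bij_betw[OF bij_translate])

section \<open>Displacement and energy under left translations\<close>

abbreviation square_summable :: "('a \<Rightarrow> real) \<Rightarrow> bool" where
  "square_summable v \<equiv> (\<lambda>x. (v x)\<^sup>2) summable_on carrier G"

abbreviation l2 :: "('a \<Rightarrow> real) \<Rightarrow> real" where "l2 \<equiv> l2norm (carrier G)"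

definition displacement :: "('a \<Rightarrow> real) \<Rightarrow> 'a \<Rightarrow> real" where
  "displacement v g = l2 (\<lambda>x. v x - v (inv g \<otimes> x))"

text \<open>Up to normalisation, the Dirichlet form of the Cayley graph whose edges are left
  multiplications by generators.\<close>

definition energy :: "('a \<Rightarrow> real) \<Rightarrow> real" where
  "energy v = (\<Sum>s\<in>S. (displacement v s)\<^sup>2)"

lemma energy_nonneg [simp]: "0 \<le> energy v"
  by (simp add: energy_def sum_nonneg)

lemma displacement_nonneg [simp]: "0 \<le> displacement v g"
  by (simp add: displacement_def)

lemma square_summable_translate:
  "g \<in> carrier G \<Longrightarrow> square_summable v \<Longrightarrow> square_summable (\<lambda>x. v (inv g \<otimes> x))"
  by (rule summable_translate[THEN iffD2])

lemma l2_translate: "g \<in> carrier G \<Longrightarrow> l2 (\<lambda>x. v (inv g \<otimes> x)) = l2 v"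
  using infsum_translate[of g "\<lambda>x. (v x)\<^sup>2"] by (simp add: l2norm_def)

lemma square_summable_diff:
  assumes "square_summable v" "g \<in> carrier G"
  shows "square_summable (\<lambda>x. v x - v (inv g \<otimes> x))"
proof -
  have "square_summable (\<lambda>x. - v (inv g \<otimes> x))"
    using square_summable_translate[OF assms(2,1)] by simp
  from l2_add_summable[OF assms(1) this] show ?thesis by simp
qed

lemma displacement_one [simp]: "displacement v \<one> = 0"
proof -
  have "(\<Sum>\<^sub>\<infinity>x\<in>carrier G. (v x - v (inv \<one> \<otimes> x))\<^sup>2) = (\<Sum>\<^sub>\<infinity>x\<in>carrier G. 0)"
    by (intro infsum_cong) simp
  then show ?thesis by (simp add: displacement_def l2norm_def)
qed

text \<open>Telescoping: left translation by g is an isometry of l2, so the second increment can be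
  measured before translating.\<close>

lemma displacement_mult:
  assumes v: "square_summable v" and g: "g \<in> carrier G" and h: "h \<in> carrier G"
  shows "displacement v (g \<otimes> h) \<le> displacement v g + displacement v h"
proof -
  have "displacement v (g \<otimes> h) =
      l2 (\<lambda>x. (v x - v (inv g \<otimes> x)) + (v (inv g \<otimes> x) - v (inv h \<otimes> (inv g \<otimes> x))))"
    unfolding displacement_def l2norm_def using g h
    by (intro arg_cong[where f = sqrt] infsum_cong) (simp add: inv_mult_group m_assoc)
  also have "\<dots> \<le> displacement v g + l2 (\<lambda>x. v (inv g \<otimes> x) - v (inv h \<otimes> (inv g \<otimes> x)))"
    unfolding displacement_def
    by (intro l2_triangle square_summable_diff[OF v g]
          square_summable_translate[OF g, of "\<lambda>y. v y - v (inv h \<otimes> y)"] square_summable_diff[OF v h])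
  also have "l2 (\<lambda>x. v (inv g \<otimes> x) - v (inv h \<otimes> (inv g \<otimes> x))) = displacement v h"
    unfolding displacement_def using l2_translate[OF g, of "\<lambda>y. v y - v (inv h \<otimes> y)"] .
  finally show ?thesis .
qed

lemma displacement_gen_le: "s \<in> S \<Longrightarrow> displacement v s \<le> sqrt (energy v)"
  unfolding energy_def
  by (rule real_le_rsqrt) (intro member_le_sum finite_S; simp)

text \<open>Subadditivity along a geodesic word, each letter costing at most the root of the
  energy.\<close>

lemma displacement_le:
  assumes v: "square_summable v" and g: "g \<in> carrier G"
  shows "displacement v g \<le> real (len g) * sqrt (energy v)"
proof -
  have "displacement v (wprod w) \<le> real (length w) * sqrt (energy v)" if "set w \<subseteq> S" for w
    using that
  proof (induction w)
    case (Cons s w)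
    then have "displacement v (wprod (s # w)) \<le> displacement v s + displacement v (wprod w)"
      using displacement_mult[OF v, of s "wprod w"] by (simp add: S_carrier wprod_closed)
    then show ?case using Cons displacement_gen_le[of s v] by (simp add: distrib_right)
  qed simp
  from this[of "geodesic g"] geodesic[OF g] show ?thesis by simp
qed

lemma displacement_sq:
  assumes v: "square_summable v" and g: "g \<in> carrier G"
  shows "(displacement v g)\<^sup>2 = 2 * (l2 v)\<^sup>2 - 2 * (\<Sum>\<^sub>\<infinity>x\<in>carrier G. v x * v (inv g \<otimes> x))"
proof -
  note gv = square_summable_translate[OF g v]
  have cross: "(\<lambda>x. - (2 * (v x * v (inv g \<otimes> x)))) summable_on carrier G"
    using summable_on_cmult_right[OF l2_mult_summable[OF v gv], of "-2"] by simp
  have "(displacement v g)\<^sup>2 = (\<Sum>\<^sub>\<infinity>x\<in>carrier G. ((v x)\<^sup>2 + (v (inv g \<otimes> x))\<^sup>2) + - (2 * (v x * v (inv g \<otimes> x))))"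
    unfolding displacement_def l2norm_sq by (intro infsum_cong) (simp add: power2_diff)
  also have "\<dots> = (\<Sum>\<^sub>\<infinity>x\<in>carrier G. (v x)\<^sup>2 + (v (inv g \<otimes> x))\<^sup>2) + (\<Sum>\<^sub>\<infinity>x\<in>carrier G. - (2 * (v x * v (inv g \<otimes> x))))"
    by (intro infsum_add summable_on_add v gv cross)
  also have "(\<Sum>\<^sub>\<infinity>x\<in>carrier G. (v x)\<^sup>2 + (v (inv g \<otimes> x))\<^sup>2) = (l2 v)\<^sup>2 + (l2 v)\<^sup>2"
    using infsum_add[OF v gv] infsum_translate[OF g, of "\<lambda>x. (v x)\<^sup>2"] by (simp add: l2norm_sq)
  finally show ?thesis by (simp add: infsum_uminus infsum_cmult_right')
qed

end

section \<open>Centering and homomorphisms to the reals\<close>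

text \<open>The homomorphism from the free abelian group to the reals that takes the values w on the
  generators.\<close>

definition frag_eval :: "('b \<Rightarrow> real) \<Rightarrow> ('b \<Rightarrow>\<^sub>0 int) \<Rightarrow> real" where
  "frag_eval w x = (\<Sum>k\<in>Poly_Mapping.keys x. of_int (Poly_Mapping.lookup x k) * w k)"

lemma frag_eval_superset:
  "finite K \<Longrightarrow> Poly_Mapping.keys x \<subseteq> K \<Longrightarrow>
    frag_eval w x = (\<Sum>k\<in>K. of_int (Poly_Mapping.lookup x k) * w k)"
  unfolding frag_eval_def by (intro sum.mono_neutral_left) (auto simp: in_keys_iff)

lemma frag_eval_add: "frag_eval w (x + y) = frag_eval w x + frag_eval w y"
proof -
  let ?K = "Poly_Mapping.keys x \<union> Poly_Mapping.keys y"
  have "frag_eval w (x + y) = (\<Sum>k\<in>?K. of_int (Poly_Mapping.lookup (x + y) k) * w k)"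
    by (intro frag_eval_superset Poly_Mapping.keys_add) simp
  then show ?thesis
    by (simp add: frag_eval_superset[of ?K x] frag_eval_superset[of ?K y] lookup_add distrib_right sum.distrib)
qed

lemma frag_eval_0 [simp]: "frag_eval w 0 = 0"
  by (simp add: frag_eval_def)

lemma frag_eval_minus: "frag_eval w (- x) = - frag_eval w x"
  using frag_eval_add[of w x "- x"] by simp

lemma frag_eval_diff: "frag_eval w (x - y) = frag_eval w x - frag_eval w y"
  using frag_eval_add[of w "x - y" y] by simp

lemma frag_eval_of [simp]: "frag_eval w (frag_of k) = w k"
  by (simp add: frag_eval_def)

lemma frag_eval_cmul: "frag_eval w (frag_cmul c x) = of_int c * frag_eval w x"
proof -
  have "frag_eval w (frag_cmul c x) =
      (\<Sum>k\<in>Poly_Mapping.keys x. of_int (Poly_Mapping.lookup (frag_cmul c x) k) * w k)"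
    by (intro frag_eval_superset) (auto simp: keys_cmul)
  then show ?thesis by (simp add: frag_eval_def sum_distrib_left mult.assoc)
qed

lemma frag_eval_extend: "frag_eval w (frag_extend f x) = frag_eval (\<lambda>k. frag_eval w (f k)) x"
proof -
  have sum: "frag_eval w (sum g I) = (\<Sum>i\<in>I. frag_eval w (g i))" if "finite I" for g I
    using that by (induction I rule: finite_induct) (simp_all add: frag_eval_add)
  have "frag_eval w (frag_extend f x) =
      (\<Sum>k\<in>Poly_Mapping.keys x. of_int (Poly_Mapping.lookup x k) * frag_eval w (f k))"
    unfolding frag_extend_def by (subst sum) (simp_all add: frag_eval_cmul)
  then show ?thesis by (simp add: frag_eval_def)
qed

section \<open>Linear functionals on the tensor product with the reals\<close>

locale real_tensor = comm_group A for A (structure)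
begin

abbreviation "F \<equiv> free_Abelian_group (carrier A \<times> (UNIV :: real set))"
abbreviation scale :: "real \<Rightarrow> (('a \<times> real) \<Rightarrow>\<^sub>0 int) \<Rightarrow> (('a \<times> real) \<Rightarrow>\<^sub>0 int)" where
  "scale c \<equiv> frag_extend (\<lambda>(a, r). frag_of (a, c * r))"

definition relators :: "(('a \<times> real) \<Rightarrow>\<^sub>0 int) set" where
  "relators = {frag_of (a \<otimes> b, r) - frag_of (a, r) - frag_of (b, r) | a b r.
         a \<in> carrier A \<and> b \<in> carrier A} \<union>
      {frag_of (a, r + s) - frag_of (a, r) - frag_of (a, s) | a r s. a \<in> carrier A}"

lemma relatorsI:
  "a \<in> carrier A \<Longrightarrow> b \<in> carrier A \<Longrightarrow> frag_of (a \<otimes> b, r) - frag_of (a, r) - frag_of (b, r) \<in> relators"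
  "a \<in> carrier A \<Longrightarrow> frag_of (a, r + s) - frag_of (a, r) - frag_of (a, s) \<in> relators"
  unfolding relators_def by blast+

lemma relatorsE:
  assumes "x \<in> relators"
  obtains a b r where "a \<in> carrier A" "b \<in> carrier A" "x = frag_of (a \<otimes> b, r) - frag_of (a, r) - frag_of (b, r)"
    | a r s where "a \<in> carrier A" "x = frag_of (a, r + s) - frag_of (a, r) - frag_of (a, s)"
  using assms unfolding relators_def by blast

lemma tensor_relations_eq: "tensor_relations A = generate F relators"
  by (simp add: tensor_relations_def relators_def)

lemma keys_relators: "x \<in> relators \<Longrightarrow> Poly_Mapping.keys x \<subseteq> carrier A \<times> UNIV"
proof -
  have keys3: "Poly_Mapping.keys (frag_of k1 - frag_of k2 - frag_of k3) \<subseteq> carrier A \<times> UNIV"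
    if "k1 \<in> carrier A \<times> UNIV" "k2 \<in> carrier A \<times> UNIV" "k3 \<in> carrier A \<times> UNIV"
    for k1 k2 k3 :: "'a \<times> real"
    using that keys_diff[of "frag_of k1 - frag_of k2" "frag_of k3"] keys_diff[of "frag_of k1" "frag_of k2"]
    by (auto simp: keys_frag_of)
  assume "x \<in> relators"
  then show ?thesis unfolding relators_def
    by (elim UnE CollectE exE conjE) (simp_all only:, (rule keys3; simp)+)
qed

lemma relations_subgroup: "subgroup (tensor_relations A) F"
  unfolding tensor_relations_eq
  by (rule group.generate_is_subgroup) (use keys_relators in auto)

lemma relations_keys: "x \<in> tensor_relations A \<Longrightarrow> Poly_Mapping.keys x \<subseteq> carrier A \<times> UNIV"
  using subgroup.mem_carrier[OF relations_subgroup] by simp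

lemma relations_0: "0 \<in> tensor_relations A"
  using subgroup.one_closed[OF relations_subgroup] by simp

lemma relations_add: "x \<in> tensor_relations A \<Longrightarrow> y \<in> tensor_relations A \<Longrightarrow> x + y \<in> tensor_relations A"
  using subgroup.m_closed[OF relations_subgroup] by simp

lemma relations_minus: "x \<in> tensor_relations A \<Longrightarrow> - x \<in> tensor_relations A"
  using subgroup.m_inv_closed[OF relations_subgroup, of x] relations_keys[of x] by simp

lemma relations_induct [consumes 1, case_names zero gen minus add]:
  assumes "x \<in> tensor_relations A" "P 0" "\<And>x. x \<in> relators \<Longrightarrow> P x"
    "\<And>x. x \<in> relators \<Longrightarrow> P x \<Longrightarrow> P (- x)"
    "\<And>x y. x \<in> tensor_relations A \<Longrightarrow> y \<in> tensor_relations A \<Longrightarrow> P x \<Longrightarrow> P y \<Longrightarrow> P (x + y)"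
  shows "P x"
  using assms(1) unfolding tensor_relations_eq
proof (induction rule: generate.induct)
  case (inv h) then show ?case using assms(3,4)[of h] keys_relators[of h] by simp
qed (use assms in \<open>simp_all add: tensor_relations_eq\<close>)

lemma scale_relations: "x \<in> tensor_relations A \<Longrightarrow> scale c x \<in> tensor_relations A"
proof (induction rule: relations_induct)
  case (gen x)
  then have "scale c x \<in> relators"
    by (elim relatorsE) (simp_all add: frag_extend_diff distrib_left relatorsI)
  then show ?case by (simp add: tensor_relations_eq generate.incl)
qed (auto simp: relations_0 relations_add relations_minus frag_extend_minus frag_extend_add)

lemma mem_tensor_coset: "y \<in> tensor_coset A x \<longleftrightarrow> (\<exists>r\<in>tensor_relations A. y = r + x)"
  by (auto simp: tensor_coset_def r_coset_def)

lemma tensor_coset_absorb: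
  assumes r: "r \<in> tensor_relations A"
  shows "tensor_coset A (r + x) = tensor_coset A x"
proof (intro Set.set_eqI iffI)
  fix y
  show "y \<in> tensor_coset A x" if "y \<in> tensor_coset A (r + x)"
    using that r unfolding mem_tensor_coset by (metis add.assoc relations_add)
  assume "y \<in> tensor_coset A x"
  then obtain q where q: "q \<in> tensor_relations A" "y = q + x" by (auto simp: mem_tensor_coset)
  have "q + - r \<in> tensor_relations A" using q r by (intro relations_add relations_minus)
  moreover have "y = (q + - r) + (r + x)" using q by simp
  ultimately show "y \<in> tensor_coset A (r + x)" unfolding mem_tensor_coset by blast
qed

text \<open>Scaling maps relators to relators, so all representatives land in one coset and the
  union defining \<open>tensor_scale\<close> collapses.\<close>

lemma tensor_scale_coset: "tensor_scale A c (tensor_coset A x) = tensor_coset A (scale c x)"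
proof -
  have "tensor_coset A (scale c y) = tensor_coset A (scale c x)" if y: "y \<in> tensor_coset A x" for y
  proof -
    obtain r where "r \<in> tensor_relations A" "y = r + x" using y by (auto simp: mem_tensor_coset)
    then show ?thesis using tensor_coset_absorb[OF scale_relations] by (simp add: frag_extend_add)
  qed
  moreover have "x \<in> tensor_coset A x" using relations_0 by (force simp: mem_tensor_coset)
  ultimately show ?thesis unfolding tensor_scale_def by blast
qed

lemma tensor_coset_closed:
  "Poly_Mapping.keys x \<subseteq> carrier A \<times> UNIV \<Longrightarrow> tensor_coset A x \<in> carrier (tensor_real A)"
  by (auto simp: tensor_real_def FactGroup_def RCOSETS_def tensor_coset_def)

lemma tensor_real_carrierE:
  assumes "v \<in> carrier (tensor_real A)"
  obtains x where "Poly_Mapping.keys x \<subseteq> carrier A \<times> UNIV" "v = tensor_coset A x"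
  using assms by (auto simp: tensor_real_def FactGroup_def RCOSETS_def tensor_coset_def)

lemma tensor_real_comm_group: "comm_group (tensor_real A)"
  unfolding tensor_real_def
  by (rule comm_group.abelian_FactGroup[OF abelian_free_Abelian_group relations_subgroup])

lemma tensor_real_mult: "v \<otimes>\<^bsub>tensor_real A\<^esub> w = {x + y | x y. x \<in> v \<and> y \<in> w}"
  by (auto simp: tensor_real_def FactGroup_def set_mult_def)

text \<open>For additive \<alpha> this is the linear functional sending the pure tensor of a and r
  to r \<alpha>(a). The chosen representative does not matter then, because the evaluation vanishes
  on \<open>tensor_relations\<close>.\<close>

definition coset_eval :: "('a \<Rightarrow> real) \<Rightarrow> (('a \<times> real) \<Rightarrow>\<^sub>0 int) set \<Rightarrow> real" where
  "coset_eval \<alpha> v = frag_eval (\<lambda>(a, r). r * \<alpha> a) (SOME x. x \<in> v)"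

lemma coset_eval_eq:
  "y \<in> v \<Longrightarrow> (\<And>x. x \<in> v \<Longrightarrow> frag_eval (\<lambda>(a, r). r * \<alpha> a) x = c) \<Longrightarrow> coset_eval \<alpha> v = c"
  unfolding coset_eval_def by (metis someI)

context
  fixes \<alpha> :: "'a \<Rightarrow> real"
  assumes additive: "\<And>a b. a \<in> carrier A \<Longrightarrow> b \<in> carrier A \<Longrightarrow> \<alpha> (a \<otimes> b) = \<alpha> a + \<alpha> b"
begin

lemma frag_eval_relations: "x \<in> tensor_relations A \<Longrightarrow> frag_eval (\<lambda>(a, r). r * \<alpha> a) x = 0"
proof (induction rule: relations_induct)
  case (gen x) then show ?case
    by (elim relatorsE) (simp_all add: frag_eval_diff additive distrib_left distrib_right)
qed (auto simp: frag_eval_minus frag_eval_add)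

lemma coset_eval_coset: "coset_eval \<alpha> (tensor_coset A x) = frag_eval (\<lambda>(a, r). r * \<alpha> a) x"
proof (rule coset_eval_eq)
  show "x \<in> tensor_coset A x" using relations_0 by (force simp: mem_tensor_coset)
qed (auto simp: mem_tensor_coset frag_eval_add frag_eval_relations)

lemma tensor_functional_coset_eval: "tensor_functional A (coset_eval \<alpha>)"
  unfolding tensor_functional_def
proof (intro conjI ballI allI)
  fix v w assume "v \<in> carrier (tensor_real A)" "w \<in> carrier (tensor_real A)"
  then obtain x y where xy: "v = tensor_coset A x" "w = tensor_coset A y"
    by (elim tensor_real_carrierE)
  have "coset_eval \<alpha> (v \<otimes>\<^bsub>tensor_real A\<^esub> w) =
      frag_eval (\<lambda>(a, r). r * \<alpha> a) x + frag_eval (\<lambda>(a, r). r * \<alpha> a) y"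
  proof (rule coset_eval_eq)
    have "x \<in> v" "y \<in> w" using relations_0 xy by (force simp: mem_tensor_coset)+
    then show "x + y \<in> v \<otimes>\<^bsub>tensor_real A\<^esub> w" by (auto simp: tensor_real_mult)
  qed (auto simp: tensor_real_mult xy mem_tensor_coset frag_eval_add frag_eval_relations)
  then show "coset_eval \<alpha> (v \<otimes>\<^bsub>tensor_real A\<^esub> w) = coset_eval \<alpha> v + coset_eval \<alpha> w"
    by (simp add: xy coset_eval_coset)
next
  fix c v assume "v \<in> carrier (tensor_real A)"
  then obtain x where x: "v = tensor_coset A x" by (elim tensor_real_carrierE)
  have "frag_eval (\<lambda>(a, r). r * \<alpha> a) (scale c x) = c * frag_eval (\<lambda>(a, r). r * \<alpha> a) x"
    by (simp add: frag_eval_extend case_prod_unfold) (simp add: frag_eval_def sum_distrib_left mult_ac)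
  then show "coset_eval \<alpha> (tensor_scale A c v) = c * coset_eval \<alpha> v"
    by (simp add: x tensor_scale_coset coset_eval_coset)
qed

lemma coset_eval_finprod:
  assumes "finite B" "\<And>g. g \<in> B \<Longrightarrow> h g \<in> carrier (tensor_real A)"
  shows "coset_eval \<alpha> (finprod (tensor_real A) h B) = (\<Sum>g\<in>B. coset_eval \<alpha> (h g))"
proof -
  interpret T: comm_group "tensor_real A" by (rule tensor_real_comm_group)
  have l: "coset_eval \<alpha> (v \<otimes>\<^bsub>tensor_real A\<^esub> w) = coset_eval \<alpha> v + coset_eval \<alpha> w"
    if "v \<in> carrier (tensor_real A)" "w \<in> carrier (tensor_real A)" for v w
    using tensor_functional_coset_eval that by (simp add: tensor_functional_def)
  have one: "coset_eval \<alpha> \<one>\<^bsub>tensor_real A\<^esub> = 0" using l[of "\<one>\<^bsub>tensor_real A\<^esub>" "\<one>\<^bsub>tensor_real A\<^esub>"] by simp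
  show ?thesis using assms
    by (induction B rule: finite_induct) (simp_all add: one l T.finprod_insert Pi_iff T.finprod_closed)
qed

end

end

text \<open>A homomorphism to the reals factors through the abelianization and induces a linear
  functional on the tensor product. By definition of \<open>tensor_topology\<close> this functional
  is continuous, so it can be applied to the limit of the finite sums. Convergence of the real
  series is part of the outcome.\<close>

lemma (in group) abelian_centered_has_sum:
  assumes centered: "abelian_centered G \<mu>"
    and hom: "\<And>g h. g \<in> carrier G \<Longrightarrow> h \<in> carrier G \<Longrightarrow> \<phi> (g \<otimes> h) = \<phi> g + (\<phi> h :: real)"
  shows "((\<lambda>g. pmf \<mu> g * \<phi> g) has_sum 0) (carrier G)"
proof -
  define A where "A = abelianization G"
  define N where "N = derived G (carrier G)"
  interpret N: normal N G unfolding N_def by (rule derived_self_is_normal)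
  interpret A: real_tensor A
    unfolding A_def abelianization_def real_tensor_def by (rule derived_quot_is_comm_group)
  have \<phi>1: "\<phi> \<one> = 0" using hom[of \<one> \<one>] by simp
  have \<phi>inv: "\<phi> (inv g) = - \<phi> g" if "g \<in> carrier G" for g
    using hom[of g "inv g"] that \<phi>1 by simp
  have \<phi>N: "\<phi> n = 0" if "n \<in> N" for n
    using that unfolding N_def derived_def
  proof (induction rule: generate.induct)
    case (eng h1 h2)
    then have "h1 \<in> carrier G" "h2 \<in> carrier G"
      using generate_in_carrier[OF derived_set_in_carrier[OF order_refl]] by auto
    then show ?case using eng hom by simp
  qed (auto simp: hom \<phi>1 \<phi>inv)
  \<comment> \<open>\<phi> is constant on cosets of the derived subgroup, since it vanishes on
    commutators.\<close>
  define \<alpha> where "\<alpha> a = \<phi> (SOME x. x \<in> a)" for a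
  have \<alpha>: "\<alpha> a = c" if "y \<in> a" "\<And>x. x \<in> a \<Longrightarrow> \<phi> x = c" for a y c
    unfolding \<alpha>_def using that by (metis someI)
  have \<alpha>_coset: "\<alpha> (N #> g) = \<phi> g" if "g \<in> carrier G" for g
  proof (rule \<alpha>)
    show "g \<in> N #> g" using that by (rule rcos_self) (rule N.subgroup_axioms)
  qed (use that in \<open>auto simp: r_coset_def hom \<phi>N\<close>)
  have additive: "\<alpha> (a \<otimes>\<^bsub>A\<^esub> b) = \<alpha> a + \<alpha> b" if "a \<in> carrier A" "b \<in> carrier A" for a b
  proof -
    obtain g h where gh: "g \<in> carrier G" "a = N #> g" "h \<in> carrier G" "b = N #> h"
      using \<open>a \<in> carrier A\<close> \<open>b \<in> carrier A\<close>
      by (auto simp: A_def abelianization_def FactGroup_def RCOSETS_def N_def)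
    then show ?thesis
      using N.rcos_sum[of g h]
      by (simp add: \<alpha>_coset hom A_def abelianization_def FactGroup_def flip: N_def)
  qed
  note functional = A.tensor_functional_coset_eval[of \<alpha>, OF additive]
  let ?l = "A.coset_eval \<alpha>"
  define h where "h g = tensor_scale A (pmf \<mu> g) (ab_class G g)" for g
  have coset_in: "N #> g \<in> carrier A" if "g \<in> carrier G" for g
    using that by (auto simp: A_def abelianization_def FactGroup_def RCOSETS_def N_def)
  have h_eq: "h g = tensor_coset A (frag_of (N #> g, pmf \<mu> g))" for g
    by (simp add: h_def ab_class_def pure_tensor_def A.tensor_scale_coset flip: A_def N_def)
  have h_closed: "h g \<in> carrier (tensor_real A)" if "g \<in> carrier G" for g
    unfolding h_eq by (rule A.tensor_coset_closed) (simp add: keys_frag_of coset_in that)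
  have lh: "?l (h g) = pmf \<mu> g * \<phi> g" if "g \<in> carrier G" for g
    unfolding h_eq using A.coset_eval_coset[of \<alpha>, OF additive] that by (simp add: \<alpha>_coset)
  have lfin: "?l (finprod (tensor_real A) h B) = (\<Sum>g\<in>B. pmf \<mu> g * \<phi> g)"
    if "finite B" "B \<subseteq> carrier G" for B
    using A.coset_eval_finprod[of \<alpha> B h, OF additive] that h_closed lh
    by (simp add: subset_iff cong: sum.cong)
  have lim: "limitin (tensor_topology A) (\<lambda>B. finprod (tensor_real A) h B) \<one>\<^bsub>tensor_real A\<^esub>
      (finite_subsets_at_top (carrier G))"
    using centered unfolding abelian_centered_def h_def[abs_def] A_def .
  interpret T: comm_group "tensor_real A" by (rule A.tensor_real_comm_group)
  have l1: "?l \<one>\<^bsub>tensor_real A\<^esub> = 0" using lfin[of "{}"] by simp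
  show ?thesis
    unfolding has_sum_def
  proof (rule topological_tendstoI)
    fix U :: "real set" assume U: "open U" "0 \<in> U"
    let ?W = "{v \<in> carrier (tensor_real A). ?l v \<in> U}"
    have "openin (tensor_topology A) ?W"
      unfolding tensor_topology_def using functional U
      by (intro topology_generated_by_Basis) blast
    moreover have "\<one>\<^bsub>tensor_real A\<^esub> \<in> ?W" using l1 U by simp
    ultimately have "\<forall>\<^sub>F B in finite_subsets_at_top (carrier G). finprod (tensor_real A) h B \<in> ?W"
      using lim unfolding limitin_def by blast
    moreover have "\<forall>\<^sub>F B in finite_subsets_at_top (carrier G). finite B \<and> B \<subseteq> carrier G"
      by (rule eventually_finite_subsets_at_top_weakI) simp
    ultimately show "\<forall>\<^sub>F B in finite_subsets_at_top (carrier G). (\<Sum>g\<in>B. pmf \<mu> g * \<phi> g) \<in> U"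
      by eventually_elim (use lfin in auto)
  qed
qed

section \<open>Unordered sums against a probability mass function\<close>

lemma has_sum_finite_sum:
  fixes f :: "'i \<Rightarrow> 'a \<Rightarrow> real"
  assumes "\<And>i. i \<in> I \<Longrightarrow> (f i has_sum s i) A"
  shows "((\<lambda>x. \<Sum>i\<in>I. f i x) has_sum (\<Sum>i\<in>I. s i)) A"
proof (cases "finite I")
  case True
  then show ?thesis using assms by (induction I rule: finite_induct) (auto intro: has_sum_add)
qed simp

lemma has_sum_expectation_pmf:
  fixes f :: "'a \<Rightarrow> 'b :: {banach, second_countable_topology}"
  assumes "integrable (measure_pmf p) f" "set_pmf p \<subseteq> A"
  shows "((\<lambda>x. pmf p x *\<^sub>R f x) has_sum measure_pmf.expectation p f) A"
proof -
  have "integrable (count_space UNIV) (\<lambda>x. pmf p x *\<^sub>R f x)"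
    using assms(1) unfolding measure_pmf_eq_density
    by (subst (asm) integrable_density) auto
  then have abs: "Infinite_Set_Sum.abs_summable_on (\<lambda>x. pmf p x *\<^sub>R f x) UNIV"
    by (simp add: Infinite_Set_Sum.abs_summable_on_def)
  have "measure_pmf.expectation p f = (\<Sum>\<^sub>\<infinity>x\<in>UNIV. pmf p x *\<^sub>R f x)"
    unfolding infsetsum_infsum[OF abs, symmetric] infsetsum_def measure_pmf_eq_density
    by (intro integral_density) auto
  moreover have "(\<lambda>x. pmf p x *\<^sub>R f x) summable_on UNIV"
    using abs abs_summable_equivalent abs_summable_summable by blast
  ultimately have "((\<lambda>x. pmf p x *\<^sub>R f x) has_sum measure_pmf.expectation p f) UNIV"
    by (simp add: has_sum_infsum)
  then show ?thesis
    by (rule has_sum_cong_neutral[THEN iffD1, rotated -1]) (use assms(2) in \<open>auto simp: set_pmf_eq\<close>)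
qed

lemma has_sum_pmf: "set_pmf p \<subseteq> A \<Longrightarrow> (pmf p has_sum 1) A"
  using has_sum_expectation_pmf[of p "\<lambda>_. 1::real" A] by simp

lemma infsum_pmf: "set_pmf p \<subseteq> A \<Longrightarrow> infsum (pmf p) A = 1"
  by (rule infsumI[OF has_sum_pmf])

lemma summable_pmf: "set_pmf p \<subseteq> A \<Longrightarrow> pmf p summable_on A"
  using has_sum_pmf has_sum_imp_summable by blast

lemma integrable_measure_pmfI:
  fixes f :: "'a \<Rightarrow> 'b :: {banach, second_countable_topology}"
  assumes "set_pmf p \<subseteq> A" "(\<lambda>x. pmf p x * norm (f x)) summable_on A"
  shows "integrable (measure_pmf p) f"
proof -
  have "(\<lambda>x. norm (pmf p x *\<^sub>R f x)) summable_on UNIV"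
    using assms(2)
    by (rule summable_on_cong_neutral[THEN iffD1, rotated -1]) (use assms(1) in \<open>auto simp: set_pmf_eq\<close>)
  then have "Infinite_Set_Sum.abs_summable_on (\<lambda>x. pmf p x *\<^sub>R f x) UNIV"
    by (simp add: abs_summable_equivalent[symmetric])
  then have "integrable (count_space UNIV) (\<lambda>x. pmf p x *\<^sub>R f x)"
    by (simp add: Infinite_Set_Sum.abs_summable_on_def)
  then show ?thesis unfolding measure_pmf_eq_density by (subst integrable_density) auto
qed

lemma sum_list_eq_sum_count:
  fixes f :: "'a \<Rightarrow> real"
  assumes "finite S" "set w \<subseteq> S"
  shows "sum_list (map f w) = (\<Sum>s\<in>S. f s * real (count_list w s))"
  using assms(2)
proof (induction w)
  case (Cons t w)
  have "(\<Sum>s\<in>S. f s * real (count_list (t # w) s)) =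
      (\<Sum>s\<in>S. f s * real (count_list w s) + (if s = t then f s else 0))"
    by (intro sum.cong) (auto simp: algebra_simps)
  also have "\<dots> = (\<Sum>s\<in>S. f s * real (count_list w s)) + f t"
    using Cons.prems assms(1) by (simp add: sum.distrib)
  finally show ?case using Cons by simp
qed simp

section \<open>Moments of the walk and quasi-homomorphisms\<close>

locale centered_walk = sym_gen_group +
  fixes \<mu> :: "'a pmf"
  assumes supp: "set_pmf \<mu> \<subseteq> carrier G" and adapted: "adapted G \<mu>"
    and smooth: "smooth G S \<mu>" and centered: "abelian_centered G \<mu>"
begin

text \<open>Half of the exponent is spent on the factor (1 + |g|)^2, which later pays for
  second-order Taylor remainders. The number \<eta> is small enough that \<eta>(1 + n) is at most
  exp(\<zeta> n / 4).\<close>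

lemma exponential_moment:
  "\<exists>\<delta>>0. (\<lambda>g. pmf \<mu> g * ((1 + real (len g))\<^sup>2 * exp (\<delta> * real (len g)))) summable_on carrier G"
proof -
  obtain \<zeta> where \<zeta>: "\<zeta> > 0" and sm: "(\<lambda>x. pmf \<mu> x * exp (\<zeta> * real (len x))) summable_on carrier G"
    using smooth by (auto simp: smooth_def)
  define \<eta> where "\<eta> = min 1 (\<zeta> / 4)"
  have \<eta>: "0 < \<eta>" "\<eta> \<le> 1" "\<eta> \<le> \<zeta> / 4" using \<zeta> by (auto simp: \<eta>_def)
  have bound: "(1 + real n)\<^sup>2 * exp (\<zeta> / 2 * real n) \<le> inverse (\<eta>\<^sup>2) * exp (\<zeta> * real n)" for n
  proof -
    have "\<eta> * (1 + real n) \<le> 1 + \<zeta> / 4 * real n"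
      using \<eta> mult_right_mono[OF \<eta>(3), of "real n"] by (simp add: distrib_left)
    also have "\<dots> \<le> exp (\<zeta> / 4 * real n)" by (rule exp_ge_add_one_self)
    finally have "(\<eta> * (1 + real n))\<^sup>2 \<le> (exp (\<zeta> / 4 * real n))\<^sup>2"
      using \<eta> by (intro power_mono) auto
    also have "\<dots> = exp (\<zeta> / 2 * real n)"
      by (simp add: power2_eq_square flip: exp_add)
    finally have "inverse (\<eta>\<^sup>2) * (\<eta> * (1 + real n))\<^sup>2 \<le> inverse (\<eta>\<^sup>2) * exp (\<zeta> / 2 * real n)"
      by (intro mult_left_mono) auto
    moreover have "inverse (\<eta>\<^sup>2) * (\<eta> * (1 + real n))\<^sup>2 = (1 + real n)\<^sup>2"
      using \<eta> by (simp add: power_mult_distrib mult.assoc[symmetric])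
    ultimately have "(1 + real n)\<^sup>2 \<le> inverse (\<eta>\<^sup>2) * exp (\<zeta> / 2 * real n)"
      by simp
    then have "(1 + real n)\<^sup>2 * exp (\<zeta> / 2 * real n) \<le>
        inverse (\<eta>\<^sup>2) * exp (\<zeta> / 2 * real n) * exp (\<zeta> / 2 * real n)"
      by (intro mult_right_mono) auto
    then show ?thesis by (simp add: mult.assoc flip: exp_add)
  qed
  have "(\<lambda>g. pmf \<mu> g * ((1 + real (len g))\<^sup>2 * exp (\<zeta> / 2 * real (len g)))) summable_on carrier G"
  proof (rule summable_on_abs_boundI[OF summable_on_cmult_right[OF sm, of "inverse (\<eta>\<^sup>2)"]])
    fix g
    show "\<bar>pmf \<mu> g * ((1 + real (len g))\<^sup>2 * exp (\<zeta> / 2 * real (len g)))\<bar> \<le>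
        inverse (\<eta>\<^sup>2) * (pmf \<mu> g * exp (\<zeta> * real (len g)))"
      using mult_left_mono[OF bound[of "len g"] pmf_nonneg[of \<mu> g]] by (simp add: mult_ac)
  qed
  then show ?thesis using \<zeta> by (intro exI[of _ "\<zeta> / 2"]) auto
qed

text \<open>The defect is bilinear in the lengths, unlike the bounded defect of a usual
  quasimorphism.\<close>

abbreviation quasi_hom :: "('a \<Rightarrow> real) \<Rightarrow> real \<Rightarrow> bool" where
  "quasi_hom \<gamma> M \<equiv> (\<forall>g\<in>carrier G. \<forall>h\<in>carrier G. \<bar>\<gamma> (g \<otimes> h) - \<gamma> g - \<gamma> h\<bar> \<le> M * real (len g) * real (len h))"

text \<open>Fixed once and for all; it is the upper limit for the Lipschitz constant of every weight
  in the energy estimates.\<close>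

definition \<delta>\<^sub>0 :: real where
  "\<delta>\<^sub>0 = (SOME \<delta>. \<delta> > 0 \<and> (\<lambda>g. pmf \<mu> g * ((1 + real (len g))\<^sup>2 * exp (\<delta> * real (len g)))) summable_on carrier G)"

definition moment :: real where
  "moment = (\<Sum>\<^sub>\<infinity>g\<in>carrier G. pmf \<mu> g * ((1 + real (len g))\<^sup>2 * exp (\<delta>\<^sub>0 * real (len g))))"

lemma \<delta>\<^sub>0_pos: "0 < \<delta>\<^sub>0"
  and moment_summable:
    "(\<lambda>g. pmf \<mu> g * ((1 + real (len g))\<^sup>2 * exp (\<delta>\<^sub>0 * real (len g)))) summable_on carrier G"
  using someI_ex[OF exponential_moment] by (auto simp: \<delta>\<^sub>0_def)

lemma moment_dominates:
  assumes "\<And>g. g \<in> carrier G \<Longrightarrow> \<bar>f g\<bar> \<le> c * ((1 + real (len g))\<^sup>2 * exp (\<delta>\<^sub>0 * real (len g)))"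
  shows "(\<lambda>g. pmf \<mu> g * f g) summable_on carrier G"
    and "\<bar>\<Sum>\<^sub>\<infinity>g\<in>carrier G. pmf \<mu> g * f g\<bar> \<le> c * moment"
proof -
  let ?w = "\<lambda>g. (1 + real (len g))\<^sup>2 * exp (\<delta>\<^sub>0 * real (len g))"
  have le: "\<bar>pmf \<mu> g * f g\<bar> \<le> c * (pmf \<mu> g * ?w g)" if "g \<in> carrier G" for g
    using mult_left_mono[OF assms[OF that] pmf_nonneg[of \<mu> g]] by (simp add: abs_mult mult_ac)
  show s: "(\<lambda>g. pmf \<mu> g * f g) summable_on carrier G"
    by (rule summable_on_abs_boundI[OF summable_on_cmult_right[OF moment_summable] le])
  have "\<bar>\<Sum>\<^sub>\<infinity>g\<in>carrier G. pmf \<mu> g * f g\<bar> \<le> (\<Sum>\<^sub>\<infinity>g\<in>carrier G. \<bar>pmf \<mu> g * f g\<bar>)"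
    by (rule abs_infsum_le[OF s])
  also have "\<dots> \<le> (\<Sum>\<^sub>\<infinity>g\<in>carrier G. c * (pmf \<mu> g * ?w g))"
    using s by (intro infsum_mono summable_on_cmult_right[OF moment_summable] le)
      (auto dest: summable_on_iff_abs_summable_on_real[THEN iffD1])
  also have "\<dots> = c * moment" by (simp add: moment_def infsum_cmult_right')
  finally show "\<bar>\<Sum>\<^sub>\<infinity>g\<in>carrier G. pmf \<mu> g * f g\<bar> \<le> c * moment" .
qed

lemma moment_weight_ge:
  "1 \<le> (1 + real n)\<^sup>2 * exp (\<delta>\<^sub>0 * real n)"
  "real n \<le> (1 + real n)\<^sup>2 * exp (\<delta>\<^sub>0 * real n)"
  "(real n)\<^sup>2 \<le> (1 + real n)\<^sup>2 * exp (\<delta>\<^sub>0 * real n)"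
proof -
  have e: "1 \<le> exp (\<delta>\<^sub>0 * real n)" using \<delta>\<^sub>0_pos by simp
  have le: "a \<le> (1 + real n)\<^sup>2 * exp (\<delta>\<^sub>0 * real n)" if "a \<le> (1 + real n)\<^sup>2" for a
    using mult_left_mono[OF e zero_le_power2[of "1 + real n"]] that by linarith
  show "1 \<le> (1 + real n)\<^sup>2 * exp (\<delta>\<^sub>0 * real n)" "real n \<le> (1 + real n)\<^sup>2 * exp (\<delta>\<^sub>0 * real n)"
    "(real n)\<^sup>2 \<le> (1 + real n)\<^sup>2 * exp (\<delta>\<^sub>0 * real n)"
    by (rule le; simp add: power2_eq_square algebra_simps)+
qed

text \<open>Splitting off the first letter costs at most M times the length of the rest; these costs
  add up to less than M times the squared length.\<close>

lemma quasi_hom_word: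
  fixes \<gamma> :: "'a \<Rightarrow> real"
  assumes M: "0 \<le> M"
    and quasi: "\<And>g h. g \<in> carrier G \<Longrightarrow> h \<in> carrier G \<Longrightarrow>
        \<bar>\<gamma> (g \<otimes> h) - \<gamma> g - \<gamma> h\<bar> \<le> M * real (len g) * real (len h)"
    and w: "set w \<subseteq> S"
  shows "\<bar>\<gamma> (wprod w) - sum_list (map \<gamma> w)\<bar> \<le> M * (real (length w))\<^sup>2"
  using w
proof (induction w)
  case Nil
  show ?case using quasi[of \<one> \<one>] by simp
next
  case (Cons s w)
  then have s: "s \<in> S" "s \<in> carrier G" and wS: "set w \<subseteq> S" and wc: "wprod w \<in> carrier G"
    by (auto intro: S_carrier wprod_closed)
  have "M * real (len s) * real (len (wprod w)) \<le> M * 1 * real (length w)"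
    using M len_gen[OF s(1)] len_wprod_le[OF wS] by (intro mult_mono) auto
  then have "\<bar>\<gamma> (s \<otimes> wprod w) - \<gamma> s - \<gamma> (wprod w)\<bar> \<le> M * real (length w)"
    using quasi[OF s(2) wc] by simp
  moreover have "M * real (length w) + M * (real (length w))\<^sup>2 \<le> M * (real (length (s # w)))\<^sup>2"
    using M by (simp add: power2_eq_square algebra_simps)
  ultimately show ?case using Cons.IH[OF wS] by simp
qed

text \<open>Centering means that the mean letter counts of \<open>\<mu>\<close> are a real combination of the letter
  counts of finitely many relators, and a quasi-homomorphism is small on relators.\<close>

lemma centered_quasi_hom:
  "\<exists>C\<ge>0. \<forall>\<gamma> M. 0 \<le> M \<longrightarrow>
     quasi_hom \<gamma> M \<longrightarrow>
     (\<lambda>g. pmf \<mu> g * \<gamma> g) summable_on carrier G \<and> \<bar>\<Sum>\<^sub>\<infinity>g\<in>carrier G. pmf \<mu> g * \<gamma> g\<bar> \<le> C * M"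
proof -
  define cnt where "cnt g s = real (count_list (geodesic g) s)" for g s
  define m where "m s = (\<Sum>\<^sub>\<infinity>g\<in>carrier G. pmf \<mu> g * cnt g s)" for s
  define I where "I = {w. set w \<subseteq> S \<and> wprod w = \<one>}"
  have cnt_le: "\<bar>cnt g s\<bar> \<le> 1 * ((1 + real (len g))\<^sup>2 * exp (\<delta>\<^sub>0 * real (len g)))" if "g \<in> carrier G" for g s
    using count_le_length[of "geodesic g" s] geodesic(3)[OF that] moment_weight_ge(2)[of "len g"]
    by (simp add: cnt_def)
  have m: "((\<lambda>g. pmf \<mu> g * cnt g s) has_sum m s) (carrier G)" for s
    unfolding m_def by (intro has_sum_infsum moment_dominates(1)[OF cnt_le])
  have lin: "((\<lambda>g. pmf \<mu> g * (\<Sum>s\<in>S. b s * cnt g s)) has_sum (\<Sum>s\<in>S. b s * m s)) (carrier G)" for b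
    using has_sum_finite_sum[where I = S and f = "\<lambda>s g. b s * (pmf \<mu> g * cnt g s)" and s = "\<lambda>s. b s * m s", OF has_sum_cmult_right[OF m]]
    by (simp add: sum_distrib_left mult_ac)
  have "\<exists>F c. finite F \<and> F \<subseteq> I \<and> (\<forall>s\<in>S. m s = (\<Sum>w\<in>F. c w * real (count_list w s)))"
  proof (rule orthogonality_imp_combination[OF finite_S])
    \<comment> \<open>Orthogonality to all relators turns the weighted letter count of geodesics
      into a homomorphism, whose mean vanishes by centering.\<close>
    fix b assume b: "\<And>w. w \<in> I \<Longrightarrow> (\<Sum>s\<in>S. b s * real (count_list w s)) = 0"
    define \<phi> where "\<phi> g = (\<Sum>s\<in>S. b s * cnt g s)" for g
    have rel: "\<phi> g + \<phi> h = \<phi> (g \<otimes> h)" if g: "g \<in> carrier G" and h: "h \<in> carrier G" for g h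
    proof -
      let ?k = "g \<otimes> h"
      have k: "?k \<in> carrier G" using g h by simp
      note geo = geodesic[OF g] geodesic[OF h] geodesic[OF k]
      let ?v = "winv (geodesic ?k)"
      have v: "set ?v \<subseteq> S" using geo by (intro winv_set)
      \<comment> \<open>Both words are relators with the same tail; subtracting their two relations
        removes the tail.\<close>
      have "geodesic g @ geodesic h @ ?v \<in> I" "geodesic ?k @ ?v \<in> I"
        unfolding I_def using geo v g h
        by (simp_all add: wprod_append wprod_winv m_assoc[symmetric] del: foldr_append)
      from b[OF this(1)] b[OF this(2)] show ?thesis
        by (simp add: \<phi>_def cnt_def distrib_left sum.distrib)
    qed
    have "((\<lambda>g. pmf \<mu> g * \<phi> g) has_sum 0) (carrier G)"
      by (rule abelian_centered_has_sum[OF centered]) (simp add: rel)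
    then show "(\<Sum>s\<in>S. b s * m s) = 0"
      using lin[of b] has_sum_unique unfolding \<phi>_def by blast
  qed
  then obtain F c where F: "finite F" "F \<subseteq> I" and mF: "\<And>s. s \<in> S \<Longrightarrow> m s = (\<Sum>w\<in>F. c w * real (count_list w s))"
    by blast
  define C where "C = (\<Sum>w\<in>F. \<bar>c w\<bar> * (real (length w))\<^sup>2) + moment"
  have "0 \<le> moment" unfolding moment_def by (intro infsum_nonneg) simp
  then have "0 \<le> C" by (simp add: C_def sum_nonneg)
  moreover have "(\<lambda>g. pmf \<mu> g * \<gamma> g) summable_on carrier G \<and> \<bar>\<Sum>\<^sub>\<infinity>g\<in>carrier G. pmf \<mu> g * \<gamma> g\<bar> \<le> C * M"
    if M: "0 \<le> M" and q: "quasi_hom \<gamma> M"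
    for \<gamma> M
  proof -
    have word: "\<bar>\<gamma> (wprod w) - (\<Sum>s\<in>S. \<gamma> s * real (count_list w s))\<bar> \<le> M * (real (length w))\<^sup>2" if "set w \<subseteq> S" for w
      using quasi_hom_word[OF M _ that, of \<gamma>] q sum_list_eq_sum_count[OF finite_S that, of \<gamma>] by simp
    \<comment> \<open>The letter sum along a geodesic replaces \<gamma>. The error is quadratic in
      the length, hence bounded by \<open>moment\<close>, and the mean of the letter sum depends on
      the mean counts m only.\<close>
    define e where "e g = \<gamma> g - (\<Sum>s\<in>S. \<gamma> s * cnt g s)" for g
    have e: "\<bar>e g\<bar> \<le> M * ((1 + real (len g))\<^sup>2 * exp (\<delta>\<^sub>0 * real (len g)))" if "g \<in> carrier G" for g
    proof -
      have "\<bar>e g\<bar> \<le> M * (real (len g))\<^sup>2"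
        using word[OF geodesic(1)[OF that]] geodesic[OF that] by (simp add: e_def cnt_def)
      also have "\<dots> \<le> M * ((1 + real (len g))\<^sup>2 * exp (\<delta>\<^sub>0 * real (len g)))"
        by (intro mult_left_mono moment_weight_ge M)
      finally show ?thesis .
    qed
    have he: "((\<lambda>g. pmf \<mu> g * e g) has_sum (\<Sum>\<^sub>\<infinity>g\<in>carrier G. pmf \<mu> g * e g)) (carrier G)"
      by (intro has_sum_infsum moment_dominates(1)[OF e])
    have total: "((\<lambda>g. pmf \<mu> g * \<gamma> g) has_sum
        ((\<Sum>\<^sub>\<infinity>g\<in>carrier G. pmf \<mu> g * e g) + (\<Sum>s\<in>S. \<gamma> s * m s))) (carrier G)"
      using has_sum_add[OF he lin[of \<gamma>]] by (simp add: e_def distrib_left[symmetric])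
    \<comment> \<open>On a relator the letter sum of \<gamma> differs from \<gamma>(1) = 0 by at
      most M times the squared length, and the relators in F do not depend on \<gamma>.\<close>
    have "(\<Sum>s\<in>S. \<gamma> s * m s) = (\<Sum>w\<in>F. c w * (\<Sum>s\<in>S. \<gamma> s * real (count_list w s)))"
      by (simp add: mF sum_distrib_left sum.swap[of _ F] mult_ac)
    moreover have "\<bar>c w * (\<Sum>s\<in>S. \<gamma> s * real (count_list w s))\<bar> \<le> \<bar>c w\<bar> * (real (length w))\<^sup>2 * M" if "w \<in> F" for w
    proof -
      have w: "set w \<subseteq> S" "wprod w = \<one>" using that F(2) by (auto simp: I_def)
      have "\<gamma> \<one> = 0" using q[rule_format, of \<one> \<one>] by simp
      then have "\<bar>\<Sum>s\<in>S. \<gamma> s * real (count_list w s)\<bar> \<le> M * (real (length w))\<^sup>2"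
        using word[OF w(1)] w(2) by simp
      from mult_left_mono[OF this abs_ge_zero[of "c w"]] show ?thesis by (simp add: abs_mult mult_ac)
    qed
    ultimately have "\<bar>\<Sum>s\<in>S. \<gamma> s * m s\<bar> \<le> (\<Sum>w\<in>F. \<bar>c w\<bar> * (real (length w))\<^sup>2) * M"
      unfolding sum_distrib_right by (metis (no_types, lifting) order_trans sum_abs sum_mono)
    moreover have "\<bar>\<Sum>\<^sub>\<infinity>g\<in>carrier G. pmf \<mu> g * e g\<bar> \<le> M * moment"
      by (rule moment_dominates(2)[OF e])
    ultimately show ?thesis
      using total infsumI[OF total] has_sum_imp_summable[OF total]
      by (simp add: C_def distrib_right mult.commute[of M])
  qed
  ultimately show ?thesis by blast
qed

end

section \<open>Coercivity\<close>

lemma has_sum_minus: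
  fixes f g :: "'a \<Rightarrow> real"
  assumes "(f has_sum a) A" "(g has_sum b) A"
  shows "((\<lambda>x. f x - g x) has_sum (a - b)) A"
  using has_sum_add[OF assms(1), of "\<lambda>x. - g x" "- b"] assms(2) by (simp add: has_sum_uminus)

lemma summable_on_minus:
  fixes f g :: "'a \<Rightarrow> real"
  shows "f summable_on A \<Longrightarrow> g summable_on A \<Longrightarrow> (\<lambda>x. f x - g x) summable_on A"
  using has_sum_minus unfolding summable_on_def by blast

lemma infsum_minus:
  fixes f g :: "'a \<Rightarrow> real"
  shows "f summable_on A \<Longrightarrow> g summable_on A \<Longrightarrow> (\<Sum>\<^sub>\<infinity>x\<in>A. f x - g x) = infsum f A - infsum g A"
  by (intro infsumI has_sum_minus has_sum_infsum)

lemma summable_on_bounded_mult: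
  fixes f b :: "'a \<Rightarrow> real"
  assumes "f summable_on A" "\<And>x. x \<in> A \<Longrightarrow> \<bar>b x\<bar> \<le> B"
  shows "(\<lambda>x. b x * f x) summable_on A"
proof (rule summable_on_abs_boundI)
  show "(\<lambda>x. B * \<bar>f x\<bar>) summable_on A"
    using summable_on_iff_abs_summable_on_real[THEN iffD1, OF assms(1)] by (intro summable_on_cmult_right) simp
  show "\<bar>b x * f x\<bar> \<le> B * \<bar>f x\<bar>" if "x \<in> A" for x
    using assms(2)[OF that] by (simp add: abs_mult mult_right_mono)
qed

lemma infsum_bounded_mult_le:
  fixes f b :: "'a \<Rightarrow> real"
  assumes "f summable_on A" "\<And>x. x \<in> A \<Longrightarrow> \<bar>b x\<bar> \<le> B"
  shows "\<bar>\<Sum>\<^sub>\<infinity>x\<in>A. b x * f x\<bar> \<le> B * (\<Sum>\<^sub>\<infinity>x\<in>A. \<bar>f x\<bar>)"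
proof -
  have s: "(\<lambda>x. b x * f x) summable_on A" by (rule summable_on_bounded_mult[OF assms])
  have f: "(\<lambda>x. \<bar>f x\<bar>) summable_on A"
    using summable_on_iff_abs_summable_on_real[THEN iffD1, OF assms(1)] by simp
  have "\<bar>\<Sum>\<^sub>\<infinity>x\<in>A. b x * f x\<bar> \<le> (\<Sum>\<^sub>\<infinity>x\<in>A. \<bar>b x * f x\<bar>)" by (rule abs_infsum_le[OF s])
  also have "\<dots> \<le> (\<Sum>\<^sub>\<infinity>x\<in>A. B * \<bar>f x\<bar>)"
    using summable_on_iff_abs_summable_on_real[THEN iffD1, OF s] assms(2)
    by (intro infsum_mono summable_on_cmult_right f) (auto simp: abs_mult intro: mult_right_mono)
  finally show ?thesis by (simp add: infsum_cmult_right')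
qed

lemma abs_exp_minus_one_le: "\<bar>exp t - 1\<bar> \<le> \<bar>t\<bar> * exp \<bar>t::real\<bar>"
proof (cases "0 \<le> t")
  case True
  have "exp t * (1 - t) \<le> exp t * exp (- t)" using exp_ge_add_one_self[of "- t"] by (intro mult_left_mono) auto
  then show ?thesis using True by (simp add: algebra_simps flip: exp_add)
next
  case False
  have "1 - exp t \<le> \<bar>t\<bar> * 1" using exp_ge_add_one_self[of t] False by linarith
  also have "\<dots> \<le> \<bar>t\<bar> * exp \<bar>t\<bar>" by (intro mult_left_mono) auto
  finally show ?thesis using False by simp
qed

lemma exp_le_quadratic: "exp (t::real) \<le> 1 + t + t\<^sup>2 * exp \<bar>t\<bar>"
proof -
  obtain u where u: "\<bar>u\<bar> \<le> \<bar>t\<bar>" and e: "exp t = (\<Sum>m<2. t ^ m / fact m) + exp u / fact 2 * t ^ 2"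
    using Maclaurin_exp_le[of t 2] by auto
  have "exp u \<le> exp \<bar>t\<bar>" "0 \<le> exp u" using u by simp_all
  then have "exp u / 2 \<le> exp \<bar>t\<bar>" by linarith
  then have "exp u / 2 * t\<^sup>2 \<le> exp \<bar>t\<bar> * t\<^sup>2"
    using exp_ge_zero[of "\<bar>t\<bar>"] by (intro mult_right_mono) auto
  then show ?thesis using e by (simp add: numeral_2_eq_2 mult.commute)
qed

context sym_gen_group
begin

lemma displacement_sq_le:
  assumes v: "square_summable v" and g: "g \<in> carrier G"
  shows "(displacement v g)\<^sup>2 \<le> 4 * (l2 v)\<^sup>2"
proof -
  have "- (l2 v * l2 v) \<le> (\<Sum>\<^sub>\<infinity>x\<in>carrier G. v x * v (inv g \<otimes> x))"
    using l2_inner_le[OF v square_summable_translate[OF g v]] l2_translate[OF g, of v] by simp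
  then show ?thesis using displacement_sq[OF v g] by (simp add: power2_eq_square)
qed

section \<open>Exponentially tilted inner products\<close>

abbreviation left_lipschitz :: "('a \<Rightarrow> real) \<Rightarrow> real \<Rightarrow> bool" where
  "left_lipschitz \<psi> \<delta> \<equiv> (\<forall>g\<in>carrier G. \<forall>x\<in>carrier G. \<bar>\<psi> x - \<psi> (inv g \<otimes> x)\<bar> \<le> \<delta> * real (len g))"

text \<open>The first-order part of \<open>tilted_inner\<close> in the weight: the increment of
  \<psi> under translation by g, averaged against the density v^2.\<close>

definition tilt :: "('a \<Rightarrow> real) \<Rightarrow> ('a \<Rightarrow> real) \<Rightarrow> 'a \<Rightarrow> real" where
  "tilt \<psi> v g = (\<Sum>\<^sub>\<infinity>x\<in>carrier G. (\<psi> x - \<psi> (inv g \<otimes> x)) * (v x)\<^sup>2)"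

text \<open>For v = exp(\<psi>) h the summand is exp(2 \<psi>(x)) h(x) h(inv g x), so this is the
  correlation of h with its translate in the weighted l2 space.\<close>

definition tilted_inner :: "('a \<Rightarrow> real) \<Rightarrow> ('a \<Rightarrow> real) \<Rightarrow> 'a \<Rightarrow> real" where
  "tilted_inner \<psi> v g = (\<Sum>\<^sub>\<infinity>x\<in>carrier G. exp (\<psi> x - \<psi> (inv g \<otimes> x)) * (v x * v (inv g \<otimes> x)))"

context
  fixes \<psi> v :: "'a \<Rightarrow> real" and \<delta> :: real
  assumes v: "square_summable v" and \<delta>: "0 \<le> \<delta>"
    and lip: "\<And>g x. g \<in> carrier G \<Longrightarrow> x \<in> carrier G \<Longrightarrow> \<bar>\<psi> x - \<psi> (inv g \<otimes> x)\<bar> \<le> \<delta> * real (len g)"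
begin

text \<open>The increments of \<psi> satisfy a cocycle identity, so the defect comes only from
  moving v^2 by g. Factoring v(gy)^2 - v(y)^2 into difference and sum bounds its l1 norm by |g|
  times the root of the energy times twice the norm of v.\<close>

lemma tilt_quasi_hom:
  assumes g: "g \<in> carrier G" and h: "h \<in> carrier G"
  shows "\<bar>tilt \<psi> v (g \<otimes> h) - tilt \<psi> v g - tilt \<psi> v h\<bar> \<le> (2 * \<delta> * sqrt (energy v) * l2 v) * real (len g) * real (len h)"
proof -
  let ?k = "inv g"
  define d where "d y = (v (g \<otimes> y))\<^sup>2 - (v y)\<^sup>2" for y
  have gk: "inv ?k = g" "?k \<in> carrier G" using g by auto
  have vg: "square_summable (\<lambda>y. v (g \<otimes> y))" using square_summable_translate[OF gk(2) v] by (simp add: gk)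
  have sh: "(\<lambda>y. (\<psi> y - \<psi> (inv h \<otimes> y)) * (v y)\<^sup>2) summable_on carrier G"
    by (rule summable_on_bounded_mult[OF v lip[OF h]])
  have sg: "(\<lambda>y. (\<psi> y - \<psi> (inv g \<otimes> y)) * (v y)\<^sup>2) summable_on carrier G"
    by (rule summable_on_bounded_mult[OF v lip[OF g]])
  have shg: "(\<lambda>y. (\<psi> y - \<psi> (inv h \<otimes> y)) * (v (g \<otimes> y))\<^sup>2) summable_on carrier G"
    by (rule summable_on_bounded_mult[OF vg lip[OF h]])
  have sg': "(\<lambda>x. (\<psi> (inv g \<otimes> x) - \<psi> (inv h \<otimes> (inv g \<otimes> x))) * (v x)\<^sup>2) summable_on carrier G"
    by (rule summable_on_bounded_mult[OF v lip[OF h]]) (use g in simp)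
  have "tilt \<psi> v (g \<otimes> h) = (\<Sum>\<^sub>\<infinity>x\<in>carrier G. (\<psi> x - \<psi> (inv g \<otimes> x)) * (v x)\<^sup>2 +
      (\<psi> (inv g \<otimes> x) - \<psi> (inv h \<otimes> (inv g \<otimes> x))) * (v x)\<^sup>2)"
    unfolding tilt_def using g h by (intro infsum_cong) (simp add: inv_mult_group m_assoc algebra_simps)
  also have "\<dots> = tilt \<psi> v g + (\<Sum>\<^sub>\<infinity>x\<in>carrier G. (\<psi> (inv g \<otimes> x) - \<psi> (inv h \<otimes> (inv g \<otimes> x))) * (v x)\<^sup>2)"
    unfolding tilt_def by (rule infsum_add[OF sg sg'])
  also have "(\<Sum>\<^sub>\<infinity>x\<in>carrier G. (\<psi> (inv g \<otimes> x) - \<psi> (inv h \<otimes> (inv g \<otimes> x))) * (v x)\<^sup>2) =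
      (\<Sum>\<^sub>\<infinity>y\<in>carrier G. (\<psi> y - \<psi> (inv h \<otimes> y)) * (v (g \<otimes> y))\<^sup>2)"
    using g by (subst infsum_translate[OF g, symmetric]) (intro infsum_cong, simp add: m_assoc[symmetric])
  finally have eq1: "tilt \<psi> v (g \<otimes> h) = tilt \<psi> v g + (\<Sum>\<^sub>\<infinity>y\<in>carrier G. (\<psi> y - \<psi> (inv h \<otimes> y)) * (v (g \<otimes> y))\<^sup>2)" .
  have "(\<Sum>\<^sub>\<infinity>y\<in>carrier G. (\<psi> y - \<psi> (inv h \<otimes> y)) * (v (g \<otimes> y))\<^sup>2) - tilt \<psi> v h = (\<Sum>\<^sub>\<infinity>y\<in>carrier G. (\<psi> y - \<psi> (inv h \<otimes> y)) * d y)"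
    unfolding tilt_def d_def right_diff_distrib[of _ "_\<^sup>2"] by (rule infsum_minus[OF shg sh, symmetric])
  with eq1 have eq: "tilt \<psi> v (g \<otimes> h) - tilt \<psi> v g - tilt \<psi> v h = (\<Sum>\<^sub>\<infinity>y\<in>carrier G. (\<psi> y - \<psi> (inv h \<otimes> y)) * d y)"
    by simp
  have sd: "d summable_on carrier G" unfolding d_def by (rule summable_on_minus[OF vg v])
  have "(\<Sum>\<^sub>\<infinity>y\<in>carrier G. \<bar>d y\<bar>) = (\<Sum>\<^sub>\<infinity>y\<in>carrier G. \<bar>(v y - v (g \<otimes> y)) * (v y + v (g \<otimes> y))\<bar>)"
    unfolding d_def by (intro infsum_cong) (simp add: algebra_simps power2_eq_square)
  also have "\<dots> \<le> displacement v ?k * l2 (\<lambda>y. v y + v (g \<otimes> y))"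
    unfolding displacement_def gk
    using l2_cauchy_schwarz[OF square_summable_diff[OF v gk(2)] l2_add_summable[OF v square_summable_translate[OF gk(2) v]]]
    by (simp add: gk)
  also have "\<dots> \<le> (real (len g) * sqrt (energy v)) * (2 * l2 v)"
  proof (intro mult_mono)
    show "displacement v ?k \<le> real (len g) * sqrt (energy v)" using displacement_le[OF v gk(2)] g by simp
    show "l2 (\<lambda>y. v y + v (g \<otimes> y)) \<le> 2 * l2 v"
      using l2_triangle[OF v vg] l2_translate[OF gk(2), of v] by (simp add: gk)
  qed auto
  finally have d: "(\<Sum>\<^sub>\<infinity>y\<in>carrier G. \<bar>d y\<bar>) \<le> (real (len g) * sqrt (energy v)) * (2 * l2 v)" .
  have "\<bar>\<Sum>\<^sub>\<infinity>y\<in>carrier G. (\<psi> y - \<psi> (inv h \<otimes> y)) * d y\<bar> \<le> (\<delta> * real (len h)) * (\<Sum>\<^sub>\<infinity>y\<in>carrier G. \<bar>d y\<bar>)"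
    by (rule infsum_bounded_mult_le[OF sd lip[OF h]])
  also have "\<dots> \<le> (\<delta> * real (len h)) * ((real (len g) * sqrt (energy v)) * (2 * l2 v))"
    using \<delta> by (intro mult_left_mono d) auto
  finally show ?thesis unfolding eq by (simp add: mult_ac)
qed

text \<open>Taylor expansion of the exponential under the sum, legitimate as an inequality because v
  is nonnegative. With Tv the translate, the linear term \<theta> v Tv is split as \<theta> v^2 -
  \<theta> v (v - Tv): the first part is \<open>tilt\<close>, the second carries a factor root of
  the energy. The crude second bound serves for summability in g.\<close>

lemma tilted_inner_le:
  assumes g: "g \<in> carrier G" and nonneg: "\<And>x. x \<in> carrier G \<Longrightarrow> 0 \<le> v x"
  shows "tilted_inner \<psi> v g \<le> (l2 v)\<^sup>2 - (displacement v g)\<^sup>2 / 2 + tilt \<psi> v g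
      + \<delta> * l2 v * sqrt (energy v) * (real (len g))\<^sup>2
      + \<delta>\<^sup>2 * (l2 v)\<^sup>2 * ((real (len g))\<^sup>2 * exp (\<delta> * real (len g)))"
    and "\<bar>tilted_inner \<psi> v g\<bar> \<le> (l2 v)\<^sup>2 * exp (\<delta> * real (len g))"
proof -
  let ?T = "\<lambda>x. v (inv g \<otimes> x)" and ?\<theta> = "\<lambda>x. \<psi> x - \<psi> (inv g \<otimes> x)" and ?n = "real (len g)"
  note gv = square_summable_translate[OF g v]
  have vT: "(\<lambda>x. v x * ?T x) summable_on carrier G" by (rule l2_mult_summable[OF v gv])
  have vTnn: "0 \<le> v x * ?T x" if "x \<in> carrier G" for x using nonneg that g by simp
  have ip: "(\<Sum>\<^sub>\<infinity>x\<in>carrier G. v x * ?T x) = (l2 v)\<^sup>2 - (displacement v g)\<^sup>2 / 2"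
    using displacement_sq[OF v g] by linarith
  have ipa: "(\<Sum>\<^sub>\<infinity>x\<in>carrier G. \<bar>v x * ?T x\<bar>) \<le> (l2 v)\<^sup>2"
    using l2_cauchy_schwarz[OF v gv] l2_translate[OF g, of v] by (simp add: power2_eq_square)
  have ebd: "\<bar>exp (?\<theta> x)\<bar> \<le> exp (\<delta> * ?n)" if "x \<in> carrier G" for x
    using lip[OF g that] by simp
  show "\<bar>tilted_inner \<psi> v g\<bar> \<le> (l2 v)\<^sup>2 * exp (\<delta> * ?n)"
    unfolding tilted_inner_def
    using order_trans[OF infsum_bounded_mult_le[OF vT, of "\<lambda>x. exp (?\<theta> x)", OF ebd] mult_left_mono[OF ipa, of "exp (\<delta> * ?n)"]]
    by (simp add: mult.commute)
  note dv = square_summable_diff[OF v g]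
  have vd: "(\<lambda>x. v x * (v x - ?T x)) summable_on carrier G" by (rule l2_mult_summable[OF v dv])
  have s1: "(\<lambda>x. ?\<theta> x * (v x)\<^sup>2) summable_on carrier G" by (rule summable_on_bounded_mult[OF v lip[OF g]])
  have s2: "(\<lambda>x. ?\<theta> x * (v x * (v x - ?T x))) summable_on carrier G" by (rule summable_on_bounded_mult[OF vd lip[OF g]])
  have s3: "(\<lambda>x. (\<delta> * ?n)\<^sup>2 * exp (\<delta> * ?n) * (v x * ?T x)) summable_on carrier G"
    by (rule summable_on_cmult_right[OF vT])
  have main: "tilted_inner \<psi> v g \<le> (\<Sum>\<^sub>\<infinity>x\<in>carrier G. (v x * ?T x + (?\<theta> x * (v x)\<^sup>2 - ?\<theta> x * (v x * (v x - ?T x))))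
      + (\<delta> * ?n)\<^sup>2 * exp (\<delta> * ?n) * (v x * ?T x))"
    unfolding tilted_inner_def
  proof (intro infsum_mono summable_on_add summable_on_minus vT s1 s2 s3 summable_on_bounded_mult[OF vT ebd])
    fix x assume x: "x \<in> carrier G"
    have "(?\<theta> x)\<^sup>2 * exp \<bar>?\<theta> x\<bar> \<le> (\<delta> * ?n)\<^sup>2 * exp (\<delta> * ?n)"
      using lip[OF g x] \<delta> by (intro mult_mono) (auto intro: abs_le_square_iff[THEN iffD1])
    then have "exp (?\<theta> x) \<le> 1 + ?\<theta> x + (\<delta> * ?n)\<^sup>2 * exp (\<delta> * ?n)"
      using exp_le_quadratic[of "?\<theta> x"] by linarith
    from mult_right_mono[OF this vTnn[OF x]]
    show "exp (?\<theta> x) * (v x * ?T x) \<le> (v x * ?T x + (?\<theta> x * (v x)\<^sup>2 - ?\<theta> x * (v x * (v x - ?T x))))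
      + (\<delta> * ?n)\<^sup>2 * exp (\<delta> * ?n) * (v x * ?T x)"
      by (simp add: algebra_simps power2_eq_square)
  qed
  have split: "(\<Sum>\<^sub>\<infinity>x\<in>carrier G. (v x * ?T x + (?\<theta> x * (v x)\<^sup>2 - ?\<theta> x * (v x * (v x - ?T x))))
      + (\<delta> * ?n)\<^sup>2 * exp (\<delta> * ?n) * (v x * ?T x)) = ((\<Sum>\<^sub>\<infinity>x\<in>carrier G. v x * ?T x) + (tilt \<psi> v g - (\<Sum>\<^sub>\<infinity>x\<in>carrier G. ?\<theta> x * (v x * (v x - ?T x)))))
      + (\<delta> * ?n)\<^sup>2 * exp (\<delta> * ?n) * (\<Sum>\<^sub>\<infinity>x\<in>carrier G. v x * ?T x)"
    unfolding tilt_def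
    by (subst infsum_add, (intro summable_on_add summable_on_minus vT s1 s2 s3)+,
        subst infsum_add, (intro summable_on_minus vT s1 s2)+, subst infsum_minus, (intro s1 s2)+,
        simp add: infsum_cmult_right')
  have b1: "- (\<Sum>\<^sub>\<infinity>x\<in>carrier G. ?\<theta> x * (v x * (v x - ?T x))) \<le> \<delta> * l2 v * sqrt (energy v) * ?n\<^sup>2"
  proof -
    have "(\<Sum>\<^sub>\<infinity>x\<in>carrier G. \<bar>v x * (v x - ?T x)\<bar>) \<le> l2 v * (?n * sqrt (energy v))"
      using l2_cauchy_schwarz[OF v dv] mult_left_mono[OF displacement_le[OF v g], of "l2 v"]
      unfolding displacement_def by simp
    then have "\<delta> * ?n * (\<Sum>\<^sub>\<infinity>x\<in>carrier G. \<bar>v x * (v x - ?T x)\<bar>) \<le> \<delta> * ?n * (l2 v * (?n * sqrt (energy v)))"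
      using \<delta> by (intro mult_left_mono) auto
    also have "\<dots> = \<delta> * l2 v * sqrt (energy v) * ?n\<^sup>2" by (simp add: power2_eq_square mult_ac)
    finally show ?thesis using infsum_bounded_mult_le[OF vd, of ?\<theta>, OF lip[OF g]] by linarith
  qed
  have b2: "(\<delta> * ?n)\<^sup>2 * exp (\<delta> * ?n) * (\<Sum>\<^sub>\<infinity>x\<in>carrier G. v x * ?T x) \<le> \<delta>\<^sup>2 * (l2 v)\<^sup>2 * (?n\<^sup>2 * exp (\<delta> * ?n))"
  proof -
    have "(\<Sum>\<^sub>\<infinity>x\<in>carrier G. v x * ?T x) \<le> (l2 v)\<^sup>2" using ip by simp
    then have "(\<delta> * ?n)\<^sup>2 * exp (\<delta> * ?n) * (\<Sum>\<^sub>\<infinity>x\<in>carrier G. v x * ?T x) \<le> (\<delta> * ?n)\<^sup>2 * exp (\<delta> * ?n) * (l2 v)\<^sup>2"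
      by (intro mult_left_mono) auto
    then show ?thesis by (simp add: power_mult_distrib mult_ac)
  qed
  show "tilted_inner \<psi> v g \<le> (l2 v)\<^sup>2 - (displacement v g)\<^sup>2 / 2 + tilt \<psi> v g
      + \<delta> * l2 v * sqrt (energy v) * ?n\<^sup>2 + \<delta>\<^sup>2 * (l2 v)\<^sup>2 * (?n\<^sup>2 * exp (\<delta> * ?n))"
    using main b1 b2 unfolding split ip by linarith
qed

end

end

context centered_walk
begin

section \<open>Comparison of the energies, and the coercivity estimate\<close>

definition \<mu>_energy :: "('a \<Rightarrow> real) \<Rightarrow> real" where
  "\<mu>_energy v = (\<Sum>\<^sub>\<infinity>g\<in>carrier G. pmf \<mu> g * (displacement v g)\<^sup>2)"

lemma \<mu>_energy_summable:
  assumes "square_summable v"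
  shows "(\<lambda>g. pmf \<mu> g * (displacement v g)\<^sup>2) summable_on carrier G"
proof (rule moment_dominates(1))
  fix g assume "g \<in> carrier G"
  then show "\<bar>(displacement v g)\<^sup>2\<bar> \<le> (4 * (l2 v)\<^sup>2) * ((1 + real (len g))\<^sup>2 * exp (\<delta>\<^sub>0 * real (len g)))"
    using displacement_sq_le[OF assms] mult_left_mono[OF moment_weight_ge(1)[of "len g"], of "4 * (l2 v)\<^sup>2"]
    by (fastforce intro: order_trans)
qed

text \<open>An atom of \<mu> is controlled by its own term of the sum, and displacement is
  subadditive on products. The constant depends on x but not on v.\<close>

lemma displacement_le_\<mu>_energy:
  assumes "x \<in> generated_semigroup G (set_pmf \<mu>)"
  shows "\<exists>C\<ge>0. \<forall>v. square_summable v \<longrightarrow> displacement v x \<le> C * sqrt (\<mu>_energy v)"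
  using assms
proof (induction rule: generated_semigroup.induct)
  case (incl g)
  then have g: "g \<in> carrier G" "0 < pmf \<mu> g" using supp by (auto simp: set_pmf_eq pmf_pos)
  have "displacement v g \<le> (1 / sqrt (pmf \<mu> g)) * sqrt (\<mu>_energy v)" if v: "square_summable v" for v
  proof -
    have "pmf \<mu> g * (displacement v g)\<^sup>2 \<le> \<mu>_energy v"
      unfolding \<mu>_energy_def
      using finite_sum_le_infsum[OF \<mu>_energy_summable[OF v], of "{g}"] g by simp
    then have "sqrt (pmf \<mu> g * (displacement v g)\<^sup>2) \<le> sqrt (\<mu>_energy v)" by (rule real_sqrt_le_mono)
    then show ?thesis using g by (simp add: real_sqrt_mult field_simps)
  qed
  then show ?case by (intro exI[of _ "1 / sqrt (pmf \<mu> g)"]) simp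
next
  case (mult x y)
  then obtain C1 C2 where C: "0 \<le> C1" "0 \<le> C2"
    "\<And>v. square_summable v \<Longrightarrow> displacement v x \<le> C1 * sqrt (\<mu>_energy v)"
    "\<And>v. square_summable v \<Longrightarrow> displacement v y \<le> C2 * sqrt (\<mu>_energy v)" by blast
  have xy: "x \<in> carrier G" "y \<in> carrier G" using mult adapted by (auto simp: adapted_def)
  have "displacement v (x \<otimes> y) \<le> (C1 + C2) * sqrt (\<mu>_energy v)" if v: "square_summable v" for v
    using displacement_mult[OF v xy] C(3)[OF v] C(4)[OF v] by (simp add: distrib_right)
  then show ?case using C by (intro exI[of _ "C1 + C2"]) simp
qed

lemma spectral_comparison:
  "\<exists>\<kappa>>0. \<forall>v. square_summable v \<longrightarrow> \<kappa> * energy v \<le> \<mu>_energy v"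
proof -
  have "\<forall>s\<in>S. \<exists>C\<ge>0. \<forall>v. square_summable v \<longrightarrow> displacement v s \<le> C * sqrt (\<mu>_energy v)"
    using displacement_le_\<mu>_energy adapted S_carrier by (auto simp: adapted_def)
  then obtain C where C: "\<And>s. s \<in> S \<Longrightarrow> 0 \<le> C s"
    "\<And>s v. s \<in> S \<Longrightarrow> square_summable v \<Longrightarrow> displacement v s \<le> C s * sqrt (\<mu>_energy v)"
    by metis
  define K where "K = 1 + (\<Sum>s\<in>S. (C s)\<^sup>2)"
  have K: "1 \<le> K" by (simp add: K_def sum_nonneg)
  have "(1 / K) * energy v \<le> \<mu>_energy v" if v: "square_summable v" for v
  proof -
    have nn: "0 \<le> \<mu>_energy v" unfolding \<mu>_energy_def by (intro infsum_nonneg) simp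
    have "energy v \<le> (\<Sum>s\<in>S. (C s)\<^sup>2 * \<mu>_energy v)"
      unfolding energy_def
    proof (rule sum_mono)
      fix s assume "s \<in> S"
      then have "(displacement v s)\<^sup>2 \<le> (C s * sqrt (\<mu>_energy v))\<^sup>2"
        by (intro power_mono C v) auto
      then show "(displacement v s)\<^sup>2 \<le> (C s)\<^sup>2 * \<mu>_energy v" using nn by (simp add: power_mult_distrib)
    qed
    also have "\<dots> \<le> K * \<mu>_energy v" using nn by (simp add: K_def sum_distrib_right distrib_right)
    finally show ?thesis using K by (simp add: field_simps)
  qed
  then show ?thesis using K by (intro exI[of _ "1 / K"]) simp
qed

text \<open>Two terms are of first order in \<delta>, the drift and the cross term of the Taylor
  expansion. Both carry a factor root of the energy, so they can be traded for part of the energy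
  and a multiple of \<delta>^2. For the drift this rests on centering, through
  \<open>tilt_quasi_hom\<close> and \<open>centered_quasi_hom\<close>; an uncentered drift would
  leave a term of order \<delta> times the squared norm of v.\<close>

lemma coercivity:
  "\<exists>\<kappa> C. 0 < \<kappa> \<and> 0 < C \<and> (\<forall>\<psi> v \<delta>. square_summable v \<longrightarrow> 0 \<le> \<delta> \<longrightarrow> \<delta> \<le> \<delta>\<^sub>0 \<longrightarrow>
     (\<forall>x\<in>carrier G. 0 \<le> v x) \<longrightarrow>
     left_lipschitz \<psi> \<delta> \<longrightarrow>
     (\<Sum>\<^sub>\<infinity>g\<in>carrier G. pmf \<mu> g * tilted_inner \<psi> v g) \<le> (1 + C * \<delta>\<^sup>2) * (l2 v)\<^sup>2 - \<kappa> * energy v)"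
proof -
  obtain \<kappa> where \<kappa>: "0 < \<kappa>" "\<And>v. square_summable v \<Longrightarrow> \<kappa> * energy v \<le> \<mu>_energy v"
    using spectral_comparison by blast
  obtain C1 where C1: "0 \<le> C1" and quasi: "\<forall>\<gamma> M. 0 \<le> M \<longrightarrow>
     quasi_hom \<gamma> M \<longrightarrow>
     (\<lambda>g. pmf \<mu> g * \<gamma> g) summable_on carrier G \<and> \<bar>\<Sum>\<^sub>\<infinity>g\<in>carrier G. pmf \<mu> g * \<gamma> g\<bar> \<le> C1 * M"
    using centered_quasi_hom by (elim exE conjE)
  define Q where "Q = moment"
  have Q: "0 \<le> Q" unfolding Q_def moment_def by (intro infsum_nonneg) simp
  \<comment> \<open>Total coefficient of the first-order terms: 2 C1 from the drift, Q from the
    cross term.\<close>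
  define B where "B = 2 * C1 + Q"
  define C where "C = B\<^sup>2 / \<kappa> + Q + 1"
  have Cpos: "0 < C" using \<kappa>(1) Q by (simp add: C_def add_nonneg_pos)
  have main: "(\<Sum>\<^sub>\<infinity>g\<in>carrier G. pmf \<mu> g * tilted_inner \<psi> v g) \<le> (1 + C * \<delta>\<^sup>2) * (l2 v)\<^sup>2 - (\<kappa> / 4) * energy v"
    if v: "square_summable v" and \<delta>: "0 \<le> \<delta>" "\<delta> \<le> \<delta>\<^sub>0" and nonneg: "\<And>x. x \<in> carrier G \<Longrightarrow> 0 \<le> v x"
      and lip: "\<And>g x. g \<in> carrier G \<Longrightarrow> x \<in> carrier G \<Longrightarrow> \<bar>\<psi> x - \<psi> (inv g \<otimes> x)\<bar> \<le> \<delta> * real (len g)"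
    for \<psi> v \<delta>
  proof -
    let ?E = "sqrt (energy v)" and ?N = "l2 v"
    let ?n = "\<lambda>g. real (len g)"
    have ti1: "tilted_inner \<psi> v g \<le> ?N\<^sup>2 - (displacement v g)\<^sup>2 / 2 + tilt \<psi> v g
        + \<delta> * ?N * ?E * (?n g)\<^sup>2 + \<delta>\<^sup>2 * ?N\<^sup>2 * ((?n g)\<^sup>2 * exp (\<delta> * ?n g))"
      if "g \<in> carrier G" for g
      by (rule tilted_inner_le(1)[where \<psi> = \<psi>, OF v \<delta>(1) _ that nonneg]) (rule lip)
    have ti2: "\<bar>tilted_inner \<psi> v g\<bar> \<le> ?N\<^sup>2 * exp (\<delta> * ?n g)" if "g \<in> carrier G" for g
      by (rule tilted_inner_le(2)[where \<psi> = \<psi>, OF v \<delta>(1) _ that nonneg]) (rule lip)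
    have expn: "exp (\<delta> * ?n g) \<le> exp (\<delta>\<^sub>0 * ?n g)" for g using \<delta> by (simp add: mult_right_mono)
    have w1: "\<bar>tilted_inner \<psi> v g\<bar> \<le> ?N\<^sup>2 * ((1 + ?n g)\<^sup>2 * exp (\<delta>\<^sub>0 * ?n g))" if g: "g \<in> carrier G" for g
    proof -
      have "exp (\<delta> * ?n g) \<le> (1 + ?n g)\<^sup>2 * exp (\<delta>\<^sub>0 * ?n g)"
        using mult_mono[of 1 "(1 + ?n g)\<^sup>2", OF _ expn[of g]] by simp
      from order_trans[OF ti2[OF g] mult_left_mono[OF this zero_le_power2]] show ?thesis .
    qed
    have w2: "\<bar>(?n g)\<^sup>2\<bar> \<le> 1 * ((1 + ?n g)\<^sup>2 * exp (\<delta>\<^sub>0 * ?n g))" for g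
      using moment_weight_ge(3)[of "len g"] by simp
    have w3: "\<bar>(?n g)\<^sup>2 * exp (\<delta> * ?n g)\<bar> \<le> 1 * ((1 + ?n g)\<^sup>2 * exp (\<delta>\<^sub>0 * ?n g))" for g
      using mult_mono[of "(?n g)\<^sup>2" "(1 + ?n g)\<^sup>2", OF _ expn[of g]] by (simp add: power_mono)
    note S2 = moment_dominates[of "\<lambda>g. (?n g)\<^sup>2", OF w2]
    note S3 = moment_dominates[of "\<lambda>g. (?n g)\<^sup>2 * exp (\<delta> * ?n g)", OF w3]
    have q: "(\<lambda>g. pmf \<mu> g * tilt \<psi> v g) summable_on carrier G \<and>
        \<bar>\<Sum>\<^sub>\<infinity>g\<in>carrier G. pmf \<mu> g * tilt \<psi> v g\<bar> \<le> C1 * (2 * \<delta> * ?E * ?N)"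
      by (rule quasi[rule_format], simp add: \<delta>(1), rule tilt_quasi_hom[where \<psi> = \<psi>, OF v \<delta>(1)]) (auto intro: lip)
    have h1: "((\<lambda>g. pmf \<mu> g * ?N\<^sup>2) has_sum (1 * ?N\<^sup>2)) (carrier G)"
      by (rule has_sum_cmult_left[OF has_sum_pmf[OF supp]])
    have h2: "((\<lambda>g. pmf \<mu> g * (displacement v g)\<^sup>2 / 2) has_sum (\<mu>_energy v / 2)) (carrier G)"
      unfolding \<mu>_energy_def by (rule has_sum_divide_const[OF has_sum_infsum[OF \<mu>_energy_summable[OF v]]])
    note h3 = has_sum_infsum[OF conjunct1[OF q]]
    note h4 = has_sum_cmult_right[OF has_sum_infsum[OF S2(1)], of "\<delta> * ?N * ?E"]
    note h5 = has_sum_cmult_right[OF has_sum_infsum[OF S3(1)], of "\<delta>\<^sup>2 * ?N\<^sup>2"]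
    let ?b = "\<lambda>g. pmf \<mu> g * ?N\<^sup>2 - pmf \<mu> g * (displacement v g)\<^sup>2 / 2 + pmf \<mu> g * tilt \<psi> v g
        + (\<delta> * ?N * ?E) * (pmf \<mu> g * (?n g)\<^sup>2) + (\<delta>\<^sup>2 * ?N\<^sup>2) * (pmf \<mu> g * ((?n g)\<^sup>2 * exp (\<delta> * ?n g)))"
    let ?rhs = "1 * ?N\<^sup>2 - \<mu>_energy v / 2 + (\<Sum>\<^sub>\<infinity>g\<in>carrier G. pmf \<mu> g * tilt \<psi> v g)
        + (\<delta> * ?N * ?E) * (\<Sum>\<^sub>\<infinity>g\<in>carrier G. pmf \<mu> g * (?n g)\<^sup>2)
        + (\<delta>\<^sup>2 * ?N\<^sup>2) * (\<Sum>\<^sub>\<infinity>g\<in>carrier G. pmf \<mu> g * ((?n g)\<^sup>2 * exp (\<delta> * ?n g)))"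
    have hs: "(?b
      has_sum (?rhs)) (carrier G)"
      by (rule has_sum_add[OF has_sum_add[OF has_sum_add[OF has_sum_minus[OF h1 h2] h3] h4] h5])
    have "(\<Sum>\<^sub>\<infinity>g\<in>carrier G. pmf \<mu> g * tilted_inner \<psi> v g) \<le>
        ?rhs"
    proof (rule has_sum_mono[OF has_sum_infsum[OF moment_dominates(1)[OF w1]] hs])
      fix g assume g: "g \<in> carrier G"
      from mult_left_mono[OF ti1[OF g] pmf_nonneg[of \<mu> g]]
      show "pmf \<mu> g * tilted_inner \<psi> v g \<le> ?b g"
        by (simp add: distrib_left right_diff_distrib mult_ac)
    qed
    moreover have "(\<delta> * ?N * ?E) * (\<Sum>\<^sub>\<infinity>g\<in>carrier G. pmf \<mu> g * (?n g)\<^sup>2) \<le> (\<delta> * ?N * ?E) * Q"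
      using S2(2) \<delta> by (intro mult_left_mono) (auto simp: Q_def)
    moreover have "(\<delta>\<^sup>2 * ?N\<^sup>2) * (\<Sum>\<^sub>\<infinity>g\<in>carrier G. pmf \<mu> g * ((?n g)\<^sup>2 * exp (\<delta> * ?n g))) \<le> (\<delta>\<^sup>2 * ?N\<^sup>2) * Q"
      using S3(2) by (intro mult_left_mono) (auto simp: Q_def)
    moreover have "\<kappa> * energy v / 2 \<le> \<mu>_energy v / 2" using \<kappa>(2)[OF v] by simp
    moreover have "(\<Sum>\<^sub>\<infinity>g\<in>carrier G. pmf \<mu> g * tilt \<psi> v g) \<le> C1 * (2 * \<delta> * ?E * ?N)" using q by linarith
    ultimately have le: "(\<Sum>\<^sub>\<infinity>g\<in>carrier G. pmf \<mu> g * tilted_inner \<psi> v g) \<le>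
        ?N\<^sup>2 - \<kappa> * energy v / 2 + C1 * (2 * \<delta> * ?E * ?N) + (\<delta> * ?N * ?E) * Q + (\<delta>\<^sup>2 * ?N\<^sup>2) * Q"
      by linarith
    \<comment> \<open>Completing the square: half of the available energy \<kappa>/2 is spent here,
      the other half stays in the conclusion.\<close>
    have "B * \<delta> * ?N * ?E \<le> \<kappa> / 4 * energy v + (B * \<delta> * ?N)\<^sup>2 / \<kappa>"
    proof -
      have "0 \<le> (\<kappa> / 2 * ?E - B * \<delta> * ?N)\<^sup>2 / \<kappa>" using \<kappa>(1) by simp
      also have "\<dots> = \<kappa> / 4 * ?E\<^sup>2 - B * \<delta> * ?N * ?E + (B * \<delta> * ?N)\<^sup>2 / \<kappa>"
        using \<kappa>(1) by (simp add: power2_eq_square field_simps)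
      finally show ?thesis by simp
    qed
    moreover have "C1 * (2 * \<delta> * ?E * ?N) + (\<delta> * ?N * ?E) * Q = B * \<delta> * ?N * ?E"
      by (simp add: B_def algebra_simps)
    moreover have "(B * \<delta> * ?N)\<^sup>2 / \<kappa> + (\<delta>\<^sup>2 * ?N\<^sup>2) * Q = (C - 1) * \<delta>\<^sup>2 * ?N\<^sup>2"
      by (simp add: C_def power_mult_distrib algebra_simps)
    moreover have "(C - 1) * \<delta>\<^sup>2 * ?N\<^sup>2 \<le> C * \<delta>\<^sup>2 * ?N\<^sup>2" by (intro mult_right_mono) auto
    ultimately show ?thesis using le by (simp add: distrib_right)
  qed
  show ?thesis
    by (rule exI[of _ "\<kappa> / 4"], rule exI[of _ C], intro conjI allI impI main)
      (use \<kappa>(1) Cpos in auto)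
qed

end

section \<open>Resolvents of the random walk\<close>

context sym_gen_group
begin

section \<open>Convolution of laws and averaging over balls\<close>

definition conv :: "'a pmf \<Rightarrow> 'a pmf \<Rightarrow> 'a pmf" where
  "conv a b = bind_pmf a (\<lambda>g. map_pmf (\<lambda>x. g \<otimes> x) b)"

lemma set_conv: "set_pmf a \<subseteq> carrier G \<Longrightarrow> set_pmf b \<subseteq> carrier G \<Longrightarrow> set_pmf (conv a b) \<subseteq> carrier G"
  by (auto simp: conv_def subset_iff)

lemma conv_assoc:
  assumes "set_pmf a \<subseteq> carrier G" "set_pmf b \<subseteq> carrier G" "set_pmf c \<subseteq> carrier G"
  shows "conv (conv a b) c = conv a (conv b c)"
proof -
  have "conv (conv a b) c = bind_pmf a (\<lambda>g. bind_pmf b (\<lambda>h. map_pmf (\<lambda>x. g \<otimes> h \<otimes> x) c))"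
    by (simp add: conv_def bind_assoc_pmf bind_map_pmf)
  also have "\<dots> = bind_pmf a (\<lambda>g. bind_pmf b (\<lambda>h. map_pmf (\<lambda>x. g \<otimes> (h \<otimes> x)) c))"
    using assms by (intro bind_pmf_cong refl map_pmf_cong) (auto simp: m_assoc subset_iff)
  also have "\<dots> = conv a (conv b c)"
    by (simp add: conv_def map_bind_pmf pmf.map_comp o_def)
  finally show ?thesis .
qed

lemma conv_bind_left: "conv (bind_pmf N a) b = bind_pmf N (\<lambda>n. conv (a n) b)"
  by (simp add: conv_def bind_assoc_pmf)

lemma conv_bind_right: "conv b (bind_pmf N a) = bind_pmf N (\<lambda>n. conv b (a n))"
  unfolding conv_def map_bind_pmf by (rule bind_commute_pmf)

lemma pmf_translate:
  assumes "set_pmf a \<subseteq> carrier G" "g \<in> carrier G" "x \<in> carrier G"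
  shows "pmf (map_pmf (\<lambda>y. g \<otimes> y) a) x = pmf a (inv g \<otimes> x)"
proof -
  have "pmf (map_pmf (\<lambda>y. g \<otimes> y) a) x = measure_pmf.prob a ((\<lambda>y. g \<otimes> y) -` {x} \<inter> set_pmf a)"
    by (simp add: pmf_map measure_Int_set_pmf)
  also have "(\<lambda>y. g \<otimes> y) -` {x} \<inter> set_pmf a = {inv g \<otimes> x} \<inter> set_pmf a"
  proof (intro Set.set_eqI iffI)
    fix y assume "y \<in> (\<lambda>y. g \<otimes> y) -` {x} \<inter> set_pmf a"
    then show "y \<in> {inv g \<otimes> x} \<inter> set_pmf a"
      using assms by (auto simp: m_assoc[symmetric] subset_iff)
  next
    fix y assume "y \<in> {inv g \<otimes> x} \<inter> set_pmf a"
    then show "y \<in> (\<lambda>y. g \<otimes> y) -` {x} \<inter> set_pmf a"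
      using assms by (auto simp: m_assoc[symmetric])
  qed
  finally show ?thesis by (simp add: measure_Int_set_pmf measure_pmf_single)
qed

lemma pmf_conv:
  assumes a: "set_pmf a \<subseteq> carrier G" and b: "set_pmf b \<subseteq> carrier G" and x: "x \<in> carrier G"
  shows "pmf (conv a b) x = (\<Sum>\<^sub>\<infinity>g\<in>carrier G. pmf a g * pmf b (inv g \<otimes> x))"
proof -
  have "pmf (conv a b) x = measure_pmf.expectation a (\<lambda>g. pmf (map_pmf (\<lambda>y. g \<otimes> y) b) x)"
    by (simp add: conv_def pmf_bind)
  moreover have "integrable (measure_pmf a) (\<lambda>g. pmf (map_pmf (\<lambda>y. g \<otimes> y) b) x)"
    by (rule measure_pmf.integrable_const_bound[where B = 1]) (auto simp: pmf_le_1)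
  from infsumI[OF has_sum_expectation_pmf[OF this a]]
  have "measure_pmf.expectation a (\<lambda>g. pmf (map_pmf (\<lambda>y. g \<otimes> y) b) x) =
      (\<Sum>\<^sub>\<infinity>g\<in>carrier G. pmf a g * pmf (map_pmf (\<lambda>y. g \<otimes> y) b) x)" by simp
  moreover have "\<dots> = (\<Sum>\<^sub>\<infinity>g\<in>carrier G. pmf a g * pmf b (inv g \<otimes> x))"
    by (intro infsum_cong) (simp add: pmf_translate b x)
  ultimately show ?thesis by simp
qed

text \<open>The pseudo-Poincare argument behind Nash inequalities: H is replaced by its average over
  left translates from the ball. As b \<mapsto> inv b x is injective, the average is pointwise at
  most the l2 norm of H over the root of the volume; each translate differs from H in l2 by at most
  r times the root of the energy.\<close>

lemma inner_le_ball:
  fixes W H :: "'a \<Rightarrow> real"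
  assumes W: "square_summable W" "W summable_on carrier G" "\<And>x. x \<in> carrier G \<Longrightarrow> 0 \<le> W x"
    and H: "square_summable H"
  shows "(\<Sum>\<^sub>\<infinity>x\<in>carrier G. W x * H x) \<le>
    infsum W (carrier G) * l2 H / sqrt (real (card (word_ball G S r))) + l2 W * (real r * sqrt (energy H))"
proof -
  let ?B = "word_ball G S r"
  let ?V = "real (card ?B)"
  have B: "b \<in> carrier G" "len b \<le> r" if "b \<in> ?B" for b using that by (auto simp: word_ball_def)
  have V: "1 \<le> ?V" using card_ball_pos[of r] by simp
  have T: "square_summable (\<lambda>x. H (inv b \<otimes> x))" if "b \<in> ?B" for b
    using square_summable_translate[OF B(1)[OF that] H] .
  have WT: "(\<lambda>x. W x * H (inv b \<otimes> x)) summable_on carrier G" if "b \<in> ?B" for b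
    by (rule l2_mult_summable[OF W(1) T[OF that]])
  have WH: "(\<lambda>x. W x * H x) summable_on carrier G" by (rule l2_mult_summable[OF W(1) H])
  have one: "(\<Sum>\<^sub>\<infinity>x\<in>carrier G. W x * H x) \<le> (\<Sum>\<^sub>\<infinity>x\<in>carrier G. W x * H (inv b \<otimes> x)) + l2 W * (real r * sqrt (energy H))"
    if b: "b \<in> ?B" for b
  proof -
    note D = square_summable_diff[OF H B(1)[OF b]]
    have "(\<Sum>\<^sub>\<infinity>x\<in>carrier G. W x * H x) - (\<Sum>\<^sub>\<infinity>x\<in>carrier G. W x * H (inv b \<otimes> x)) =
        (\<Sum>\<^sub>\<infinity>x\<in>carrier G. W x * (H x - H (inv b \<otimes> x)))"
      using infsum_minus[OF WH WT[OF b]] by (simp add: right_diff_distrib)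
    also have "\<dots> \<le> l2 W * displacement H b"
      using l2_inner_le[OF W(1) D] unfolding displacement_def by linarith
    also have "\<dots> \<le> l2 W * (real r * sqrt (energy H))"
    proof (intro mult_left_mono)
      have "displacement H b \<le> real (len b) * sqrt (energy H)" by (rule displacement_le[OF H B(1)[OF b]])
      also have "\<dots> \<le> real r * sqrt (energy H)" using B(2)[OF b] by (intro mult_right_mono) auto
      finally show "displacement H b \<le> real r * sqrt (energy H)" .
    qed simp
    finally show ?thesis by simp
  qed
  have avg: "(\<Sum>b\<in>?B. H (inv b \<otimes> x)) \<le> sqrt ?V * l2 H" if x: "x \<in> carrier G" for x
  proof -
    have inj: "inj_on (\<lambda>b. inv b \<otimes> x) ?B"
    proof (rule inj_onI)
      fix b c assume "b \<in> ?B" "c \<in> ?B" "inv b \<otimes> x = inv c \<otimes> x"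
      then have "inv b = inv c" using B x by simp
      then show "b = c" using \<open>b \<in> ?B\<close> \<open>c \<in> ?B\<close> B by (metis inv_inv)
    qed
    have "(\<Sum>b\<in>?B. H (inv b \<otimes> x)) \<le> (\<Sum>b\<in>?B. \<bar>1::real\<bar> * \<bar>H (inv b \<otimes> x)\<bar>)" by (intro sum_mono) simp
    also have "\<dots> \<le> L2_set (\<lambda>_. 1) ?B * L2_set (\<lambda>b. H (inv b \<otimes> x)) ?B" by (rule L2_set_mult_ineq)
    also have "\<dots> \<le> sqrt ?V * l2 H"
    proof (intro mult_mono)
      have "(\<Sum>b\<in>?B. (H (inv b \<otimes> x))\<^sup>2) = (\<Sum>y\<in>(\<lambda>b. inv b \<otimes> x) ` ?B. (H y)\<^sup>2)"
        by (simp add: sum.reindex[OF inj])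
      also have "\<dots> \<le> (\<Sum>\<^sub>\<infinity>y\<in>carrier G. (H y)\<^sup>2)"
        using B x by (intro finite_sum_le_infsum H finite_imageI finite_word_ball) auto
      finally show "L2_set (\<lambda>b. H (inv b \<otimes> x)) ?B \<le> l2 H" unfolding L2_set_def l2norm_def by simp
    qed (auto simp: L2_set_def intro: sum_nonneg)
    finally show ?thesis .
  qed
  have hs: "((\<lambda>x. \<Sum>b\<in>?B. W x * H (inv b \<otimes> x)) has_sum (\<Sum>b\<in>?B. \<Sum>\<^sub>\<infinity>x\<in>carrier G. W x * H (inv b \<otimes> x))) (carrier G)"
    by (intro has_sum_finite_sum has_sum_infsum WT)
  have "(\<Sum>b\<in>?B. \<Sum>\<^sub>\<infinity>x\<in>carrier G. W x * H (inv b \<otimes> x)) \<le> infsum W (carrier G) * (sqrt ?V * l2 H)"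
  proof (rule has_sum_mono[OF hs has_sum_cmult_left[OF has_sum_infsum[OF W(2)]]])
    fix x assume x: "x \<in> carrier G"
    show "(\<Sum>b\<in>?B. W x * H (inv b \<otimes> x)) \<le> W x * (sqrt ?V * l2 H)"
      unfolding sum_distrib_left[symmetric] by (intro mult_left_mono avg W x)
  qed
  moreover have "?V * (\<Sum>\<^sub>\<infinity>x\<in>carrier G. W x * H x) \<le>
      (\<Sum>b\<in>?B. \<Sum>\<^sub>\<infinity>x\<in>carrier G. W x * H (inv b \<otimes> x)) + ?V * (l2 W * (real r * sqrt (energy H)))"
    using sum_mono[of ?B "\<lambda>_. \<Sum>\<^sub>\<infinity>x\<in>carrier G. W x * H x", OF one] by (simp add: sum.distrib)
  ultimately have "?V * (\<Sum>\<^sub>\<infinity>x\<in>carrier G. W x * H x) \<le>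
      infsum W (carrier G) * (sqrt ?V * l2 H) + ?V * (l2 W * (real r * sqrt (energy H)))" by linarith
  also have "sqrt ?V = ?V / sqrt ?V" using V by (simp add: real_div_sqrt)
  finally have "?V * (\<Sum>\<^sub>\<infinity>x\<in>carrier G. W x * H x) \<le>
      ?V * (infsum W (carrier G) * l2 H / sqrt ?V + l2 W * (real r * sqrt (energy H)))"
    by (simp add: algebra_simps)
  then show ?thesis using V by simp
qed

end

context centered_walk
begin

text \<open>The law of \<mu>^n * v at a geometric time n, that is, p times the sum of (1 - p)^n
  \<mu>^n * v. The time has mean (1 - p)/p, so p is taken of the order of the inverse square of a
  spatial scale.\<close>

definition resolvent :: "real \<Rightarrow> 'a pmf \<Rightarrow> 'a pmf" where
  "resolvent p v = bind_pmf (geometric_pmf p) (\<lambda>n. (conv \<mu> ^^ n) v)"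

text \<open>Lets \<mu> stand on the left for the energy estimates and on the right when pairing with
  harmonic functions.\<close>

definition commuting :: "'a pmf \<Rightarrow> bool" where
  "commuting v \<longleftrightarrow> set_pmf v \<subseteq> carrier G \<and> conv v \<mu> = conv \<mu> v"

lemma commuting_set: "commuting v \<Longrightarrow> set_pmf v \<subseteq> carrier G"
  by (simp add: commuting_def)

lemma commuting_one: "commuting (return_pmf \<one>)"
proof -
  have "map_pmf (\<lambda>x. \<one> \<otimes> x) \<mu> = map_pmf (\<lambda>x. x) \<mu>" "bind_pmf \<mu> (\<lambda>g. return_pmf (g \<otimes> \<one>)) = bind_pmf \<mu> return_pmf"
    using supp by (intro map_pmf_cong bind_pmf_cong refl; auto)+
  then show ?thesis
    by (simp add: commuting_def conv_def bind_return_pmf bind_return_pmf' map_pmf_ident)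
qed

lemma commuting_conv: "commuting v \<Longrightarrow> commuting (conv \<mu> v)"
  using conv_assoc[OF supp _ supp, of v] set_conv[OF supp, of v] by (simp add: commuting_def)

lemma commuting_power: "commuting v \<Longrightarrow> commuting ((conv \<mu> ^^ n) v)"
  by (induction n) (auto intro: commuting_conv)

lemma commuting_resolvent:
  assumes v: "commuting v"
  shows "commuting (resolvent p v)"
proof -
  have "set_pmf (resolvent p v) \<subseteq> carrier G"
    using commuting_power[OF v] unfolding resolvent_def commuting_def by auto
  moreover have "conv (resolvent p v) \<mu> = conv \<mu> (resolvent p v)"
    using commuting_power[OF v] by (simp add: resolvent_def conv_bind_left conv_bind_right commuting_def)
  ultimately show ?thesis by (simp add: commuting_def)
qed

text \<open>The geometric time is zero with probability p, and otherwise one plus a fresh geometric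
  time.\<close>

lemma resolvent_eq:
  assumes p: "0 < p" "p \<le> 1"
  shows "resolvent p v = bind_pmf (bernoulli_pmf p) (\<lambda>b. if b then v else conv \<mu> (resolvent p v))"
proof -
  have "resolvent p v = bind_pmf (bernoulli_pmf p)
      (\<lambda>b. bind_pmf (if b then return_pmf 0 else map_pmf Suc (geometric_pmf p)) (\<lambda>n. (conv \<mu> ^^ n) v))"
    unfolding resolvent_def using p by (subst geometric_bind_pmf_unfold) (auto simp: bind_assoc_pmf)
  also have "\<dots> = bind_pmf (bernoulli_pmf p) (\<lambda>b. if b then v else conv \<mu> (resolvent p v))"
    by (intro bind_pmf_cong refl) (auto simp: bind_return_pmf bind_map_pmf resolvent_def conv_bind_right)
  finally show ?thesis .
qed

lemma pmf_resolvent: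
  assumes p: "0 < p" "p \<le> 1"
  shows "pmf (resolvent p v) x = p * pmf v x + (1 - p) * pmf (conv \<mu> (resolvent p v)) x"
proof -
  have "pmf (resolvent p v) x = pmf (bind_pmf (bernoulli_pmf p) (\<lambda>b. if b then v else conv \<mu> (resolvent p v))) x"
    using resolvent_eq[OF p] by simp
  then show ?thesis using p by (simp add: pmf_bind)
qed

definition weighted :: "('a \<Rightarrow> real) \<Rightarrow> 'a pmf \<Rightarrow> 'a \<Rightarrow> real" where
  "weighted \<psi> a x = exp (\<psi> x) * pmf a x"

lemma weighted_nonneg [simp]: "0 \<le> weighted \<psi> a x"
  by (simp add: weighted_def)

lemma weighted_summable:
  assumes "set_pmf a \<subseteq> carrier G" "\<forall>x\<in>carrier G. \<bar>\<psi> x\<bar> \<le> B"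
  shows "weighted \<psi> a summable_on carrier G" "square_summable (weighted \<psi> a)"
proof -
  have e: "exp (\<psi> x) \<le> exp B" if "x \<in> carrier G" for x using assms(2) that by (force dest: abs_le_D1)
  show "weighted \<psi> a summable_on carrier G"
    unfolding weighted_def[abs_def]
    by (rule summable_on_bounded_mult[OF summable_pmf[OF assms(1)], where B = "exp B"]) (use e in auto)
  have "(\<lambda>x. ((exp (\<psi> x))\<^sup>2 * pmf a x) * pmf a x) summable_on carrier G"
  proof (rule summable_on_bounded_mult[OF summable_pmf[OF assms(1)]])
    fix x assume "x \<in> carrier G"
    then have "(exp (\<psi> x))\<^sup>2 * pmf a x \<le> (exp B)\<^sup>2 * 1"
      by (intro mult_mono power_mono e) (auto simp: pmf_le_1)
    then show "\<bar>(exp (\<psi> x))\<^sup>2 * pmf a x\<bar> \<le> (exp B)\<^sup>2" by (simp add: abs_mult)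
  qed
  then show "square_summable (weighted \<psi> a)"
    by (simp add: weighted_def power_mult_distrib power2_eq_square[of "pmf _ _"] mult.assoc)
qed

text \<open>The equation h = p v + (1 - p) \<mu> * h, multiplied by exp(2 \<psi>) h and summed.
  Boundedness of \<psi> makes the double sum absolutely convergent, so that the sums over g and x
  may be exchanged.\<close>

lemma resolvent_identity:
  assumes p: "0 < p" "p \<le> 1" and v: "commuting v"
    and bdd: "\<forall>x\<in>carrier G. \<bar>\<psi> x\<bar> \<le> B"
  defines "W \<equiv> weighted \<psi> v" and "H \<equiv> weighted \<psi> (resolvent p v)"
  shows "(l2 H)\<^sup>2 = p * (\<Sum>\<^sub>\<infinity>x\<in>carrier G. W x * H x) +
      (1 - p) * (\<Sum>\<^sub>\<infinity>g\<in>carrier G. pmf \<mu> g * tilted_inner \<psi> H g)"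
proof -
  define h where "h = resolvent p v"
  have hset: "set_pmf h \<subseteq> carrier G" and vset: "set_pmf v \<subseteq> carrier G"
    using commuting_resolvent[OF v] v by (auto simp: h_def commuting_def)
  define K where "K g x = exp (2 * \<psi> x) * (pmf h x * pmf h (inv g \<otimes> x))" for g x
  note Ws = weighted_summable[OF vset bdd, folded W_def]
  note Hs = weighted_summable[OF hset bdd, unfolded h_def, folded H_def]
  have K_bd: "0 \<le> K g x" "K g x \<le> exp (2 * B) * pmf h x" if "x \<in> carrier G" for g x
  proof -
    show "0 \<le> K g x" by (simp add: K_def)
    have "exp (2 * \<psi> x) * (pmf h x * pmf h (inv g \<otimes> x)) \<le> exp (2 * B) * (pmf h x * 1)"
      using bdd that by (intro mult_mono) (auto simp: pmf_le_1 dest!: bspec abs_le_D1)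
    then show "K g x \<le> exp (2 * B) * pmf h x" by (simp add: K_def)
  qed
  have prod: "(\<lambda>(x, g). pmf \<mu> g * K g x) summable_on (carrier G \<times> carrier G)"
  proof (rule summable_on_abs_boundI)
    show "(\<lambda>(x, g). exp (2 * B) * pmf h x * pmf \<mu> g) summable_on (carrier G \<times> carrier G)"
    proof (rule summable_on_SigmaI)
      show "((\<lambda>g. case (x, g) of (x, g) \<Rightarrow> exp (2 * B) * pmf h x * pmf \<mu> g) has_sum exp (2 * B) * pmf h x * 1) (carrier G)" for x
        using has_sum_cmult_right[OF has_sum_pmf[OF supp]] by simp
      show "(\<lambda>x. exp (2 * B) * pmf h x * 1) summable_on carrier G"
        using summable_on_cmult_right[OF summable_pmf[OF hset]] by simp
    qed auto
    fix z assume "z \<in> carrier G \<times> carrier G"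
    then obtain x g where z: "z = (x, g)" "x \<in> carrier G" by auto
    show "\<bar>case z of (x, g) \<Rightarrow> pmf \<mu> g * K g x\<bar> \<le> (case z of (x, g) \<Rightarrow> exp (2 * B) * pmf h x * pmf \<mu> g)"
      using mult_left_mono[OF K_bd(2)[OF z(2), of g] pmf_nonneg[of \<mu> g]] K_bd(1)[OF z(2), of g] z
      by (simp add: abs_mult mult_ac)
  qed
  have tilted: "tilted_inner \<psi> H g = (\<Sum>\<^sub>\<infinity>x\<in>carrier G. K g x)" for g
    unfolding tilted_inner_def
  proof (intro infsum_cong)
    fix x
    have "exp (\<psi> x - \<psi> (inv g \<otimes> x)) * (exp (\<psi> x) * exp (\<psi> (inv g \<otimes> x))) = exp (2 * \<psi> x)"
      by (simp flip: exp_add)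
    then show "exp (\<psi> x - \<psi> (inv g \<otimes> x)) * (H x * H (inv g \<otimes> x)) = K g x"
      by (simp add: H_def weighted_def K_def h_def algebra_simps)
  qed
  have WH: "(\<lambda>x. W x * H x) summable_on carrier G" by (rule l2_mult_summable[OF Ws(2) Hs(2)])
  have "(l2 H)\<^sup>2 = (\<Sum>\<^sub>\<infinity>x\<in>carrier G. p * (W x * H x) + (1 - p) * (\<Sum>\<^sub>\<infinity>g\<in>carrier G. pmf \<mu> g * K g x))"
    unfolding l2norm_sq
  proof (intro infsum_cong)
    fix x assume x: "x \<in> carrier G"
    have "(H x)\<^sup>2 = exp (2 * \<psi> x) * pmf h x * pmf h x"
      by (simp add: H_def weighted_def h_def power2_eq_square flip: exp_add)
    also have "\<dots> = exp (2 * \<psi> x) * pmf h x * (p * pmf v x + (1 - p) * (\<Sum>\<^sub>\<infinity>g\<in>carrier G. pmf \<mu> g * pmf h (inv g \<otimes> x)))"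
      using pmf_resolvent[OF p, of v x] pmf_conv[OF supp hset x] by (simp add: h_def)
    also have "\<dots> = p * (exp (\<psi> x) * exp (\<psi> x) * pmf h x * pmf v x) +
        (1 - p) * (exp (2 * \<psi> x) * pmf h x * (\<Sum>\<^sub>\<infinity>g\<in>carrier G. pmf \<mu> g * pmf h (inv g \<otimes> x)))"
      by (simp add: algebra_simps flip: exp_add)
    also have "exp (2 * \<psi> x) * pmf h x * (\<Sum>\<^sub>\<infinity>g\<in>carrier G. pmf \<mu> g * pmf h (inv g \<otimes> x)) =
        (\<Sum>\<^sub>\<infinity>g\<in>carrier G. pmf \<mu> g * K g x)"
      unfolding infsum_cmult_right'[symmetric] by (intro infsum_cong) (simp add: K_def)
    finally show "(H x)\<^sup>2 = p * (W x * H x) + (1 - p) * (\<Sum>\<^sub>\<infinity>g\<in>carrier G. pmf \<mu> g * K g x)"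
      by (simp add: W_def H_def weighted_def h_def mult_ac)
  qed
  also have "\<dots> = p * (\<Sum>\<^sub>\<infinity>x\<in>carrier G. W x * H x) +
      (1 - p) * (\<Sum>\<^sub>\<infinity>x\<in>carrier G. \<Sum>\<^sub>\<infinity>g\<in>carrier G. pmf \<mu> g * K g x)"
    by (subst infsum_add, intro summable_on_cmult_right WH,
        intro summable_on_cmult_right summable_on_Sigma_banach[OF prod], simp add: infsum_cmult_right')
  also have "(\<Sum>\<^sub>\<infinity>x\<in>carrier G. \<Sum>\<^sub>\<infinity>g\<in>carrier G. pmf \<mu> g * K g x) =
      (\<Sum>\<^sub>\<infinity>g\<in>carrier G. pmf \<mu> g * tilted_inner \<psi> H g)"
    unfolding tilted using infsum_swap_banach[OF prod] by (simp add: infsum_cmult_right')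
  finally show ?thesis .
qed

abbreviation resolvent_bounds :: "real \<Rightarrow> real \<Rightarrow> ('a \<Rightarrow> real) \<Rightarrow> 'a pmf \<Rightarrow> bool" where
  "resolvent_bounds K p \<psi> v \<equiv> energy (weighted \<psi> (resolvent p v)) \<le> K * p * (l2 (weighted \<psi> v))\<^sup>2 \<and>
     (l2 (weighted \<psi> (resolvent p v)))\<^sup>2 \<le> 4 * (l2 (weighted \<psi> v))\<^sup>2 \<and>
     (\<forall>r. (l2 (weighted \<psi> (resolvent p v)))\<^sup>2 \<le>
        4 * (infsum (weighted \<psi> v) (carrier G))\<^sup>2 / real (card (word_ball G S r))
        + K * p * (real r)\<^sup>2 * (l2 (weighted \<psi> v))\<^sup>2)"

text \<open>One resolvent step turns the coercivity estimate into a gradient bound and, after averaging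
  over a ball, into an \<open>\<ell>\<^sup>1\<close>-\<open>\<ell>\<^sup>2\<close> smoothing bound.\<close>

lemma resolvent_step:
  "\<exists>K\<ge>1. \<forall>p \<delta> \<psi> B v. 0 < p \<longrightarrow> p \<le> 1 / 2 \<longrightarrow> 0 \<le> \<delta> \<longrightarrow> \<delta> \<le> \<delta>\<^sub>0 \<longrightarrow> K * \<delta>\<^sup>2 \<le> p \<longrightarrow> commuting v \<longrightarrow>
     (\<forall>x\<in>carrier G. \<bar>\<psi> x\<bar> \<le> B) \<longrightarrow>
     left_lipschitz \<psi> \<delta> \<longrightarrow>
     resolvent_bounds K p \<psi> v"
proof -
  obtain \<kappa> C where \<kappa>: "0 < \<kappa>" and C: "0 < C" and coer: "\<forall>\<psi> v \<delta>. square_summable v \<longrightarrow> 0 \<le> \<delta> \<longrightarrow> \<delta> \<le> \<delta>\<^sub>0 \<longrightarrow>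
     (\<forall>x\<in>carrier G. 0 \<le> v x) \<longrightarrow>
     left_lipschitz \<psi> \<delta> \<longrightarrow>
     (\<Sum>\<^sub>\<infinity>g\<in>carrier G. pmf \<mu> g * tilted_inner \<psi> v g) \<le> (1 + C * \<delta>\<^sup>2) * (l2 v)\<^sup>2 - \<kappa> * energy v"
    using coercivity by (elim exE conjE)
  \<comment> \<open>With 2 C, the condition K \<delta>^2 \<le> p absorbs the weight error into half
    of the mass term; 2 / \<kappa> comes from dividing by the energy coefficient.\<close>
  define K where "K = max 1 (max (2 * C) (2 / \<kappa>))"
  have K: "1 \<le> K" "2 * C \<le> K" "2 / \<kappa> \<le> K" by (simp_all add: K_def)
  have "energy (weighted \<psi> (resolvent p v)) \<le> K * p * (l2 (weighted \<psi> v))\<^sup>2"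
    "(l2 (weighted \<psi> (resolvent p v)))\<^sup>2 \<le> 4 * (l2 (weighted \<psi> v))\<^sup>2"
    "(l2 (weighted \<psi> (resolvent p v)))\<^sup>2 \<le>
        4 * (infsum (weighted \<psi> v) (carrier G))\<^sup>2 / real (card (word_ball G S r))
        + K * p * (real r)\<^sup>2 * (l2 (weighted \<psi> v))\<^sup>2"
    if p: "0 < p" "p \<le> 1 / 2" and \<delta>: "0 \<le> \<delta>" "\<delta> \<le> \<delta>\<^sub>0" "K * \<delta>\<^sup>2 \<le> p" and v: "commuting v"
      and bdd: "\<forall>x\<in>carrier G. \<bar>\<psi> x\<bar> \<le> B"
      and lip: "left_lipschitz \<psi> \<delta>"
    for p \<delta> \<psi> B v r
  proof -
    define W where "W = weighted \<psi> v"
    define H where "H = weighted \<psi> (resolvent p v)"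
    define ip where "ip = (\<Sum>\<^sub>\<infinity>x\<in>carrier G. W x * H x)"
    note Ws = weighted_summable[OF commuting_set[OF v] bdd, folded W_def]
    note Hs = weighted_summable[OF commuting_set[OF commuting_resolvent[OF v, of p]] bdd, folded H_def]
    define N where "N = (l2 H)\<^sup>2"
    define E where "E = energy H"
    define L where "L = (l2 W)\<^sup>2"
    have nn: "0 \<le> N" "0 \<le> E" "0 \<le> L" by (simp_all add: N_def E_def L_def)
    have p1: "p \<le> 1" using p by simp
    have "N = p * ip + (1 - p) * (\<Sum>\<^sub>\<infinity>g\<in>carrier G. pmf \<mu> g * tilted_inner \<psi> H g)"
      unfolding N_def ip_def W_def H_def by (rule resolvent_identity[OF p(1) p1 v bdd])
    also have "\<dots> \<le> p * ip + (1 - p) * ((1 + C * \<delta>\<^sup>2) * N - \<kappa> * E)"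
      unfolding N_def E_def using p1 Hs(2) \<delta> lip
      by (intro add_left_mono mult_left_mono coer[rule_format]) (auto simp: H_def)
    also have "\<dots> \<le> p * ip + (1 - p) * N + C * \<delta>\<^sup>2 * N - \<kappa> / 2 * E"
    proof -
      have "(1 - p) * (C * \<delta>\<^sup>2 * N) \<le> 1 * (C * \<delta>\<^sup>2 * N)" using p C nn by (intro mult_right_mono) auto
      moreover have "1 / 2 * (\<kappa> * E) \<le> (1 - p) * (\<kappa> * E)" using p \<kappa> nn by (intro mult_right_mono) auto
      ultimately show ?thesis by (simp add: algebra_simps)
    qed
    also have "C * \<delta>\<^sup>2 * N \<le> p / 2 * N"
    proof (rule mult_right_mono)
      have "2 * C * \<delta>\<^sup>2 \<le> K * \<delta>\<^sup>2" using K by (intro mult_right_mono) auto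
      then show "C * \<delta>\<^sup>2 \<le> p / 2" using \<delta>(3) by simp
    qed (rule nn)
    \<comment> \<open>All three bounds follow from this inequality by estimating \<open>ip\<close>
      in three ways: arithmetic-geometric mean for the energy, Cauchy-Schwarz for the norm,
      averaging over a ball for the smoothing.\<close>
    finally have base: "p / 2 * N + \<kappa> / 2 * E \<le> p * ip" by (simp add: algebra_simps)
    have ipWH: "ip \<le> l2 W * l2 H"
      using l2_inner_le[OF Ws(2) Hs(2)] unfolding ip_def by linarith
    have "ip \<le> L / 2 + N / 2"
      using ipWH sum_squares_bound[of "l2 W" "l2 H"] unfolding L_def N_def by (simp add: field_simps)
    then have "p * ip \<le> p * (L / 2 + N / 2)" using p by (intro mult_left_mono) auto
    with base have "\<kappa> * E \<le> p * L" by (simp add: algebra_simps)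
    then have "E \<le> (1 / \<kappa>) * p * L" using \<kappa> by (simp add: field_simps)
    also have "\<dots> \<le> K * p * L" using K \<kappa> p nn by (intro mult_right_mono) (auto simp: field_simps)
    finally show "energy (weighted \<psi> (resolvent p v)) \<le> K * p * (l2 (weighted \<psi> v))\<^sup>2"
      by (simp add: E_def L_def H_def W_def)
    have "0 \<le> \<kappa> / 2 * E" using \<kappa> nn by simp
    with base have "p * (N / 2) \<le> p * ip" by simp
    then have Nip: "N \<le> 2 * ip" using p by simp
    have "N \<le> 4 * L"
    proof -
      have "2 * (2 * l2 W * l2 H) \<le> 4 * (l2 W)\<^sup>2 + (l2 H)\<^sup>2"
        using sum_squares_bound[of "2 * l2 W" "l2 H"] by (simp add: power_mult_distrib)
      then show ?thesis using Nip ipWH unfolding N_def L_def by (simp add: algebra_simps)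
    qed
    then show "(l2 (weighted \<psi> (resolvent p v)))\<^sup>2 \<le> 4 * (l2 (weighted \<psi> v))\<^sup>2"
      by (simp add: N_def L_def H_def W_def)
    define V where "V = real (card (word_ball G S r))"
    define w where "w = infsum W (carrier G)"
    have V: "0 < V" using card_ball_pos[of r] by (simp add: V_def)
    have "ip \<le> w * l2 H / sqrt V + l2 W * (real r * sqrt E)"
      unfolding ip_def w_def V_def E_def by (rule inner_le_ball[OF Ws(2,1) _ Hs(2)]) (simp add: W_def)
    moreover have "w * l2 H / sqrt V \<le> w\<^sup>2 / V + N / 4"
    proof -
      have "0 \<le> (w / sqrt V - l2 H / 2)\<^sup>2" by simp
      then show ?thesis using V by (simp add: N_def power2_eq_square algebra_simps power_divide)
    qed
    \<comment> \<open>Scaled so that the energy produced is exactly the one available in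
      \<open>base\<close>.\<close>
    moreover have "p * (l2 W * (real r * sqrt E)) \<le> \<kappa> / 2 * E + (p * l2 W * real r)\<^sup>2 / (2 * \<kappa>)"
    proof -
      have "0 \<le> (\<kappa> * sqrt E - p * l2 W * real r)\<^sup>2 / (2 * \<kappa>)" using \<kappa> by simp
      also have "\<dots> = \<kappa> / 2 * (sqrt E)\<^sup>2 - p * (l2 W * (real r * sqrt E)) + (p * l2 W * real r)\<^sup>2 / (2 * \<kappa>)"
        using \<kappa> by (simp add: power2_eq_square field_simps)
      finally show ?thesis using nn by simp
    qed
    ultimately have "p * ip \<le> p * (w\<^sup>2 / V + N / 4) + (\<kappa> / 2 * E + (p * l2 W * real r)\<^sup>2 / (2 * \<kappa>))"
      using mult_left_mono[of ip "w\<^sup>2 / V + N / 4 + l2 W * (real r * sqrt E)" p] p by (simp add: distrib_left)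
    moreover have "p * (w\<^sup>2 / V + N / 4) = p * (w\<^sup>2 / V) + p / 4 * N" by (simp add: distrib_left)
    moreover have "(p * l2 W * real r)\<^sup>2 / (2 * \<kappa>) = p * (p * (l2 W * real r)\<^sup>2 / (2 * \<kappa>))"
      by (simp add: power2_eq_square)
    ultimately have "p / 4 * N \<le> p * (w\<^sup>2 / V) + p * (p * (l2 W * real r)\<^sup>2 / (2 * \<kappa>))"
      using base by linarith
    then have "p * (N / 4) \<le> p * (w\<^sup>2 / V + p * (l2 W * real r)\<^sup>2 / (2 * \<kappa>))" by (simp add: distrib_left)
    then have "N / 4 \<le> w\<^sup>2 / V + p * (l2 W * real r)\<^sup>2 / (2 * \<kappa>)" using p by simp
    then have "N \<le> 4 * w\<^sup>2 / V + (2 / \<kappa>) * (p * (real r)\<^sup>2 * L)"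
      by (simp add: L_def power_mult_distrib mult_ac)
    also have "(2 / \<kappa>) * (p * (real r)\<^sup>2 * L) \<le> K * (p * (real r)\<^sup>2 * L)"
      using K p nn by (intro mult_right_mono) auto
    finally show "(l2 (weighted \<psi> (resolvent p v)))\<^sup>2 \<le>
        4 * (infsum (weighted \<psi> v) (carrier G))\<^sup>2 / real (card (word_ball G S r))
        + K * p * (real r)\<^sup>2 * (l2 (weighted \<psi> v))\<^sup>2"
      by (simp add: N_def L_def H_def W_def w_def V_def mult_ac)
  qed
  then show ?thesis using K(1)
    by (intro exI[of _ K] conjI allI impI) assumption+
qed

end

section \<open>Volume growth and the multiscale iteration\<close>

lemma exp_minus_le_power: "0 < y \<Longrightarrow> 1 \<le> k \<Longrightarrow> exp (- y) \<le> (real k / y) ^ k"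
proof -
  assume y: "0 < (y::real)" "1 \<le> k"
  have "y / real k \<le> exp (y / real k)" using exp_ge_add_one_self[of "y / real k"] by linarith
  then have "(y / real k) ^ k \<le> exp (y / real k) ^ k" using y by (intro power_mono) auto
  also have "\<dots> = exp y" using y by (simp flip: exp_of_nat_mult)
  finally have "inverse (exp y) \<le> inverse ((y / real k) ^ k)" using y by (intro le_imp_inverse_le) auto
  then show ?thesis by (simp add: exp_minus power_inverse[symmetric])
qed

locale centered_walk_poly = centered_walk +
  assumes growth: "polynomial_growth G S"
begin

section \<open>Volumes at the scales 4^j\<close>

definition vol :: "nat \<Rightarrow> real" where "vol j = real (card (word_ball G S (4 ^ j)))"

lemma vol_ge_1: "1 \<le> vol j"
  using card_ball_pos[of "4 ^ j"] by (simp add: vol_def)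

text \<open>\<open>good_scales\<close> for the logarithm of the volume: growth of degree d means
  slope d ln 4 in the scale index. The factor A is uniform over all the scales found.\<close>

lemma good_volume_scales:
  "\<exists>A\<ge>1. \<forall>N. \<exists>J\<ge>N. (\<forall>k\<ge>J. vol k \<le> vol J * A ^ (k - J)) \<and> (\<forall>k\<le>J. vol J \<le> vol k * A ^ (J - k))"
proof -
  obtain C d where Cd: "\<And>r. r \<ge> 1 \<Longrightarrow> real (card (word_ball G S r)) \<le> C * real r ^ d"
    using growth by (auto simp: polynomial_growth_def)
  have C: "1 \<le> C" using Cd[of 1] card_ball_pos[of 1] by simp
  define \<phi> where "\<phi> j = ln (vol j)" for j
  define b where "b = real d * ln 4"
  define D where "D = 2 * b + 1"
  have b: "0 \<le> b" by (simp add: b_def)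
  have v: "vol j = exp (\<phi> j)" for j using vol_ge_1[of j] by (simp add: \<phi>_def)
  have "vol i \<le> vol j" if "i \<le> j" for i j
    unfolding vol_def using that by (intro of_nat_mono card_ball_mono power_increasing) auto
  then have mono: "mono \<phi>"
    using vol_ge_1 by (intro monoI) (simp add: \<phi>_def order_less_le_trans[OF zero_less_one])
  have nonneg: "0 \<le> \<phi> n" for n using vol_ge_1[of n] by (simp add: \<phi>_def)
  have gr: "\<phi> n \<le> b * real n + ln C" for n
  proof -
    have "vol n \<le> C * (4 ^ n) ^ d" using Cd[of "4 ^ n"] by (simp add: vol_def)
    then have "\<phi> n \<le> ln (C * (4 ^ n) ^ d)"
      using vol_ge_1[of n] by (simp add: \<phi>_def)
    also have "\<dots> = b * real n + ln C"
      using C by (simp add: ln_mult ln_realpow b_def)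
    finally show ?thesis .
  qed
  have "\<exists>J\<ge>N. (\<forall>k\<ge>J. vol k \<le> vol J * exp D ^ (k - J)) \<and> (\<forall>k\<le>J. vol J \<le> vol k * exp D ^ (J - k))" for N
  proof -
    obtain J where J: "J \<ge> N" "\<And>k. k \<ge> J \<Longrightarrow> \<phi> k \<le> \<phi> J + D * (real k - real J)"
      "\<And>k. k \<le> J \<Longrightarrow> \<phi> J \<le> \<phi> k + D * (real J - real k)"
      using good_scales[OF mono nonneg b gr, of D N] by (auto simp: D_def)
    have "vol k \<le> vol J * exp D ^ (k - J)" if "k \<ge> J" for k
      using J(2)[OF that] that unfolding v exp_of_nat_mult[symmetric] exp_add[symmetric]
      by (simp add: of_nat_diff mult.commute)
    moreover have "vol J \<le> vol k * exp D ^ (J - k)" if "k \<le> J" for k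
      using J(3)[OF that] that unfolding v exp_of_nat_mult[symmetric] exp_add[symmetric]
      by (simp add: of_nat_diff mult.commute)
    ultimately show ?thesis using J(1) by blast
  qed
  then show ?thesis using b by (intro exI[of _ "exp D"]) (auto simp: D_def)
qed

text \<open>Sum over annuli between radii 4^(J+i-1) and 4^(J+i): the exponential there is below any
  power of 4^(-i) up to a constant, and a large power beats the volume factor A^i.\<close>

lemma exponential_volume:
  assumes A: "1 \<le> A" and c: "0 < c" "c \<le> 1"
  shows "\<exists>Z>0. \<forall>J. (\<forall>k\<ge>J. vol k \<le> vol J * A ^ (k - J)) \<longrightarrow>
    decay (c / 4 ^ J) summable_on carrier G \<and>
    infsum (decay (c / 4 ^ J)) (carrier G) \<le> Z * vol J"
proof -
  \<comment> \<open>The decay exponent \<open>k = Suc k0\<close> makes the series over annuli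
    geometric with ratio at most 1/2; the successor ensures k \<ge> 1.\<close>
  obtain k0 :: nat where "2 * A < 4 ^ k0" using real_arch_pow[of 4 "2 * A"] by auto
  then have k0: "2 * A \<le> 4 ^ Suc k0" using A by simp
  define k where "k = Suc k0"
  have k: "1 \<le> k" "2 * A \<le> 4 ^ k" using k0 by (simp_all add: k_def)
  define Z where "Z = (4 * real k / c) ^ k"
  have "1 \<le> real k" using k by simp
  then have "c \<le> 4 * real k" using c by linarith
  then have Z: "1 \<le> Z" unfolding Z_def using c by (intro one_le_power) (simp add: field_simps)
  define q where "q = A / 4 ^ k"
  have q: "0 \<le> q" "q \<le> 1 / 2" using A k by (auto simp: q_def field_simps)
  have bound: "(\<Sum>x\<in>F. exp (- (c / 4 ^ J * real (len x)))) \<le> 2 * Z * vol J"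
    if J: "\<forall>k\<ge>J. vol k \<le> vol J * A ^ (k - J)" and F: "finite F" "F \<subseteq> carrier G" for J F
  proof -
    obtain n where n: "\<And>x. x \<in> F \<Longrightarrow> len x \<le> n"
      using F(1) by (metis Max_ge finite_imageI imageI)
    have lin: "m \<le> 4 ^ m" for m :: nat by (rule less_imp_le, rule power_gt_expt) simp
    have in_ball: "len x \<le> 4 ^ (J + n)" if "x \<in> F" for x
      using n[OF that] lin[of "J + n"] by linarith
    let ?I = "\<lambda>x i. if len x \<le> 4 ^ (J + i) then 1 else (0::real)"
    have pt: "exp (- (c / 4 ^ J * real (len x))) \<le> (\<Sum>i\<le>n. Z * inverse (4 ^ k) ^ i * ?I x i)" if x: "x \<in> F" for x
    proof -
      \<comment> \<open>The annulus of x. For i > 0, minimality gives the lower bound on the length;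
        for i = 0 the trivial bound 1 suffices.\<close>
      define i where "i = (LEAST i. len x \<le> 4 ^ (J + i))"
      have i: "len x \<le> 4 ^ (J + i)" "i \<le> n"
        unfolding i_def using in_ball[OF x] by (rule LeastI, rule Least_le)
      have "exp (- (c / 4 ^ J * real (len x))) \<le> Z * inverse (4 ^ k) ^ i"
      proof (cases i)
        case 0
        have "exp (- (c / 4 ^ J * real (len x))) \<le> 1" using c by simp
        also note Z
        finally show ?thesis using 0 by simp
      next
        case (Suc m)
        then have "\<not> len x \<le> 4 ^ (J + m)" unfolding i_def by (intro not_less_Least) simp
        then have "4 ^ (J + m) \<le> real (len x)"
          by (metis nat_le_linear numeral_power_le_of_nat_cancel_iff)
        then have "c / 4 ^ J * 4 ^ (J + m) \<le> c / 4 ^ J * real (len x)" using c by (intro mult_left_mono) auto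
        then have "exp (- (c / 4 ^ J * real (len x))) \<le> exp (- (c * 4 ^ m))" by (simp add: power_add)
        also have "\<dots> \<le> (real k / (c * 4 ^ m)) ^ k" using c k by (intro exp_minus_le_power) auto
        also have "real k / (c * 4 ^ m) = (4 * real k / c) * inverse (4 ^ i)" using Suc by (simp add: field_simps)
        also have "\<dots> ^ k = Z * inverse (4 ^ k) ^ i"
          by (simp only: Z_def power_mult_distrib power_inverse power_mult[symmetric] mult.commute[of i k])
        finally show ?thesis .
      qed
      also have "\<dots> = Z * inverse (4 ^ k) ^ i * ?I x i" using i by simp
      also have "\<dots> \<le> (\<Sum>i\<le>n. Z * inverse (4 ^ k) ^ i * ?I x i)"
        using i(2) Z by (intro member_le_sum) auto
      finally show ?thesis .
    qed
    have "(\<Sum>x\<in>F. exp (- (c / 4 ^ J * real (len x)))) \<le> (\<Sum>x\<in>F. \<Sum>i\<le>n. Z * inverse (4 ^ k) ^ i * ?I x i)"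
      by (rule sum_mono[OF pt])
    also have "\<dots> = (\<Sum>i\<le>n. Z * inverse (4 ^ k) ^ i * (\<Sum>x\<in>F. ?I x i))"
      by (subst sum.swap) (simp add: sum_distrib_left)
    also have "\<dots> \<le> (\<Sum>i\<le>n. Z * vol J * q ^ i)"
    proof (rule sum_mono)
      fix i
      have "(\<Sum>x\<in>F. ?I x i) = real (card (F \<inter> {x. len x \<le> 4 ^ (J + i)}))" using F by (simp add: sum.If_cases)
      also have "\<dots> \<le> vol (J + i)"
        unfolding vol_def using F by (intro of_nat_mono card_mono finite_word_ball) (auto simp: word_ball_def)
      also have "\<dots> \<le> vol J * A ^ i" using J[rule_format, of "J + i"] by simp
      finally have "Z * inverse (4 ^ k) ^ i * (\<Sum>x\<in>F. ?I x i) \<le> Z * inverse (4 ^ k) ^ i * (vol J * A ^ i)"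
        using Z by (intro mult_left_mono) auto
      then show "Z * inverse (4 ^ k) ^ i * (\<Sum>x\<in>F. ?I x i) \<le> Z * vol J * q ^ i"
        by (simp add: q_def divide_inverse power_mult_distrib mult_ac)
    qed
    also have "\<dots> \<le> Z * vol J * 2"
    proof -
      have "(\<Sum>i\<le>n. q ^ i) \<le> suminf (\<lambda>i. q ^ i)" using q by (intro sum_le_suminf summable_geometric) auto
      also have "\<dots> = 1 / (1 - q)" using q by (intro suminf_geometric) auto
      also have "\<dots> \<le> 2" using q by (simp add: field_simps)
      finally show ?thesis unfolding sum_distrib_left[symmetric]
        using Z vol_ge_1[of J] by (intro mult_left_mono) auto
    qed
    finally show ?thesis by (simp add: mult_ac)
  qed
  have "decay (c / 4 ^ J) summable_on carrier G \<and>
    infsum (decay (c / 4 ^ J)) (carrier G) \<le> 2 * Z * vol J"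
    if J: "\<forall>k\<ge>J. vol k \<le> vol J * A ^ (k - J)" for J
  proof
    show s: "decay (c / 4 ^ J) summable_on carrier G"
      using bound[OF J] by (intro nonneg_bdd_above_summable_on) (auto intro!: bdd_aboveI2)
    show "infsum (decay (c / 4 ^ J)) (carrier G) \<le> 2 * Z * vol J"
      by (rule infsum_le_finite_sums[OF s bound[OF J]])
  qed
  then show ?thesis using Z by (intro exI[of _ "2 * Z"]) auto
qed

text \<open>Truncation makes the weight bounded, as \<open>resolvent_identity\<close> requires, and
  does not increase its Lipschitz constant.\<close>

definition cap :: "real \<Rightarrow> real \<Rightarrow> 'a \<Rightarrow> real" where
  "cap \<delta> t x = min (\<delta> * real (len x)) t"

lemma cap_bound: "0 \<le> \<delta> \<Longrightarrow> 0 \<le> t \<Longrightarrow> \<forall>x\<in>carrier G. \<bar>cap \<delta> t x\<bar> \<le> t"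
  by (auto simp: cap_def)

lemma cap_lipschitz:
  assumes "0 \<le> \<delta>"
  shows "left_lipschitz (cap \<delta> t) \<delta>"
proof (intro ballI)
  fix g x assume gx: "g \<in> carrier G" "x \<in> carrier G"
  have "\<bar>cap \<delta> t x - cap \<delta> t (inv g \<otimes> x)\<bar> \<le> \<bar>\<delta> * real (len x) - \<delta> * real (len (inv g \<otimes> x))\<bar>"
    unfolding cap_def by linarith
  also have "\<dots> = \<delta> * \<bar>real (len (inv g \<otimes> x)) - real (len x)\<bar>"
    using assms by (simp add: right_diff_distrib[symmetric] abs_mult abs_minus_commute)
  also have "\<dots> \<le> \<delta> * real (len g)" using assms len_mult_left_diff[OF gx] by (intro mult_left_mono) auto
  finally show "\<bar>cap \<delta> t x - cap \<delta> t (inv g \<otimes> x)\<bar> \<le> \<delta> * real (len g)" .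
qed

abbreviation linweight :: "real \<Rightarrow> 'a \<Rightarrow> real" where
  "linweight \<delta> x \<equiv> \<delta> * real (len x)"

text \<open>On a finite set the truncation is inactive once t exceeds all weights there, so a bound
  uniform in t holds for every finite partial sum.\<close>

lemma uncap:
  assumes a: "set_pmf a \<subseteq> carrier G" and \<delta>: "0 \<le> \<delta>"
    and le: "\<And>t. 0 \<le> t \<Longrightarrow> (l2 (weighted (cap \<delta> t) a))\<^sup>2 \<le> M"
  shows "square_summable (weighted (linweight \<delta>) a)" "(l2 (weighted (linweight \<delta>) a))\<^sup>2 \<le> M"
proof -
  have fin: "(\<Sum>x\<in>F. (weighted (linweight \<delta>) a x)\<^sup>2) \<le> M" if F: "finite F" "F \<subseteq> carrier G" for F
  proof -
    define t where "t = (\<Sum>x\<in>F. \<delta> * real (len x))"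
    have t: "0 \<le> t" using \<delta> by (simp add: t_def sum_nonneg)
    have "\<delta> * real (len x) \<le> t" if "x \<in> F" for x
      unfolding t_def using that F \<delta> by (intro member_le_sum) auto
    then have "(\<Sum>x\<in>F. (weighted (linweight \<delta>) a x)\<^sup>2) = (\<Sum>x\<in>F. (weighted (cap \<delta> t) a x)\<^sup>2)"
      by (intro sum.cong) (auto simp: weighted_def cap_def)
    also have "\<dots> \<le> (l2 (weighted (cap \<delta> t) a))\<^sup>2"
      unfolding l2norm_sq by (intro finite_sum_le_infsum F weighted_summable(2)[OF a cap_bound[OF \<delta> t]]) auto
    also have "\<dots> \<le> M" by (rule le[OF t])
    finally show ?thesis .
  qed
  show s: "square_summable (weighted (linweight \<delta>) a)"
    using fin by (intro nonneg_bdd_above_summable_on) (auto intro!: bdd_aboveI2)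
  show "(l2 (weighted (linweight \<delta>) a))\<^sup>2 \<le> M"
    unfolding l2norm_sq by (rule infsum_le_finite_sums[OF s fin])
qed

text \<open>Cauchy-Schwarz twice: against exp(-\<delta>|x|/2), to pass from l2 at weight \<delta> to
  l1 at weight \<delta>/2, then against the total mass 1, to reach weight \<delta>/4. The second use
  produces the square on the left that makes the multiscale recursion close; the quarter matches the
  ratio of consecutive weights.\<close>

lemma l1_weight_le:
  assumes a: "set_pmf a \<subseteq> carrier G" and \<delta>: "0 \<le> \<delta>"
    and s: "square_summable (weighted (linweight \<delta>) a)"
    and e: "decay \<delta> summable_on carrier G"
  shows "weighted (linweight (\<delta> / 4)) a summable_on carrier G"
    and "(infsum (weighted (linweight (\<delta> / 4)) a) (carrier G))\<^sup>2 \<le>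
      l2 (weighted (linweight \<delta>) a) * sqrt (infsum (decay \<delta>) (carrier G))"
proof -
  let ?h = "\<lambda>x. exp (- (\<delta> * real (len x) / 2))"
  have h2: "(?h x)\<^sup>2 = exp (- (\<delta> * real (len x)))" for x
    by (simp add: power2_eq_square flip: exp_add)
  have hs: "square_summable ?h" unfolding h2 by (rule e)
  have eq: "weighted (linweight \<delta>) a x * ?h x = weighted (linweight (\<delta> / 2)) a x" for x
  proof -
    have "exp (\<delta> * real (len x)) * exp (- (\<delta> * real (len x) / 2)) = exp (\<delta> / 2 * real (len x))"
      by (simp add: field_simps flip: exp_add)
    then show ?thesis by (simp add: weighted_def mult_ac)
  qed
  have s2: "weighted (linweight (\<delta> / 2)) a summable_on carrier G"
    using l2_mult_summable[OF s hs] unfolding eq .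
  have i2: "infsum (weighted (linweight (\<delta> / 2)) a) (carrier G) \<le>
      l2 (weighted (linweight \<delta>) a) * sqrt (infsum (decay \<delta>) (carrier G))"
    using l2_inner_le[OF s hs] unfolding eq l2norm_def[of _ ?h] h2 by linarith
  let ?u = "\<lambda>x. sqrt (weighted (linweight (\<delta> / 2)) a x)" and ?w = "\<lambda>x. sqrt (pmf a x)"
  have us: "square_summable ?u" using s2 by simp
  have ws: "square_summable ?w" using summable_pmf[OF a] by simp
  have uw: "?u x * ?w x = weighted (linweight (\<delta> / 4)) a x" for x
  proof -
    have "exp (\<delta> / 2 * real (len x)) = (exp (\<delta> / 4 * real (len x)))\<^sup>2"
      by (simp add: power2_eq_square flip: exp_add)
    then have "weighted (linweight (\<delta> / 2)) a x * pmf a x = (weighted (linweight (\<delta> / 4)) a x)\<^sup>2"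
      by (simp add: weighted_def power2_eq_square mult_ac)
    then show ?thesis by (simp flip: real_sqrt_mult)
  qed
  show s4: "weighted (linweight (\<delta> / 4)) a summable_on carrier G"
    using l2_mult_summable[OF us ws] unfolding uw .
  have "infsum (weighted (linweight (\<delta> / 4)) a) (carrier G) \<le> l2 ?u * l2 ?w"
    using l2_inner_le[OF us ws] unfolding uw by linarith
  moreover have "l2 ?w = 1" by (simp add: l2norm_def infsum_pmf[OF a])
  ultimately have "infsum (weighted (linweight (\<delta> / 4)) a) (carrier G) \<le> l2 ?u" by simp
  then have "(infsum (weighted (linweight (\<delta> / 4)) a) (carrier G))\<^sup>2 \<le> (l2 ?u)\<^sup>2"
    by (intro power_mono infsum_nonneg) auto
  also have "(l2 ?u)\<^sup>2 = infsum (weighted (linweight (\<delta> / 2)) a) (carrier G)" by (simp add: l2norm_sq)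
  finally show "(infsum (weighted (linweight (\<delta> / 4)) a) (carrier G))\<^sup>2 \<le>
      l2 (weighted (linweight \<delta>) a) * sqrt (infsum (decay \<delta>) (carrier G))"
    using i2 by linarith
qed

section \<open>Iterated resolvents along the scales\<close>

text \<open>Isolates the laws reachable by finitely many resolvents from the point mass, so that
  commutation, finite mean length and the mean value property are plain inductions.\<close>

inductive walk_law :: "'a pmf \<Rightarrow> bool" where
  walk_law_one: "walk_law (return_pmf \<one>)"
| walk_law_resolvent: "walk_law v \<Longrightarrow> 0 < p \<Longrightarrow> p \<le> 1 / 2 \<Longrightarrow> walk_law (resolvent p v)"

lemma walk_law_commuting: "walk_law v \<Longrightarrow> commuting v"
  by (induction rule: walk_law.induct) (auto intro: commuting_one commuting_resolvent)

lemma weighted_return_one: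
  "square_summable (weighted (linweight \<delta>) (return_pmf \<one>))" "(l2 (weighted (linweight \<delta>) (return_pmf \<one>)))\<^sup>2 = 1"
proof -
  have "((\<lambda>x. (weighted (linweight \<delta>) (return_pmf \<one>) x)\<^sup>2) has_sum 1) (carrier G)"
    by (rule has_sum_finite_neutralI[of "{\<one>}"]) (auto simp: weighted_def)
  then show "square_summable (weighted (linweight \<delta>) (return_pmf \<one>))" "(l2 (weighted (linweight \<delta>) (return_pmf \<one>)))\<^sup>2 = 1"
    unfolding l2norm_sq by (auto intro: has_sum_imp_summable infsumI)
qed

text \<open>The spatial scale is R = 4^J and the weight has rate c/R; since 16^J = R^2, the energy
  bound is better than the mass bound by the factor R^2.\<close>

abbreviation good_kernel :: "real \<Rightarrow> real \<Rightarrow> nat \<Rightarrow> 'a pmf \<Rightarrow> bool" where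
  "good_kernel c C J h \<equiv> walk_law h \<and>
     decay (c / 4 ^ J) summable_on carrier G \<and>
     infsum (decay (c / 4 ^ J)) (carrier G) \<le> C * vol J \<and>
     (\<forall>t\<ge>0. energy (weighted (cap (c / 4 ^ J) t) h) \<le> C / (16 ^ J * vol J) \<and>
        (l2 (weighted (cap (c / 4 ^ J) t) h))\<^sup>2 \<le> C / vol J)"

text \<open>At weight \<delta> j the parameter p j is the smallest that the resolvent step admits.
  The sequence v does not depend on J; only its analysis does, through comparison of all volumes
  with the volume at the good scale J.\<close>

lemma kernel_estimate:
  "\<exists>c C. 0 < c \<and> 0 < C \<and> (\<forall>N. \<exists>J\<ge>N. \<exists>h. good_kernel c C J h)"
proof -
  obtain A where A: "1 \<le> A" and scales: "\<forall>N. \<exists>J\<ge>N. (\<forall>k\<ge>J. vol k \<le> vol J * A ^ (k - J)) \<and> (\<forall>k\<le>J. vol J \<le> vol k * A ^ (J - k))"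
    using good_volume_scales by (elim exE conjE)
  obtain K where K: "1 \<le> K" and step: "\<forall>p \<delta> \<psi> B v. 0 < p \<longrightarrow> p \<le> 1 / 2 \<longrightarrow> 0 \<le> \<delta> \<longrightarrow> \<delta> \<le> \<delta>\<^sub>0 \<longrightarrow> K * \<delta>\<^sup>2 \<le> p \<longrightarrow> commuting v \<longrightarrow>
     (\<forall>x\<in>carrier G. \<bar>\<psi> x\<bar> \<le> B) \<longrightarrow>
     left_lipschitz \<psi> \<delta> \<longrightarrow>
     resolvent_bounds K p \<psi> v"
    using resolvent_step by (elim exE conjE)
  \<comment> \<open>The last entry gives (K c)^2 \<le> 1/(4 A^2), so that the part carried over from
    the previous scale is at most a quarter of the new bound.\<close>
  define c where "c = min (min 1 \<delta>\<^sub>0) (1 / (2 * K * A))"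
  have c: "0 < c" "c \<le> 1" "c \<le> \<delta>\<^sub>0" "c \<le> 1 / (2 * K * A)"
    using \<delta>\<^sub>0_pos K A by (auto simp: c_def)
  obtain Z where Z: "0 < Z" and volZ: "\<forall>J. (\<forall>k\<ge>J. vol k \<le> vol J * A ^ (k - J)) \<longrightarrow>
    decay (c / 4 ^ J) summable_on carrier G \<and>
    infsum (decay (c / 4 ^ J)) (carrier G) \<le> Z * vol J"
    using exponential_volume[OF A c(1,2)] by (elim exE conjE)
  define \<delta> where "\<delta> j = c / 4 ^ j" for j :: nat
  define p where "p j = K * (\<delta> j)\<^sup>2" for j
  define v where "v = rec_nat (return_pmf \<one>) (\<lambda>j a. resolvent (p (Suc j)) a)"
  have v0: "v 0 = return_pmf \<one>" and vS: "v (Suc j) = resolvent (p (Suc j)) (v j)" for j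
    by (simp_all add: v_def)
  have \<delta>: "0 < \<delta> j" "\<delta> j \<le> \<delta>\<^sub>0" "\<delta> j \<le> c" "\<delta> (Suc j) = \<delta> j / 4" for j
  proof -
    have "c / 4 ^ j \<le> c / 1" using c by (intro divide_left_mono) auto
    then show "\<delta> j \<le> c" by (simp add: \<delta>_def)
    then show "\<delta> j \<le> \<delta>\<^sub>0" using c by simp
  qed (use c in \<open>auto simp: \<delta>_def\<close>)
  have \<eta>: "(K * c)\<^sup>2 \<le> 1 / (4 * A\<^sup>2)"
  proof -
    have "K * c \<le> 1 / (2 * A)" using c K A by (simp add: field_simps)
    then have "(K * c)\<^sup>2 \<le> (1 / (2 * A))\<^sup>2" using K c by (intro power_mono) auto
    then show ?thesis by (simp add: power2_eq_square)
  qed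
  have p: "0 < p j" "p j \<le> 1 / 2" for j
  proof -
    show "0 < p j" using K \<delta>(1)[of j] by (simp add: p_def)
    have "p j \<le> K * c\<^sup>2" unfolding p_def using K \<delta>(1,3)[of j] by (intro mult_left_mono power_mono) auto
    also have "\<dots> \<le> K * (K * c\<^sup>2)" using K mult_right_mono[of 1 K "K * c\<^sup>2"] by simp
    also have "\<dots> = (K * c)\<^sup>2" by (simp add: power2_eq_square)
    also have "\<dots> \<le> 1 / 2"
    proof -
      have "1 \<le> A\<^sup>2" using A by simp
      then have "1 / (4 * A\<^sup>2) \<le> 1 / 2" by (intro frac_le) auto
      then show ?thesis using \<eta> by linarith
    qed
    finally show "p j \<le> 1 / 2" .
  qed
  have law: "walk_law (v j)" for j
    by (induction j) (auto simp: v0 vS intro: walk_law_one walk_law_resolvent p)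
  note comm = walk_law_commuting[OF law]
  have vset: "set_pmf (v j) \<subseteq> carrier G" for j by (rule commuting_set[OF comm])
  \<comment> \<open>\<open>vol 0\<close> starts the induction at the point mass; 64 A^2 Z is what
    the inequality 8 A sqrt(B Z) \<le> B in the inductive step asks for.\<close>
  define B where "B = vol 0 + 64 * A\<^sup>2 * Z"
  have B: "vol 0 \<le> B" "64 * A\<^sup>2 * Z \<le> B" "0 < B"
    using Z A vol_ge_1[of 0] by (auto simp: B_def add_pos_nonneg)
  define C where "C = (K * c)\<^sup>2 * B + 4 * B + Z"
  have C: "0 < C" "(K * c)\<^sup>2 * B \<le> C" "4 * B \<le> C" "Z \<le> C" using B Z by (auto simp: C_def add_nonneg_pos)
  have "\<exists>J\<ge>N. \<exists>h. good_kernel c C J h" for N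
  proof -
    obtain J where J: "J \<ge> N" and up: "\<forall>k\<ge>J. vol k \<le> vol J * A ^ (k - J)"
      and low: "\<And>k. k \<le> J \<Longrightarrow> vol J \<le> vol k * A ^ (J - k)"
      using scales by blast
    have volpos: "0 < vol j" for j using vol_ge_1[of j] by linarith
    have expJ: "decay (\<delta> J) summable_on carrier G"
      "infsum (decay (\<delta> J)) (carrier G) \<le> Z * vol J"
      using volZ up unfolding \<delta>_def by blast+
    have \<delta>mono: "\<delta> J \<le> \<delta> j" if "j \<le> J" for j
      unfolding \<delta>_def using that c by (intro divide_left_mono power_increasing) auto
    \<comment> \<open>Coarser than a bound by the volume at scale j, but the factor
      \<open>vol J\<close> cancels against the normalisation of the l2 norms below.\<close>
    have expj: "decay (\<delta> j) summable_on carrier G"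
      "infsum (decay (\<delta> j)) (carrier G) \<le> Z * vol J" if j: "j \<le> J" for j
    proof -
      have le: "exp (- (\<delta> j * real (len x))) \<le> exp (- (\<delta> J * real (len x)))" for x
        using \<delta>mono[OF j] by (simp add: mult_right_mono)
      show s: "decay (\<delta> j) summable_on carrier G"
        by (rule summable_on_abs_boundI[OF expJ(1)]) (use le in simp)
      show "infsum (decay (\<delta> j)) (carrier G) \<le> Z * vol J"
        using infsum_mono[OF s expJ(1) le] expJ(2) by linarith
    qed
    \<comment> \<open>Why A^2 per remaining scale: with i scales left after the step, the root of
      \<open>m j\<close> contributes A^(i+1) and the volume comparison A^i, so the power (A^2)^i
      reproduces itself up to one factor A, absorbed by B.\<close>
    define m where "m j = B * (A\<^sup>2) ^ (J - j)" for j
    have m0: "0 \<le> m j" for j using B by (simp add: m_def)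
    have capW: "square_summable (weighted (cap \<delta>' t) a)"
      "l2 (weighted (cap \<delta>' t) a) \<le> l2 (weighted (linweight \<delta>'') a)"
      if "square_summable (weighted (linweight \<delta>'') a)" "0 \<le> \<delta>'" "\<delta>' \<le> \<delta>''" for \<delta>' \<delta>'' t a
    proof -
      have "cap \<delta>' t x \<le> \<delta>'' * real (len x)" for x
        using that mult_right_mono[OF that(3), of "real (len x)"] by (simp add: cap_def)
      then have "\<bar>weighted (cap \<delta>' t) a x\<bar> \<le> \<bar>weighted (linweight \<delta>'') a x\<bar>" for x
        by (simp add: weighted_def mult_right_mono)
      then show "square_summable (weighted (cap \<delta>' t) a)"
        "l2 (weighted (cap \<delta>' t) a) \<le> l2 (weighted (linweight \<delta>'') a)"
        using l2norm_mono[OF that(1)] by blast+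
    qed
    have main: "square_summable (weighted (linweight (\<delta> j)) (v j)) \<and>
        (l2 (weighted (linweight (\<delta> j)) (v j)))\<^sup>2 \<le> m j / vol J" if "j \<le> J" for j
      using that
    proof (induction j)
      case 0
      have "vol J \<le> vol 0 * A ^ J" using low[of 0] by simp
      also have "\<dots> \<le> B * (A\<^sup>2) ^ J"
        using B A by (intro mult_mono power_mono) (auto simp: self_le_power)
      finally have "1 \<le> m 0 / vol J" using volpos[of J] by (simp add: m_def)
      then show ?case using weighted_return_one by (simp add: v0)
    next
      case (Suc j)
      then have IH: "square_summable (weighted (linweight (\<delta> j)) (v j))"
        "(l2 (weighted (linweight (\<delta> j)) (v j)))\<^sup>2 \<le> m j / vol J" and j: "j \<le> J" "Suc j \<le> J" by auto
      define \<delta>' where "\<delta>' = \<delta> (Suc j)"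
      have \<delta>': "0 \<le> \<delta>'" "\<delta>' = \<delta> j / 4" "\<delta>' \<le> \<delta> j" "\<delta>' \<le> \<delta>\<^sub>0"
        using \<delta>(1)[of j] \<delta>(1,2)[of "Suc j"] \<delta>(4)[of j] by (auto simp: \<delta>'_def)
      have bound: "(l2 (weighted (cap \<delta>' t) (v (Suc j))))\<^sup>2 \<le> m (Suc j) / vol J" if t: "0 \<le> t" for t
      proof -
        define W where "W = weighted (cap \<delta>' t) (v j)"
        \<comment> \<open>The radius 4^(j+1) is matched to the parameter, so the product is free of
          j.\<close>
        have Kp: "K * p (Suc j) * (real (4 ^ Suc j))\<^sup>2 = (K * c)\<^sup>2"
          by (simp add: p_def \<delta>_def power2_eq_square)
        have Kp': "K * \<delta>'\<^sup>2 \<le> p (Suc j)" by (simp add: p_def \<delta>'_def)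
        have "(l2 (weighted (cap \<delta>' t) (v (Suc j))))\<^sup>2 \<le>
            4 * (infsum W (carrier G))\<^sup>2 / real (card (word_ball G S (4 ^ Suc j)))
            + K * p (Suc j) * (real (4 ^ Suc j))\<^sup>2 * (l2 W)\<^sup>2"
          unfolding vS W_def
          using step[rule_format, OF p(1)[of "Suc j"] p(2)[of "Suc j"] \<delta>'(1,4) Kp' comm[of j],
            of "cap \<delta>' t" t] cap_bound[OF \<delta>'(1) t] cap_lipschitz[OF \<delta>'(1), of t] by blast
        then have N: "(l2 (weighted (cap \<delta>' t) (v (Suc j))))\<^sup>2 \<le>
            4 * (infsum W (carrier G))\<^sup>2 / vol (Suc j) + (K * c)\<^sup>2 * (l2 W)\<^sup>2"
          unfolding Kp vol_def[symmetric] .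
        have "l2 W \<le> l2 (weighted (linweight (\<delta> j)) (v j))"
          unfolding W_def by (rule capW(2)[OF IH(1) \<delta>'(1,3)])
        then have "(l2 W)\<^sup>2 \<le> (l2 (weighted (linweight (\<delta> j)) (v j)))\<^sup>2" by (intro power_mono) auto
        with IH(2) have l2W: "(l2 W)\<^sup>2 \<le> m j / vol J" by linarith
        have \<delta>j: "0 \<le> \<delta> j" using \<delta>(1)[of j] by simp
        note l1 = l1_weight_le[OF vset \<delta>j IH(1) expj(1)[OF j(1)]]
        have "infsum W (carrier G) \<le> infsum (weighted (linweight (\<delta> j / 4)) (v j)) (carrier G)"
          unfolding W_def
        proof (intro infsum_mono l1(1) weighted_summable(1)[OF vset cap_bound[OF \<delta>'(1) t]])
          fix x show "weighted (cap \<delta>' t) (v j) x \<le> weighted (linweight (\<delta> j / 4)) (v j) x"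
            by (simp add: weighted_def cap_def \<delta>'(2) mult_right_mono)
        qed
        then have "(infsum W (carrier G))\<^sup>2 \<le> (infsum (weighted (linweight (\<delta> j / 4)) (v j)) (carrier G))\<^sup>2"
          by (intro power_mono infsum_nonneg) (auto simp: W_def)
        also have "\<dots> \<le> l2 (weighted (linweight (\<delta> j)) (v j)) * sqrt (infsum (decay (\<delta> j)) (carrier G))"
          by (rule l1(2))
        also have "\<dots> \<le> sqrt (m j / vol J) * sqrt (Z * vol J)"
          using IH(2) expj(2)[OF j(1)] m0[of j] volpos[of J]
          by (intro mult_mono real_sqrt_le_mono real_le_rsqrt) (auto intro: infsum_nonneg)
        also have "\<dots> = sqrt (m j * Z)"
          using volpos[of J] by (simp flip: real_sqrt_mult)
        finally have l1W: "(infsum W (carrier G))\<^sup>2 \<le> sqrt (m j * Z)" .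
        define i where "i = J - Suc j"
        have Ji: "J - j = Suc i" using j by (simp add: i_def)
        have Apos: "0 < A" using A by simp
        have "sqrt (m j * Z) = sqrt (B * Z) * A ^ Suc i"
        proof -
          have "m j * Z = (B * Z) * (A ^ Suc i)\<^sup>2" by (simp add: m_def Ji power_mult[symmetric] mult.commute[of 2] power2_eq_square power_mult_distrib)
          then show ?thesis using Apos by (simp only: real_sqrt_mult real_sqrt_abs) simp
        qed
        moreover have "8 * A * sqrt (B * Z) \<le> B"
        proof (rule power2_le_imp_le)
          have "(8 * A * sqrt (B * Z))\<^sup>2 = (64 * A\<^sup>2 * Z) * B"
            using B Z by (simp add: power_mult_distrib)
          also have "\<dots> \<le> B * B" using B by (intro mult_right_mono) auto
          finally show "(8 * A * sqrt (B * Z))\<^sup>2 \<le> B\<^sup>2" by (simp add: power2_eq_square)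
        qed (use B in simp)
        then have "4 * A * sqrt (B * Z) * (A\<^sup>2) ^ i \<le> B / 2 * (A\<^sup>2) ^ i" by (intro mult_right_mono) auto
        ultimately have a1: "4 * sqrt (m j * Z) * A ^ i \<le> B / 2 * (A\<^sup>2) ^ i"
          by (simp add: power_mult_distrib power2_eq_square mult_ac)
        have "4 * (infsum W (carrier G))\<^sup>2 / vol (Suc j) \<le> 4 * sqrt (m j * Z) / vol (Suc j)"
          using l1W volpos[of "Suc j"] by (intro divide_right_mono) auto
        also have "\<dots> \<le> 4 * sqrt (m j * Z) * (A ^ i / vol J)"
        proof -
          have "1 / vol (Suc j) \<le> A ^ i / vol J"
            using low[OF j(2)] volpos[of J] volpos[of "Suc j"] by (simp add: i_def field_simps)
          from mult_left_mono[OF this, of "4 * sqrt (m j * Z)"] show ?thesis using m0[of j] Z by simp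
        qed
        also have "\<dots> \<le> B / 2 * (A\<^sup>2) ^ i / vol J"
          using divide_right_mono[OF a1, of "vol J"] volpos[of J] by simp
        finally have t1: "4 * (infsum W (carrier G))\<^sup>2 / vol (Suc j) \<le> B / 2 * (A\<^sup>2) ^ i / vol J" .
        have "(K * c)\<^sup>2 * (l2 W)\<^sup>2 \<le> 1 / (4 * A\<^sup>2) * (m j / vol J)"
          by (intro mult_mono \<eta> l2W) auto
        also have "\<dots> = B / 4 * (A\<^sup>2) ^ i / vol J" using Apos by (simp add: m_def Ji)
        also have "\<dots> \<le> B / 2 * (A\<^sup>2) ^ i / vol J"
          using B volpos[of J] by (intro divide_right_mono mult_right_mono) auto
        finally have "(l2 (weighted (cap \<delta>' t) (v (Suc j))))\<^sup>2 \<le> B / 2 * (A\<^sup>2) ^ i / vol J + B / 2 * (A\<^sup>2) ^ i / vol J"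
          using N t1 by linarith
        also have "\<dots> = m (Suc j) / vol J" by (simp add: m_def i_def)
        finally show ?thesis .
      qed
      show ?case using uncap[OF vset[of "Suc j"] \<delta>'(1) bound] by (simp add: \<delta>'_def)
    qed
    \<comment> \<open>The induction controls l2 norms only; one more resolvent at scale J yields the
      energy bound with its factor p J, of order 16^(-J).\<close>
    define h where "h = resolvent (p J) (v J)"
    have hl: "walk_law h" unfolding h_def by (intro walk_law_resolvent law p)
    have vJ: "square_summable (weighted (linweight (\<delta> J)) (v J))" "(l2 (weighted (linweight (\<delta> J)) (v J)))\<^sup>2 \<le> B / vol J"
      using main[of J] by (auto simp: m_def)
    have \<delta>J: "0 \<le> \<delta> J" "\<delta> J \<le> \<delta>\<^sub>0" "K * (\<delta> J)\<^sup>2 \<le> p J" using \<delta>[of J] by (auto simp: p_def)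
    have "energy (weighted (cap (\<delta> J) t) h) \<le> C / (16 ^ J * vol J) \<and>
        (l2 (weighted (cap (\<delta> J) t) h))\<^sup>2 \<le> C / vol J" if t: "0 \<le> t" for t
    proof -
      let ?W = "weighted (cap (\<delta> J) t) (v J)"
      have "l2 ?W \<le> l2 (weighted (linweight (\<delta> J)) (v J))" by (rule capW(2)[OF vJ(1) \<delta>J(1) order_refl])
      then have "(l2 ?W)\<^sup>2 \<le> (l2 (weighted (linweight (\<delta> J)) (v J)))\<^sup>2" by (intro power_mono) auto
      with vJ(2) have W: "(l2 ?W)\<^sup>2 \<le> B / vol J" by linarith
      have st: "energy (weighted (cap (\<delta> J) t) h) \<le> K * p J * (l2 ?W)\<^sup>2 \<and>
          (l2 (weighted (cap (\<delta> J) t) h))\<^sup>2 \<le> 4 * (l2 ?W)\<^sup>2"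
        unfolding h_def using step[rule_format, OF p(1)[of J] p(2)[of J] \<delta>J comm[of J], of "cap (\<delta> J) t" t]
          cap_bound[OF \<delta>J(1) t] cap_lipschitz[OF \<delta>J(1), of t] by blast
      have "K * p J * (l2 ?W)\<^sup>2 \<le> K * p J * (B / vol J)" using K p(1)[of J] by (intro mult_left_mono W) auto
      also have "\<dots> = (K * c)\<^sup>2 * B / (16 ^ J * vol J)"
      proof -
        have "(4 ^ J)\<^sup>2 = (16 ^ J :: real)" by (simp add: power_mult[symmetric] power_mult_distrib power2_eq_square flip: power_mult_distrib)
        then show ?thesis by (simp add: p_def \<delta>_def power_divide power2_eq_square[of K] power_mult_distrib)
      qed
      also have "\<dots> \<le> C / (16 ^ J * vol J)" using C volpos[of J] by (intro divide_right_mono) auto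
      finally have "energy (weighted (cap (\<delta> J) t) h) \<le> C / (16 ^ J * vol J)" using st by linarith
      moreover have "4 * (l2 ?W)\<^sup>2 \<le> C / vol J"
      proof -
        have "4 * (l2 ?W)\<^sup>2 \<le> 4 * B / vol J" using W by simp
        also have "\<dots> \<le> C / vol J" using C volpos[of J] by (intro divide_right_mono) auto
        finally show ?thesis .
      qed
      ultimately show ?thesis using st by linarith
    qed
    moreover have "infsum (decay (\<delta> J)) (carrier G) \<le> C * vol J"
      using expJ(2) mult_right_mono[OF C(4), of "vol J"] volpos[of J] by linarith
    ultimately show ?thesis using J hl expJ(1) unfolding \<delta>_def by blast
  qed
  then show ?thesis using c(1) C(1) by blast
qed

end

section \<open>Harmonic functions of linear growth\<close>

context centered_walk_poly
begin

text \<open>Extended values allow computing with mixtures before finiteness is known.\<close>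

definition mean_length :: "'a pmf \<Rightarrow> ennreal" where
  "mean_length v = (\<integral>\<^sup>+x. ennreal (real (len x)) \<partial>measure_pmf v)"

lemma mean_length_conv:
  assumes a: "set_pmf a \<subseteq> carrier G" and b: "set_pmf b \<subseteq> carrier G"
  shows "mean_length (conv a b) \<le> mean_length a + mean_length b"
proof -
  have "mean_length (conv a b) = (\<integral>\<^sup>+g. \<integral>\<^sup>+x. ennreal (real (len (g \<otimes> x))) \<partial>measure_pmf b \<partial>measure_pmf a)"
    by (simp add: mean_length_def conv_def)
  also have "\<dots> \<le> (\<integral>\<^sup>+g. \<integral>\<^sup>+x. ennreal (real (len g)) + ennreal (real (len x)) \<partial>measure_pmf b \<partial>measure_pmf a)"
  proof (intro nn_integral_mono_AE, unfold AE_measure_pmf_iff, intro ballI nn_integral_mono_AE, unfold AE_measure_pmf_iff, intro ballI)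
    fix g x assume "g \<in> set_pmf a" "x \<in> set_pmf b"
    then have "len (g \<otimes> x) \<le> len g + len x" using a b by (intro len_mult) auto
    then have "ennreal (real (len (g \<otimes> x))) \<le> ennreal (real (len g) + real (len x))"
      by (intro ennreal_leI) linarith
    also have "\<dots> = ennreal (real (len g)) + ennreal (real (len x))" by (rule ennreal_plus) auto
    finally show "ennreal (real (len (g \<otimes> x))) \<le> ennreal (real (len g)) + ennreal (real (len x))" .
  qed
  also have "\<dots> = mean_length a + mean_length b"
    by (simp add: nn_integral_add mean_length_def measure_pmf.emeasure_space_1)
  finally show ?thesis .
qed

lemma mean_length_\<mu>: "mean_length \<mu> < \<infinity>"
proof -
  have "(\<lambda>g. pmf \<mu> g * real (len g)) summable_on carrier G"
    using moment_weight_ge(2) by (intro moment_dominates(1)[where c = 1]) auto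
  then have "integrable (measure_pmf \<mu>) (\<lambda>g. real (len g))"
    by (intro integrable_measure_pmfI[OF supp]) simp
  then show ?thesis
    unfolding mean_length_def integrable_iff_bounded by simp
qed

text \<open>n further steps add at most n times the mean length of \<mu>, and a geometric time has
  finite mean.\<close>

lemma mean_length_walk_law: "walk_law v \<Longrightarrow> mean_length v < \<infinity>"
proof (induction rule: walk_law.induct)
  case walk_law_one
  show ?case by (simp add: mean_length_def)
next
  case (walk_law_resolvent v p)
  have v: "commuting v" by (rule walk_law_commuting) fact
  have pw: "mean_length ((conv \<mu> ^^ n) v) \<le> ennreal (real n) * mean_length \<mu> + mean_length v" for n
  proof (induction n)
    case (Suc n)
    have "mean_length ((conv \<mu> ^^ Suc n) v) \<le> mean_length \<mu> + mean_length ((conv \<mu> ^^ n) v)"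
      using mean_length_conv[OF supp commuting_set[OF commuting_power[OF v, of n]]] by simp
    also have "\<dots> \<le> mean_length \<mu> + (ennreal (real n) * mean_length \<mu> + mean_length v)"
      by (intro add_left_mono Suc)
    also have "\<dots> = ennreal (real (Suc n)) * mean_length \<mu> + mean_length v"
    proof -
      have "ennreal (real (Suc n)) = ennreal 1 + ennreal (real n)"
        unfolding of_nat_Suc by (rule ennreal_plus) auto
      then show ?thesis by (simp add: distrib_right add.assoc)
    qed
    finally show ?case .
  qed simp
  have "mean_length (resolvent p v) = (\<integral>\<^sup>+n. mean_length ((conv \<mu> ^^ n) v) \<partial>measure_pmf (geometric_pmf p))"
    by (simp add: mean_length_def resolvent_def)
  also have "\<dots> \<le> (\<integral>\<^sup>+n. ennreal (real n) * mean_length \<mu> + mean_length v \<partial>measure_pmf (geometric_pmf p))"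
    by (intro nn_integral_mono pw)
  also have "\<dots> = (\<integral>\<^sup>+n. ennreal (real n) \<partial>measure_pmf (geometric_pmf p)) * mean_length \<mu> + mean_length v"
    by (simp add: nn_integral_add nn_integral_multc measure_pmf.emeasure_space_1)
  also have "\<dots> < \<infinity>"
  proof -
    have "integrable (geometric_pmf p) real"
      using walk_law_resolvent by (intro integrable_real_geometric_pmf) auto
    then have "(\<integral>\<^sup>+n. ennreal (real n) \<partial>measure_pmf (geometric_pmf p)) < \<infinity>"
      unfolding integrable_iff_bounded by simp
    then show ?thesis using mean_length_\<mu> walk_law_resolvent.IH by (simp add: ennreal_mult_less_top)
  qed
  finally show ?case .
qed

lemma summable_linear_growth:
  fixes f :: "'a \<Rightarrow> complex"
  assumes a: "set_pmf a \<subseteq> carrier G" "mean_length a < \<infinity>"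
    and f: "\<And>x. x \<in> carrier G \<Longrightarrow> norm (f x) \<le> L * (1 + real (len x))"
  shows "(\<lambda>x. norm (of_real (pmf a x) * f x)) summable_on carrier G"
    "(\<lambda>x. of_real (pmf a x) * f x) summable_on carrier G"
proof -
  have "integrable (measure_pmf a) (\<lambda>x. real (len x))"
    using a(2) by (simp add: integrable_iff_bounded mean_length_def)
  from has_sum_expectation_pmf[OF this a(1)]
  have "(\<lambda>x. pmf a x * real (len x)) summable_on carrier G" by (auto dest: has_sum_imp_summable)
  then have "(\<lambda>x. L * (pmf a x + pmf a x * real (len x))) summable_on carrier G"
    by (intro summable_on_cmult_right summable_on_add summable_pmf a(1))
  then show s: "(\<lambda>x. norm (of_real (pmf a x) * f x)) summable_on carrier G"
  proof (rule summable_on_abs_boundI)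
    fix x assume "x \<in> carrier G"
    from mult_left_mono[OF f[OF this] pmf_nonneg[of a x]]
    show "\<bar>norm (of_real (pmf a x) * f x)\<bar> \<le> L * (pmf a x + pmf a x * real (len x))"
      by (simp add: norm_mult algebra_simps)
  qed
  then show "(\<lambda>x. of_real (pmf a x) * f x) summable_on carrier G" by (rule abs_summable_summable)
qed

section \<open>Mean value property\<close>

text \<open>Exchange of sums, absolutely convergent since f grows linearly and both laws have finite
  mean length. With \<mu> on the right the inner sum is the harmonicity relation at g.\<close>

lemma harmonic_conv:
  fixes f :: "'a \<Rightarrow> complex"
  assumes h: "set_pmf h \<subseteq> carrier G" "mean_length h < \<infinity>"
    and f: "\<And>x. x \<in> carrier G \<Longrightarrow> norm (f x) \<le> L * (1 + real (len x))" and harm: "harmonic G \<mu> f"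
  shows "(\<Sum>\<^sub>\<infinity>x\<in>carrier G. of_real (pmf (conv h \<mu>) x) * f x) = (\<Sum>\<^sub>\<infinity>x\<in>carrier G. of_real (pmf h x) * f x)"
proof -
  let ?A = "\<lambda>g. \<Sum>\<^sub>\<infinity>y\<in>carrier G. norm (of_real (pmf \<mu> y) * f (g \<otimes> y))"
  define F where "F g x = of_real (pmf h g) * (of_real (pmf \<mu> (inv g \<otimes> x)) * f x)" for g x
  have L: "0 \<le> L" using f[of \<one>] by (metis len_one mult_1_right add_0_right of_nat_0 one_closed norm_ge_zero order_trans)
  have inner: "((\<lambda>x. norm (F g x)) has_sum (pmf h g * ?A g)) (carrier G)"
    if g: "g \<in> carrier G" for g
  proof -
    have "((\<lambda>y. norm (of_real (pmf \<mu> y) * f (g \<otimes> y))) has_sum ?A g) (carrier G)"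
      using harm g by (intro has_sum_infsum) (auto simp: harmonic_def)
    then have "((\<lambda>x. norm (of_real (pmf \<mu> (inv g \<otimes> x)) * f (g \<otimes> (inv g \<otimes> x)))) has_sum ?A g) (carrier G)"
      using has_sum_reindex_bij_betw[OF bij_translate[OF g], of "\<lambda>y. norm (of_real (pmf \<mu> y) * f (g \<otimes> y))"] by simp
    then have "((\<lambda>x. norm (of_real (pmf \<mu> (inv g \<otimes> x)) * f x)) has_sum ?A g) (carrier G)"
      by (rule has_sum_cong[THEN iffD1, rotated]) (use g in \<open>simp add: m_assoc[symmetric]\<close>)
    from has_sum_cmult_right[OF this, of "pmf h g"] show ?thesis by (simp add: F_def norm_mult)
  qed
  have mlen: "(\<lambda>y. pmf \<mu> y * real (len y)) summable_on carrier G"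
    using moment_weight_ge(2) by (intro moment_dominates(1)[where c = 1]) auto
  define m where "m = (\<Sum>\<^sub>\<infinity>y\<in>carrier G. pmf \<mu> y * real (len y))"
  have m: "0 \<le> m" unfolding m_def by (intro infsum_nonneg) simp
  have outer: "(\<lambda>g. pmf h g * ?A g) summable_on carrier G"
  proof (rule summable_on_abs_boundI)
    show "(\<lambda>g. norm (of_real (pmf h g) * (complex_of_real (L * (1 + real (len g) + m))))) summable_on carrier G"
    proof (rule summable_linear_growth(1)[OF h])
      fix x assume "x \<in> carrier G"
      have "L * (1 + real (len x) + m) \<le> L * ((1 + m) * (1 + real (len x)))"
        using L m by (intro mult_left_mono) (auto simp: algebra_simps)
      then show "norm (complex_of_real (L * (1 + real (len x) + m))) \<le> (L * (1 + m)) * (1 + real (len x))"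
        using L m unfolding norm_of_real by (simp add: mult.assoc)
    qed
    fix g assume g: "g \<in> carrier G"
    have "?A g \<le> L * (1 + real (len g)) * 1 + L * m"
    proof (rule has_sum_mono[OF has_sum_infsum has_sum_add[OF has_sum_cmult_right[OF has_sum_pmf[OF supp]] has_sum_cmult_right[OF has_sum_infsum[OF mlen]], folded m_def]])
      show "(\<lambda>y. norm (of_real (pmf \<mu> y) * f (g \<otimes> y))) summable_on carrier G"
        using harm g by (simp add: harmonic_def)
      fix y assume y: "y \<in> carrier G"
      have "norm (f (g \<otimes> y)) \<le> L * (1 + real (len (g \<otimes> y)))" using f g y by simp
      also have "\<dots> \<le> L * (1 + real (len g) + real (len y))"
        using L len_mult[OF g y] by (intro mult_left_mono) auto
      finally show "norm (of_real (pmf \<mu> y) * f (g \<otimes> y)) \<le> L * (1 + real (len g)) * pmf \<mu> y + L * (pmf \<mu> y * real (len y))"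
        using mult_left_mono[of "norm (f (g \<otimes> y))" "L * (1 + real (len g) + real (len y))" "pmf \<mu> y"]
        by (simp add: norm_mult algebra_simps)
    qed
    then have "?A g \<le> L * (1 + real (len g) + m)"
      by (simp add: algebra_simps)
    moreover have "0 \<le> ?A g" by (intro infsum_nonneg) simp
    ultimately show "\<bar>pmf h g * ?A g\<bar> \<le>
        norm (of_real (pmf h g) * (complex_of_real (L * (1 + real (len g) + m))))"
      using L m unfolding norm_mult norm_of_real by (simp add: abs_mult mult_left_mono)
  qed
  have "(\<lambda>z. norm (case z of (g, x) \<Rightarrow> F g x)) summable_on (carrier G \<times> carrier G)"
    by (rule summable_on_SigmaI[OF _ outer]) (use inner in auto)
  then have prod: "(\<lambda>(g, x). F g x) summable_on (carrier G \<times> carrier G)" by (rule abs_summable_summable)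
  have "(\<Sum>\<^sub>\<infinity>x\<in>carrier G. of_real (pmf (conv h \<mu>) x) * f x) = (\<Sum>\<^sub>\<infinity>x\<in>carrier G. \<Sum>\<^sub>\<infinity>g\<in>carrier G. F g x)"
  proof (intro infsum_cong)
    fix x assume x: "x \<in> carrier G"
    have "complex_of_real (pmf (conv h \<mu>) x) = (\<Sum>\<^sub>\<infinity>g\<in>carrier G. of_real (pmf h g * pmf \<mu> (inv g \<otimes> x)))"
    proof -
      have "(\<lambda>g. pmf \<mu> (inv g \<otimes> x) * pmf h g) summable_on carrier G"
        by (rule summable_on_bounded_mult[OF summable_pmf[OF h(1)], where B = 1]) (simp add: pmf_le_1)
      then have "((\<lambda>g. pmf h g * pmf \<mu> (inv g \<otimes> x)) has_sum pmf (conv h \<mu>) x) (carrier G)"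
        using pmf_conv[OF h(1) supp x] by (simp add: mult.commute has_sum_infsum)
      then show ?thesis by (intro infsumI[symmetric]) (simp only: has_sum_of_real_iff)
    qed
    then show "of_real (pmf (conv h \<mu>) x) * f x = (\<Sum>\<^sub>\<infinity>g\<in>carrier G. F g x)"
      by (simp add: F_def infsum_cmult_left'[symmetric] mult.assoc)
  qed
  also have "\<dots> = (\<Sum>\<^sub>\<infinity>g\<in>carrier G. \<Sum>\<^sub>\<infinity>x\<in>carrier G. F g x)"
    by (rule infsum_swap_banach[OF prod, symmetric])
  also have "\<dots> = (\<Sum>\<^sub>\<infinity>g\<in>carrier G. of_real (pmf h g) * f g)"
  proof (intro infsum_cong)
    fix g assume g: "g \<in> carrier G"
    have "(\<Sum>\<^sub>\<infinity>x\<in>carrier G. of_real (pmf \<mu> (inv g \<otimes> x)) * f x) =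
        (\<Sum>\<^sub>\<infinity>x\<in>carrier G. of_real (pmf \<mu> (inv g \<otimes> x)) * f (g \<otimes> (inv g \<otimes> x)))"
      using g by (intro infsum_cong) (simp add: m_assoc[symmetric])
    also have "\<dots> = (\<Sum>\<^sub>\<infinity>y\<in>carrier G. of_real (pmf \<mu> y) * f (g \<otimes> y))"
      by (rule infsum_translate[OF g, of "\<lambda>y. of_real (pmf \<mu> y) * f (g \<otimes> y)"])
    also have "\<dots> = f g" using harm g by (simp add: harmonic_def)
    finally show "(\<Sum>\<^sub>\<infinity>x\<in>carrier G. F g x) = of_real (pmf h g) * f g"
      by (simp add: F_def infsum_cmult_right')
  qed
  finally show ?thesis .
qed

text \<open>Pair the equation h = p v + (1 - p) h * \<mu> with f. The pairing with h * \<mu> equals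
  the one with h and is finite, so it cancels and leaves the pairing with v.\<close>

lemma harmonic_mean_value:
  fixes f :: "'a \<Rightarrow> complex"
  assumes "walk_law h"
    and f: "\<And>x. x \<in> carrier G \<Longrightarrow> norm (f x) \<le> L * (1 + real (len x))" and harm: "harmonic G \<mu> f"
  shows "(\<Sum>\<^sub>\<infinity>x\<in>carrier G. of_real (pmf h x) * f x) = f \<one>"
  using assms(1)
proof (induction rule: walk_law.induct)
  case walk_law_one
  have "((\<lambda>x. of_real (pmf (return_pmf \<one>) x) * f x) has_sum f \<one>) (carrier G)"
    by (rule has_sum_finite_neutralI[of "{\<one>}"]) auto
  then show ?case by (rule infsumI)
next
  case (walk_law_resolvent v p)
  define h where "h = resolvent p v"
  have law: "walk_law h" unfolding h_def by (intro walk_law.intros walk_law_resolvent)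
  note vs = commuting_set[OF walk_law_commuting[OF \<open>walk_law v\<close>]]
  have hc: "commuting h" by (rule walk_law_commuting[OF law])
  note hs = commuting_set[OF hc]
  have cs: "set_pmf (conv h \<mu>) \<subseteq> carrier G" by (rule set_conv[OF hs supp])
  have "mean_length (conv h \<mu>) \<le> mean_length h + mean_length \<mu>" by (rule mean_length_conv[OF hs supp])
  also have "\<dots> < \<infinity>" using mean_length_walk_law[OF law] mean_length_\<mu> by simp
  finally have cm: "mean_length (conv h \<mu>) < \<infinity>" .
  \<comment> \<open>Commutation enters here: \<open>pmf_resolvent\<close> has \<mu> on the left,
    \<open>harmonic_conv\<close> needs it on the right.\<close>
  have ph: "pmf h x = p * pmf v x + (1 - p) * pmf (conv h \<mu>) x" for x
    using pmf_resolvent[of p v x] walk_law_resolvent hc by (simp add: h_def commuting_def)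
  let ?I = "\<lambda>a. \<Sum>\<^sub>\<infinity>x\<in>carrier G. of_real (pmf a x) * f x"
  have "((\<lambda>x. of_real p * (of_real (pmf v x) * f x) + of_real (1 - p) * (of_real (pmf (conv h \<mu>) x) * f x))
      has_sum (of_real p * ?I v + of_real (1 - p) * ?I (conv h \<mu>))) (carrier G)"
    by (intro has_sum_add has_sum_cmult_right has_sum_infsum
        summable_linear_growth(2)[OF vs mean_length_walk_law[OF \<open>walk_law v\<close>] f]
        summable_linear_growth(2)[OF cs cm f])
  then have "((\<lambda>x. of_real (pmf h x) * f x) has_sum (of_real p * ?I v + of_real (1 - p) * ?I (conv h \<mu>))) (carrier G)"
    by (simp add: ph algebra_simps)
  then have "?I h = of_real p * ?I v + of_real (1 - p) * ?I (conv h \<mu>)" by (rule infsumI)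
  also have "?I (conv h \<mu>) = ?I h"
    by (rule harmonic_conv[OF hs mean_length_walk_law[OF law] f harm])
  finally have "of_real p * ?I h = of_real p * ?I v" by (simp add: algebra_simps)
  then show ?case using walk_law_resolvent by (simp add: h_def)
qed

lemma harmonic_translate:
  assumes "harmonic G \<mu> f" "x \<in> carrier G"
  shows "harmonic G \<mu> (\<lambda>y. f (x \<otimes> y))"
  unfolding harmonic_def
proof (intro ballI)
  fix k assume k: "k \<in> carrier G"
  have xk: "x \<otimes> k \<in> carrier G" using assms k by simp
  have eq: "f (x \<otimes> (k \<otimes> g)) = f (x \<otimes> k \<otimes> g)" if "g \<in> carrier G" for g
    using that assms k by (simp add: m_assoc)
  show "(\<lambda>g. norm (of_real (pmf \<mu> g) * f (x \<otimes> (k \<otimes> g)))) summable_on carrier G \<and>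
      f (x \<otimes> k) = (\<Sum>\<^sub>\<infinity>g\<in>carrier G. of_real (pmf \<mu> g) * f (x \<otimes> (k \<otimes> g)))"
    using assms(1)[unfolded harmonic_def, rule_format, OF xk] by (simp add: eq cong: summable_on_cong infsum_cong)
qed

section \<open>Gradient estimate\<close>

text \<open>Weight and translation by s commute up to a factor within \<delta> exp(\<delta>) of 1.
  Hence the weighted gradient of h is the gradient of the weighted law plus a small multiple of its
  translate.\<close>

lemma weighted_kernel_difference:
  assumes h: "set_pmf h \<subseteq> carrier G" and \<delta>: "0 \<le> \<delta>" and t: "0 \<le> t" and s: "s \<in> S"
  shows "square_summable (\<lambda>y. exp (cap \<delta> t y) * (pmf h (inv s \<otimes> y) - pmf h y))"
    and "l2 (\<lambda>y. exp (cap \<delta> t y) * (pmf h (inv s \<otimes> y) - pmf h y)) \<le>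
      sqrt (energy (weighted (cap \<delta> t) h)) + \<delta> * exp \<delta> * l2 (weighted (cap \<delta> t) h)"
proof -
  let ?H = "weighted (cap \<delta> t) h"
  define T where "T y = ?H (inv s \<otimes> y)" for y
  define e where "e y = exp (cap \<delta> t y - cap \<delta> t (inv s \<otimes> y)) - 1" for y
  have sc: "s \<in> carrier G" by (rule S_carrier[OF s])
  have H: "square_summable ?H" by (rule weighted_summable(2)[OF h cap_bound[OF \<delta> t]])
  have TS: "square_summable T" unfolding T_def by (rule square_summable_translate[OF sc H])
  have eq: "exp (cap \<delta> t y) * (pmf h (inv s \<otimes> y) - pmf h y) = - (?H y - T y) + e y * T y" for y
    by (simp add: T_def e_def weighted_def algebra_simps exp_diff)
  have e: "\<bar>e y\<bar> \<le> \<delta> * exp \<delta>" if y: "y \<in> carrier G" for y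
  proof -
    have "\<bar>cap \<delta> t y - cap \<delta> t (inv s \<otimes> y)\<bar> \<le> \<delta> * real (len s)"
      using cap_lipschitz[OF \<delta>] sc y by blast
    also have "\<dots> \<le> \<delta> * 1" using len_gen[OF s] \<delta> by (intro mult_left_mono) auto
    finally have le: "\<bar>cap \<delta> t y - cap \<delta> t (inv s \<otimes> y)\<bar> \<le> \<delta>" by simp
    have "\<bar>e y\<bar> \<le> \<bar>cap \<delta> t y - cap \<delta> t (inv s \<otimes> y)\<bar> * exp \<bar>cap \<delta> t y - cap \<delta> t (inv s \<otimes> y)\<bar>"
      unfolding e_def by (rule abs_exp_minus_one_le)
    also have "\<dots> \<le> \<delta> * exp \<delta>" using le \<delta> by (intro mult_mono) auto
    finally show ?thesis .
  qed
  have D: "square_summable (\<lambda>y. - (?H y - T y))"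
    using square_summable_diff[OF H sc] by (simp add: T_def power2_commute)
  have cT: "square_summable (\<lambda>y. (\<delta> * exp \<delta>) * T y)"
    using summable_on_cmult_right[OF TS] by (simp add: power_mult_distrib)
  have eT: "\<bar>e y * T y\<bar> \<le> \<bar>(\<delta> * exp \<delta>) * T y\<bar>" if "y \<in> carrier G" for y
    using e[OF that] \<delta> by (simp add: abs_mult mult_right_mono)
  note eTs = l2norm_mono[OF cT eT]
  show "square_summable (\<lambda>y. exp (cap \<delta> t y) * (pmf h (inv s \<otimes> y) - pmf h y))"
    unfolding eq by (rule l2_add_summable[OF D eTs(1)])
  have "l2 (\<lambda>y. exp (cap \<delta> t y) * (pmf h (inv s \<otimes> y) - pmf h y)) \<le> l2 (\<lambda>y. - (?H y - T y)) + l2 (\<lambda>y. e y * T y)"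
    unfolding eq by (rule l2_triangle[OF D eTs(1)])
  also have "l2 (\<lambda>y. - (?H y - T y)) = displacement ?H s"
    by (simp add: displacement_def l2norm_def T_def power2_commute)
  also have "\<dots> \<le> sqrt (energy ?H)" by (rule displacement_gen_le[OF s])
  also have "l2 (\<lambda>y. e y * T y) \<le> \<delta> * exp \<delta> * l2 ?H"
  proof -
    have "l2 (\<lambda>y. (\<delta> * exp \<delta>) * T y) = \<delta> * exp \<delta> * l2 ?H"
      using l2_translate[OF sc, of ?H] \<delta> by (simp only: l2norm_cmult) (simp add: T_def[abs_def])
    then show ?thesis using eTs(2) by simp
  qed
  finally show "l2 (\<lambda>y. exp (cap \<delta> t y) * (pmf h (inv s \<otimes> y) - pmf h y)) \<le>
      sqrt (energy ?H) + \<delta> * exp \<delta> * l2 ?H" by simp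
qed

text \<open>At scale R = 4^J the kernel gradient gains 1/R, f has size R times L, and the volume
  from the decay sum cancels the one in the kernel bounds, so the constant does not depend on
  J.\<close>

lemma harmonic_gradient_bound:
  "\<exists>C. \<forall>f L. harmonic G \<mu> f \<longrightarrow> (\<forall>x\<in>carrier G. norm (f x) \<le> L * (1 + real (len x))) \<longrightarrow>
     (\<forall>s\<in>S. \<forall>x\<in>carrier G. norm (f (x \<otimes> s) - f x) \<le> C * L)"
proof -
  obtain c C where c: "0 < c" and C: "0 < C" and kernel: "\<forall>N. \<exists>J\<ge>N. \<exists>h. good_kernel c C J h"
    using kernel_estimate by (elim exE conjE)
  \<comment> \<open>Chosen for \<eta>(1 + u) \<le> exp(c u / 2), so that the linear growth of f is
    absorbed by half of the exponential decay.\<close>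
  define \<eta> where "\<eta> = min 1 (c / 2)"
  have \<eta>: "0 < \<eta>" "\<eta> \<le> 1" "\<eta> \<le> c / 2" using c by (auto simp: \<eta>_def)
  define C' where "C' = C * (1 + c * exp c) / \<eta>"
  \<comment> \<open>The growth bound has 4^J in place of 1, because it is applied to the translate
    of a function by x with 1 + |x| \<le> 4^J.\<close>
  have at_one: "norm (f s - f \<one>) \<le> C' * L"
    if harm: "harmonic G \<mu> f" and f: "\<And>y. y \<in> carrier G \<Longrightarrow> norm (f y) \<le> L * (4 ^ J + real (len y))"
      and s: "s \<in> S" and good: "good_kernel c C J h" for f L J s h
  proof -
    note law = conjunct1[OF good] and es = good[THEN conjunct2, THEN conjunct1]
      and ele = good[THEN conjunct2, THEN conjunct2, THEN conjunct1]
      and kl = good[THEN conjunct2, THEN conjunct2, THEN conjunct2]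
    define \<delta> where "\<delta> = c / 4 ^ J"
    have \<delta>: "0 \<le> \<delta>" "\<delta> \<le> c" using c by (auto simp: \<delta>_def field_simps)
    have v: "0 < vol J" using vol_ge_1[of J] by linarith
    have sc: "s \<in> carrier G" by (rule S_carrier[OF s])
    have "norm (f \<one>) \<le> L * 4 ^ J" using f[of \<one>] by simp
    then have "0 \<le> L * 4 ^ J" using norm_ge_zero order_trans by blast
    then have L: "0 \<le> L" using mult_neg_pos[of L "4 ^ J"] by (cases "0 \<le> L") auto
    note hset = commuting_set[OF walk_law_commuting[OF law]]
    have f1: "norm (f y) \<le> (L * 4 ^ J) * (1 + real (len y))" if "y \<in> carrier G" for y
    proof -
      have "4 ^ J + real (len y) \<le> 4 ^ J * (1 + real (len y))"
        using mult_right_mono[of 1 "4 ^ J" "real (len y)"] by (simp add: distrib_left)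
      from mult_left_mono[OF this L] f[OF that] show ?thesis by (simp add: mult.assoc)
    qed
    have fs1: "norm (f (s \<otimes> y)) \<le> (L * 4 ^ J * 2) * (1 + real (len y))" if y: "y \<in> carrier G" for y
    proof -
      have "norm (f (s \<otimes> y)) \<le> (L * 4 ^ J) * (1 + real (len (s \<otimes> y)))" using f1 sc y by simp
      also have "\<dots> \<le> (L * 4 ^ J) * (2 * (1 + real (len y)))"
        using len_mult[OF sc y] len_gen[OF s] L by (intro mult_left_mono) auto
      finally show ?thesis by (simp only: mult.assoc)
    qed
    define D where "D y = pmf h (inv s \<otimes> y) - pmf h y" for y
    have h1: "((\<lambda>y. of_real (pmf h y) * f y) has_sum f \<one>) (carrier G)"
      using has_sum_infsum[OF summable_linear_growth(2)[OF hset mean_length_walk_law[OF law] f1]]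
        harmonic_mean_value[OF law f1 harm] by simp
    have "((\<lambda>y. of_real (pmf h y) * f (s \<otimes> y)) has_sum f (s \<otimes> \<one>)) (carrier G)"
      using has_sum_infsum[OF summable_linear_growth(2)[OF hset mean_length_walk_law[OF law] fs1]]
        harmonic_mean_value[OF law fs1 harmonic_translate[OF harm sc]] by simp
    then have "((\<lambda>y. of_real (pmf h (inv s \<otimes> y)) * f (s \<otimes> (inv s \<otimes> y))) has_sum f s) (carrier G)"
      using has_sum_reindex_bij_betw[OF bij_translate[OF sc], of "\<lambda>y. of_real (pmf h y) * f (s \<otimes> y)"] sc by simp
    then have hs: "((\<lambda>y. of_real (pmf h (inv s \<otimes> y)) * f y) has_sum f s) (carrier G)"
      by (rule has_sum_cong[THEN iffD1, rotated]) (use sc in \<open>simp add: m_assoc[symmetric]\<close>)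
    have "((\<lambda>y. of_real (pmf h (inv s \<otimes> y)) * f y + - (of_real (pmf h y) * f y)) has_sum (f s + - f \<one>)) (carrier G)"
      by (intro has_sum_add hs has_sum_uminus[THEN iffD2]) (use h1 in simp)
    then have diff: "((\<lambda>y. of_real (D y) * f y) has_sum (f s - f \<one>)) (carrier G)"
      by (simp add: D_def algebra_simps)
    have fin: "(\<Sum>y\<in>F. norm (of_real (D y) * f y)) \<le> C' * L" if F: "finite F" "F \<subseteq> carrier G" for F
    proof -
      \<comment> \<open>A truncation level above every weight on F, so that \<open>cap\<close> acts
        there as the full weight while the kernel bounds, uniform in t, apply.\<close>
      define t where "t = (\<Sum>y\<in>F. \<delta> * real (len y))"
      have t: "0 \<le> t" using \<delta> by (simp add: t_def sum_nonneg)
      have tF: "cap \<delta> t y = \<delta> * real (len y)" if "y \<in> F" for y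
      proof -
        have "\<delta> * real (len y) \<le> t" unfolding t_def using that F \<delta> by (intro member_le_sum) auto
        then show ?thesis by (simp add: cap_def)
      qed
      let ?u = "\<lambda>y. exp (cap \<delta> t y) * D y" and ?w = "\<lambda>y. exp (- (\<delta> * real (len y))) * norm (f y)"
      have "(\<Sum>y\<in>F. norm (of_real (D y) * f y)) = (\<Sum>y\<in>F. \<bar>?u y\<bar> * \<bar>?w y\<bar>)"
        by (intro sum.cong) (auto simp: norm_mult abs_mult tF exp_minus)
      also have "\<dots> \<le> L2_set ?u F * L2_set ?w F" by (rule L2_set_mult_ineq)
      also have "\<dots> \<le> ((1 + c * exp c) / 4 ^ J * sqrt (C / vol J)) * (L * 4 ^ J / \<eta> * sqrt (C * vol J))"
      proof (intro mult_mono)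
        have "L2_set ?u F \<le> l2 ?u"
          unfolding L2_set_def l2norm_def D_def
          by (intro real_sqrt_le_mono finite_sum_le_infsum F weighted_kernel_difference(1)[OF hset \<delta>(1) t s]) auto
        also have "\<dots> \<le> sqrt (energy (weighted (cap \<delta> t) h)) + \<delta> * exp \<delta> * l2 (weighted (cap \<delta> t) h)"
          unfolding D_def by (rule weighted_kernel_difference(2)[OF hset \<delta>(1) t s])
        also have "\<dots> \<le> sqrt (C / vol J) / 4 ^ J + (c / 4 ^ J) * exp c * sqrt (C / vol J)"
        proof (intro add_mono mult_mono)
          have "sqrt (energy (weighted (cap \<delta> t) h)) \<le> sqrt (C / (16 ^ J * vol J))"
            using kl t by (intro real_sqrt_le_mono) (auto simp: \<delta>_def)
          also have "\<dots> = sqrt (C / vol J) / 4 ^ J"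
          proof -
            have "(16::real) ^ J = (4 ^ J)\<^sup>2" by (simp add: power2_eq_square flip: power_mult_distrib)
            then show ?thesis by (simp add: real_sqrt_divide real_sqrt_mult)
          qed
          finally show "sqrt (energy (weighted (cap \<delta> t) h)) \<le> sqrt (C / vol J) / 4 ^ J" .
          show "l2 (weighted (cap \<delta> t) h) \<le> sqrt (C / vol J)"
            using kl t by (intro real_le_rsqrt) (auto simp: \<delta>_def)
        qed (use c \<delta> in \<open>auto simp: \<delta>_def\<close>)
        also have "\<dots> = (1 + c * exp c) / 4 ^ J * sqrt (C / vol J)" by (simp add: field_simps)
        finally show "L2_set ?u F \<le> (1 + c * exp c) / 4 ^ J * sqrt (C / vol J)" .
        have "(\<Sum>y\<in>F. (?w y)\<^sup>2) \<le> (\<Sum>y\<in>F. (L * 4 ^ J / \<eta>)\<^sup>2 * exp (- (\<delta> * real (len y))))"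
        proof (rule sum_mono)
          fix y assume "y \<in> F"
          then have y: "y \<in> carrier G" using F by auto
          let ?n = "real (len y) / 4 ^ J"
          have "\<eta> * (1 + ?n) \<le> 1 + c / 2 * ?n"
            using \<eta> mult_right_mono[OF \<eta>(3), of ?n] by (simp add: distrib_left)
          also have "\<dots> \<le> exp (c / 2 * ?n)" by (rule exp_ge_add_one_self)
          also have "c / 2 * ?n = \<delta> * real (len y) / 2" by (simp add: \<delta>_def)
          finally have "1 + ?n \<le> exp (\<delta> * real (len y) / 2) / \<eta>" using \<eta> by (simp add: field_simps)
          then have "L * 4 ^ J * (1 + ?n) \<le> L * 4 ^ J * (exp (\<delta> * real (len y) / 2) / \<eta>)"
            using L by (intro mult_left_mono) auto
          moreover have "L * 4 ^ J * (1 + ?n) = L * (4 ^ J + real (len y))" by (simp add: distrib_left)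
          then have "norm (f y) \<le> L * 4 ^ J * (1 + ?n)" using f[OF y] by linarith
          ultimately have "norm (f y) \<le> L * 4 ^ J / \<eta> * exp (\<delta> * real (len y) / 2)" by simp
          then have "?w y \<le> exp (- (\<delta> * real (len y))) * (L * 4 ^ J / \<eta> * exp (\<delta> * real (len y) / 2))"
            by (intro mult_left_mono) auto
          also have "\<dots> = L * 4 ^ J / \<eta> * exp (- (\<delta> * real (len y)) / 2)"
            by (simp add: mult_ac flip: exp_add)
          finally have "(?w y)\<^sup>2 \<le> (L * 4 ^ J / \<eta> * exp (- (\<delta> * real (len y)) / 2))\<^sup>2"
            by (intro power_mono) auto
          also have "\<dots> = (L * 4 ^ J / \<eta>)\<^sup>2 * exp (- (\<delta> * real (len y)))"
            by (simp add: power_mult_distrib power2_eq_square flip: exp_add)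
          finally show "(?w y)\<^sup>2 \<le> (L * 4 ^ J / \<eta>)\<^sup>2 * exp (- (\<delta> * real (len y)))" .
        qed
        also have "\<dots> = (L * 4 ^ J / \<eta>)\<^sup>2 * (\<Sum>y\<in>F. exp (- (\<delta> * real (len y))))" by (simp add: sum_distrib_left)
        also have "\<dots> \<le> (L * 4 ^ J / \<eta>)\<^sup>2 * (C * vol J)"
          using finite_sum_le_infsum[OF es F] ele by (intro mult_left_mono) (auto simp: \<delta>_def)
        finally have "sqrt (\<Sum>y\<in>F. (?w y)\<^sup>2) \<le> sqrt ((L * 4 ^ J / \<eta>)\<^sup>2 * (C * vol J))" by (rule real_sqrt_le_mono)
        also have "\<dots> = L * 4 ^ J / \<eta> * sqrt (C * vol J)"
          using L \<eta> by (simp only: real_sqrt_mult real_sqrt_abs) simp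
        finally show "L2_set ?w F \<le> L * 4 ^ J / \<eta> * sqrt (C * vol J)" by (simp add: L2_set_def)
      qed (use L \<eta> c C v in \<open>auto simp: L2_set_def intro!: sum_nonneg\<close>)
      also have "\<dots> = (1 + c * exp c) * L / \<eta> * (sqrt (C / vol J) * sqrt (C * vol J))" by simp
      also have "sqrt (C / vol J) * sqrt (C * vol J) = C"
        using v C by (simp flip: real_sqrt_mult)
      also have "(1 + c * exp c) * L / \<eta> * C = C' * L" by (simp add: C'_def)
      finally show ?thesis .
    qed
    have ns: "(\<lambda>y. norm (of_real (D y) * f y)) summable_on carrier G"
      using fin by (intro nonneg_bdd_above_summable_on) (auto intro!: bdd_aboveI2)
    have "norm (f s - f \<one>) \<le> (\<Sum>\<^sub>\<infinity>y\<in>carrier G. norm (of_real (D y) * f y))"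
      using norm_infsum_bound[OF ns] infsumI[OF diff] by simp
    also have "\<dots> \<le> C' * L" by (rule infsum_le_finite_sums[OF ns fin])
    finally show ?thesis .
  qed
  have "norm (f (x \<otimes> s) - f x) \<le> C' * L"
    if harm: "harmonic G \<mu> f" and f: "\<And>x. x \<in> carrier G \<Longrightarrow> norm (f x) \<le> L * (1 + real (len x))"
      and s: "s \<in> S" and x: "x \<in> carrier G" for f L s x
  proof -
    \<comment> \<open>The scale depends on x but C' does not; this is why good scales are needed
      beyond every bound.\<close>
    obtain J h where J: "J \<ge> Suc (len x)" and good: "good_kernel c C J h"
      using kernel[rule_format, of "Suc (len x)"] by blast
    have "J < 4 ^ J" by (rule power_gt_expt) simp
    then have "Suc (len x) \<le> 4 ^ J" using J by linarith
    then have J4: "1 + real (len x) \<le> 4 ^ J" by (metis of_nat_Suc numeral_power_le_of_nat_cancel_iff of_nat_le_iff of_nat_numeral of_nat_power)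
    have "norm (f \<one>) \<le> L" using f[of \<one>] by simp
    then have L: "0 \<le> L" using norm_ge_zero order_trans by blast
    have "norm (f (x \<otimes> y)) \<le> L * (4 ^ J + real (len y))" if y: "y \<in> carrier G" for y
    proof -
      have "norm (f (x \<otimes> y)) \<le> L * (1 + real (len (x \<otimes> y)))" using f x y by simp
      also have "\<dots> \<le> L * (4 ^ J + real (len y))"
        using L J4 len_mult[OF x y] by (intro mult_left_mono) auto
      finally show ?thesis .
    qed
    from at_one[OF harmonic_translate[OF harm x] this s good] show ?thesis using x by simp
  qed
  then show ?thesis by blast
qed

section \<open>The two inclusions\<close>

lemma HF1_linear_growth:
  assumes "f \<in> HF1 G S \<mu>"
  shows "\<exists>L. \<forall>x\<in>carrier G. norm (f x) \<le> L * (1 + real (len x))"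
proof -
  let ?M = "\<lambda>r. Max ((\<lambda>x. norm (f x)) ` word_ball G S r)"
  have "limsup (\<lambda>r. ereal (inverse (real r) * ?M r)) < \<infinity>" using assms by (simp add: HF1_def)
  then obtain B where "limsup (\<lambda>r. ereal (inverse (real r) * ?M r)) < ereal B"
    using less_PInf_Ex_of_nat[of "limsup (\<lambda>r. ereal (inverse (real r) * ?M r))"] by auto
  from Limsup_lessD[OF this] obtain r0 where r0: "\<And>r. r \<ge> r0 \<Longrightarrow> inverse (real r) * ?M r < B"
    by (auto simp: eventually_sequentially)
  have "norm (f x) \<le> (\<bar>B\<bar> * (real r0 + 1)) * (1 + real (len x))" if x: "x \<in> carrier G" for x
  proof -
    \<comment> \<open>Large enough for the limsup bound and positive, which avoids the default value
      of the inverse at 0.\<close>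
    define r where "r = r0 + 1 + len x"
    have r: "0 < real r" by (simp add: r_def)
    have "norm (f x) \<le> ?M r"
      by (rule Max_ge[OF finite_imageI[OF finite_word_ball]]) (use x in \<open>auto simp: word_ball_def r_def\<close>)
    also have "\<dots> \<le> B * real r" using r0[of r] r by (simp add: r_def field_simps)
    also have "\<dots> \<le> \<bar>B\<bar> * ((real r0 + 1) * (1 + real (len x)))"
      by (intro mult_mono) (auto simp: r_def algebra_simps)
    finally show ?thesis by (simp add: mult.assoc)
  qed
  then show ?thesis by blast
qed

text \<open>Telescoping along a geodesic word: reading it from x multiplies by letters on the right,
  as in the Lipschitz condition.\<close>

lemma LHF_imp_HF1:
  assumes f: "f \<in> LHF G S \<mu>"
  shows "f \<in> HF1 G S \<mu>"
proof -
  obtain B where B: "\<And>s x. s \<in> S \<Longrightarrow> x \<in> carrier G \<Longrightarrow> norm (f (x \<otimes> s) - f x) \<le> B"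
    using f by (force simp: LHF_def bdd_above_def)
  have word: "norm (f (x \<otimes> wprod w) - f x) \<le> real (length w) * \<bar>B\<bar>" if "set w \<subseteq> S" "x \<in> carrier G" for w x
    using that
  proof (induction w arbitrary: x)
    case (Cons s w)
    then have s: "s \<in> S" "s \<in> carrier G" "set w \<subseteq> S" "wprod w \<in> carrier G"
      by (auto intro: S_carrier wprod_closed)
    have "norm (f (x \<otimes> s \<otimes> wprod w) - f (x \<otimes> s)) \<le> real (length w) * \<bar>B\<bar>" using Cons s by simp
    moreover have "norm (f (x \<otimes> s) - f x) \<le> \<bar>B\<bar>" using B[OF s(1) Cons.prems(2)] by linarith
    ultimately have "norm ((f (x \<otimes> s \<otimes> wprod w) - f (x \<otimes> s)) + (f (x \<otimes> s) - f x)) \<le> real (length w) * \<bar>B\<bar> + \<bar>B\<bar>"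
      using norm_triangle_mono by blast
    then show ?case using s Cons.prems by (simp add: m_assoc algebra_simps)
  qed simp
  have lin: "norm (f x) \<le> norm (f \<one>) + real (len x) * \<bar>B\<bar>" if x: "x \<in> carrier G" for x
    using word[OF geodesic(1)[OF x], of \<one>] geodesic[OF x] norm_triangle_ineq2[of "f x" "f \<one>"] x by simp
  have M: "Max ((\<lambda>x. norm (f x)) ` word_ball G S r) \<le> norm (f \<one>) + real r * \<bar>B\<bar>" for r
  proof (rule Max.boundedI)
    show "finite ((\<lambda>x. norm (f x)) ` word_ball G S r)" by (intro finite_imageI finite_word_ball)
    show "(\<lambda>x. norm (f x)) ` word_ball G S r \<noteq> {}" using one_in_ball[of r] by blast
    fix a assume "a \<in> (\<lambda>x. norm (f x)) ` word_ball G S r"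
    then obtain x where x: "a = norm (f x)" "x \<in> carrier G" "len x \<le> r" by (auto simp: word_ball_def)
    have "real (len x) * \<bar>B\<bar> \<le> real r * \<bar>B\<bar>" using x by (intro mult_right_mono) auto
    then show "a \<le> norm (f \<one>) + real r * \<bar>B\<bar>" using lin[OF x(2)] x(1) by linarith
  qed
  have "ereal (inverse (real r) * Max ((\<lambda>x. norm (f x)) ` word_ball G S r)) \<le> ereal (norm (f \<one>) + \<bar>B\<bar>)"
    if "1 \<le> r" for r
  proof -
    have "inverse (real r) * Max ((\<lambda>x. norm (f x)) ` word_ball G S r) \<le> inverse (real r) * (norm (f \<one>) + real r * \<bar>B\<bar>)"
      by (intro mult_left_mono M) simp
    also have "\<dots> = inverse (real r) * norm (f \<one>) + \<bar>B\<bar>" using that by (simp add: distrib_left mult.assoc[symmetric])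
    also have "\<dots> \<le> 1 * norm (f \<one>) + \<bar>B\<bar>"
      using that by (intro add_right_mono mult_right_mono) (auto simp: field_simps)
    finally show ?thesis by simp
  qed
  then have "limsup (\<lambda>r. ereal (inverse (real r) * Max ((\<lambda>x. norm (f x)) ` word_ball G S r))) \<le> ereal (norm (f \<one>) + \<bar>B\<bar>)"
    by (intro Limsup_bounded) (auto simp: eventually_sequentially)
  also have "\<dots> < \<infinity>" by simp
  finally show ?thesis using f by (simp add: LHF_def HF1_def)
qed

lemma HF1_eq_LHF: "HF1 G S \<mu> = LHF G S \<mu>"
proof
  show "HF1 G S \<mu> \<subseteq> LHF G S \<mu>"
  proof
    fix f assume f: "f \<in> HF1 G S \<mu>"
    obtain L where L: "\<forall>x\<in>carrier G. norm (f x) \<le> L * (1 + real (len x))"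
      using HF1_linear_growth[OF f] by blast
    obtain C where "\<forall>s\<in>S. \<forall>x\<in>carrier G. norm (f (x \<otimes> s) - f x) \<le> C * L"
      using harmonic_gradient_bound L f unfolding HF1_def by blast
    then have "bdd_above {norm (f (x \<otimes> s) - f x) | s x. s \<in> S \<and> x \<in> carrier G}"
      by (intro bdd_aboveI[of _ "C * L"]) blast
    then show "f \<in> LHF G S \<mu>" using f by (simp add: LHF_def HF1_def)
  qed
  show "LHF G S \<mu> \<subseteq> HF1 G S \<mu>" using LHF_imp_HF1 by blast
qed

end

theorem corollary3p16:
  fixes G :: "('a, 'm) monoid_scheme" and S :: "'a set" and \<mu> :: "'a pmf"
  assumes "group G"
    and "finite S" and "symmetric_generating_set G S"
    and "polynomial_growth G S"
    and "set_pmf \<mu> \<subseteq> carrier G"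
    and "adapted G \<mu>"
    and "smooth G S \<mu>"
    and "abelian_centered G \<mu>"
  shows "\<exists>T. linear_isomorphism T (HF1 G S \<mu>) (LHF G S \<mu>)"
proof -
  interpret group G by fact
  interpret centered_walk_poly G S \<mu>
    by unfold_locales fact+
  show ?thesis
    using HF1_eq_LHF by (intro exI[of _ id]) (simp add: linear_isomorphism_def)
qed

end
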